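(* Let $w$ be a strictly superexponential normalized weight and let $q\in\mathcal H^w$, $q\ne0$. Then $$|\gamma_n(q)|\le 2n\exp(-n\psi(\tilde n)),\qquad \tilde n=\frac{n}{4\|q\|_w},$$ for all integers $n\ge1$ with $n\ge4\|q\|_w$, where $$\psi(r)=\min_{m\ge1}\frac{\log\bigl(r\,w(m)\bigr)}{m}.$$
   Context: Let $S^1=\mathbb R/\mathbb Z$. A normalized weight is a function $w:\mathbb Z\to\mathbb R$, $n\mapsto w_n=w(n)$, with $w_n=w_{-n}\ge1$ for all $n$ (no submultiplicativity is assumed here). It is strictly superexponential if $\lim_{n\to\infty}\frac{\log w(n)}{n}=\infty$. For $q=\sum_{n\in\mathbb Z}q_ne^{2n\pi ix}$ put $\|q\|_w^2=\sum_{n\in\mathbb Z}w_n^2|q_n|^2$, and $\mathcal H^w=\{q\in L^2(S^1,\mathbb C):\|q\|_w<\infty\}$. The minimum in the definition of $\psi$ is over integers $m\ge1$. For complex $q\in L^2(S^1,\mathbb C)$, the periodic eigenvalues are the eigenvalues of $L=-\frac{d^2}{dx^2}+q$ on $[0,1]$ with periodic or anti-periodic boundary conditions (both types taken together; equivalently the eigenvalues of $-\frac{d^2}{dx^2}+q$ on functions of period 2), listed with algebraic multiplicity and ordered lexicographically (first by real part, then by imaginary part): $\lambda_0(q)\prec\lambda_1^-(q)\preceq\lambda_1^+(q)\prec\dots\prec\lambda_n^-(q)\preceq\lambda_n^+(q)\prec\cdots$. The gap lengths are $\gamma_n(q)=\lambda_n^+(q)-\lambda_n^-(q)$, $n\ge1$.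 *)

theory Defs
  imports "HOL-Analysis.Analysis" "HOL-Library.Function_Algebras"
begin

definition normalized_weight :: "(int \<Rightarrow> real) \<Rightarrow> bool" where
  "normalized_weight w \<longleftrightarrow> (\<forall>n. w n = w (- n) \<and> w n \<ge> 1)"

definition strictly_superexponential :: "(int \<Rightarrow> real) \<Rightarrow> bool" where
  "strictly_superexponential w \<longleftrightarrow>
     filterlim (\<lambda>n::nat. ln (w (int n)) / real n) at_top sequentially"

text \<open>
  Elements of \<open>L\<^sup>2(\<real>/T\<int>, \<complex>)\<close> are represented by \<open>T\<close>-periodic measurable functions on the line;
  two such functions that agree almost everywhere represent the same element.
\<close>

definition L2_circle :: "real \<Rightarrow> (real \<Rightarrow> complex) set" where
  "L2_circle T = {f. f \<in> borel_measurable lebesgue \<and> (\<forall>x. f (x + T) = f x) \<and>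
     integrable (lebesgue_on {0..T}) (\<lambda>x. (cmod (f x))\<^sup>2)}"

definition fourier_coeff :: "(real \<Rightarrow> complex) \<Rightarrow> int \<Rightarrow> complex" where
  "fourier_coeff q n =
     (LINT x|lebesgue_on {0..1}. q x * exp (- (2 * of_int n * of_real pi * \<i> * of_real x)))"

definition weighted_space :: "(int \<Rightarrow> real) \<Rightarrow> (real \<Rightarrow> complex) set" where
  "weighted_space w = {q \<in> L2_circle 1.
     (\<lambda>n. (w n)\<^sup>2 * (cmod (fourier_coeff q n))\<^sup>2) summable_on UNIV}"

definition weighted_norm :: "(int \<Rightarrow> real) \<Rightarrow> (real \<Rightarrow> complex) \<Rightarrow> real" where
  "weighted_norm w q = sqrt (\<Sum>\<^sub>\<infinity>n. (w n)\<^sup>2 * (cmod (fourier_coeff q n))\<^sup>2)"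

text \<open>
  \<open>f\<close> is a \<open>T\<close>-periodic function, absolutely continuous with derivative \<open>g \<in> L\<^sup>2\<close>, i.e.\ \<open>f\<close> is the
  continuous representative of an element of \<open>H\<^sup>1(\<real>/T\<int>)\<close>.
\<close>

definition has_L2_derivative :: "real \<Rightarrow> (real \<Rightarrow> complex) \<Rightarrow> (real \<Rightarrow> complex) \<Rightarrow> bool" where
  "has_L2_derivative T f g \<longleftrightarrow> (\<forall>x. f (x + T) = f x) \<and> g \<in> L2_circle T \<and>
     (\<forall>a b. a \<le> b \<longrightarrow> (g has_integral (f b - f a)) {a..b})"

text \<open>
  The graph of \<open>L = - d\<^sup>2/dx\<^sup>2 + q\<close> on functions of period \<open>2\<close>, with domain \<open>H\<^sup>2(\<real>/2\<int>)\<close>: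
  \<open>f\<close> lies in the domain and \<open>L f = g\<close> as elements of \<open>L\<^sup>2\<close>. For \<open>q\<close> of period \<open>1\<close> the space of
  functions of period \<open>2\<close> is the direct sum of the \<open>1\<close>-periodic and the \<open>1\<close>-antiperiodic functions,
  and \<open>L\<close> respects this sum, so both types of boundary conditions on \<open>[0,1]\<close> are covered.
\<close>

definition hill_graph :: "(real \<Rightarrow> complex) \<Rightarrow> (real \<Rightarrow> complex) \<Rightarrow> (real \<Rightarrow> complex) \<Rightarrow> bool" where
  "hill_graph q f g \<longleftrightarrow> (\<exists>f1 f2. has_L2_derivative 2 f f1 \<and> has_L2_derivative 2 f1 f2 \<and>
     (AE x in lebesgue. g x = - f2 x + q x * f x))"

text \<open>
  \<open>root_space q z k\<close> is the kernel of \<open>(L - z)\<^sup>k\<close>. Its elements are continuous, so they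
  represent distinct elements of \<open>L\<^sup>2\<close> and dimensions may be counted in the space of functions.
\<close>

primrec root_space :: "(real \<Rightarrow> complex) \<Rightarrow> complex \<Rightarrow> nat \<Rightarrow> (real \<Rightarrow> complex) set" where
  "root_space q z 0 = {\<lambda>x. 0}"
| "root_space q z (Suc k) =
     {f. \<exists>g \<in> root_space q z k. hill_graph q f (\<lambda>x. z * f x + g x)}"

interpretation cfun: vector_space "\<lambda>(c::complex) (f::real \<Rightarrow> complex) x. c * f x"
  by unfold_locales (auto simp: fun_eq_iff algebra_simps)

text \<open>
  The algebraic multiplicity of \<open>z\<close>; it is \<open>0\<close> when \<open>z\<close> is not an eigenvalue. The root spaces of
  \<open>L\<close> are finite-dimensional for \<open>q \<in> L\<^sup>2\<close>, so the convention that \<open>dim\<close> is \<open>0\<close> on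
  infinite-dimensional spaces plays no role.
\<close>

definition algebraic_multiplicity :: "(real \<Rightarrow> complex) \<Rightarrow> complex \<Rightarrow> nat" where
  "algebraic_multiplicity q z = cfun.dim (\<Union>k. root_space q z k)"

definition lex_le :: "complex \<Rightarrow> complex \<Rightarrow> bool" where
  "lex_le z z' \<longleftrightarrow> Re z < Re z' \<or> (Re z = Re z' \<and> Im z \<le> Im z')"

definition is_spectrum_listing :: "(real \<Rightarrow> complex) \<Rightarrow> (nat \<Rightarrow> complex) \<Rightarrow> bool" where
  "is_spectrum_listing q \<mu> \<longleftrightarrow> (\<forall>i j. i \<le> j \<longrightarrow> lex_le (\<mu> i) (\<mu> j)) \<and>
     (\<forall>z. finite {k. \<mu> k = z} \<and> card {k. \<mu> k = z} = algebraic_multiplicity q z)"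

text \<open>
  A listing is unique because \<open>lex_le\<close> is a linear order. It is indexed by
  \<open>\<lambda>\<^sub>0, \<lambda>\<^sub>1\<^sup>-, \<lambda>\<^sub>1\<^sup>+, \<lambda>\<^sub>2\<^sup>-, \<lambda>\<^sub>2\<^sup>+, \<dots>\<close> in this order.
\<close>

definition spectrum_listing :: "(real \<Rightarrow> complex) \<Rightarrow> nat \<Rightarrow> complex" where
  "spectrum_listing q = (THE \<mu>. is_spectrum_listing q \<mu>)"

definition lambda_minus :: "(real \<Rightarrow> complex) \<Rightarrow> nat \<Rightarrow> complex" where
  "lambda_minus q n = spectrum_listing q (2 * n - 1)"

definition lambda_plus :: "(real \<Rightarrow> complex) \<Rightarrow> nat \<Rightarrow> complex" where
  "lambda_plus q n = spectrum_listing q (2 * n)"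

definition gap_length :: "(real \<Rightarrow> complex) \<Rightarrow> nat \<Rightarrow> complex" where
  "gap_length q n = lambda_plus q n - lambda_minus q n"

text \<open>\<open>LEAST\<close> is the minimum; it is attained for strictly superexponential \<open>w\<close> and \<open>r > 0\<close>.\<close>

definition psi :: "(int \<Rightarrow> real) \<Rightarrow> real \<Rightarrow> real" where
  "psi w r = (LEAST y. \<exists>m::nat. m \<ge> 1 \<and> y = ln (r * w (int m)) / real m)"

end

theory Submission
  imports Defs "HOL-Computational_Algebra.Fundamental_Theorem_Algebra"
begin

text \<open>
  On Fourier coefficients (with respect to \<open>exp (\<i>\<pi>kx)\<close>) the operator is \<open>\<pi>\<^sup>2k\<^sup>2\<close> plus convolution with
  the coefficients of \<open>q\<close>. Convolution maps \<open>\<ell>\<^sup>1\<close> to \<open>\<ell>\<^sup>2\<close> with norm at most \<open>n/4\<close>, and dividing by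
  \<open>\<pi>\<^sup>2k\<^sup>2 - z\<close> maps \<open>\<ell>\<^sup>2\<close> back to \<open>\<ell>\<^sup>1\<close> by Cauchy-Schwarz; for \<open>z\<close> near \<open>\<pi>\<^sup>2n\<^sup>2\<close> the product of the two
  norms is small.

  To locate the eigenvalues with their multiplicities, a Riccati equation is solved by contraction: for
  each \<open>N \<ge> n\<close> there is an invariant subspace of dimension \<open>2N - 1\<close> that is a graph over the modes
  \<open>|k| < N\<close> and contains all root vectors for \<open>Re z \<le> \<pi>\<^sup>2N\<^sup>2 - N\<close>, while the eigenvalues on it satisfy
  \<open>Re z < \<pi>\<^sup>2(N - 1)\<^sup>2 + N\<close>. Hence \<open>\<lambda>\<^sub>n\<^sup>-\<close> and \<open>\<lambda>\<^sub>n\<^sup>+\<close> lie in the strip \<open>|Re z - \<pi>\<^sup>2n\<^sup>2| \<le> 2n\<close>.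

  The exponent \<open>a = \<psi>(n / (4\<parallel>q\<parallel>\<^sub>w))\<close> is chosen such that \<open>exp (a|m|) \<le> (n / (4\<parallel>q\<parallel>\<^sub>w)) w m\<close> for all \<open>m\<close>,
  that is, the norm of \<open>q\<close> with respect to the submultiplicative weight \<open>exp (a|m|)\<close> is at most \<open>n/4\<close>.
  In the strip, Lyapunov-Schmidt reduction to the modes \<open>\<plusminus>n\<close> leaves a 2 by 2 matrix with equal diagonal
  entries, which depend on \<open>z\<close> with a Lipschitz constant at most \<open>1/10\<close>, and with off-diagonal entries
  of size \<open>n exp (-an)\<close>, since they couple modes at distance \<open>2n\<close>.
\<close>

text \<open>Since q is only in L^2, multiplication by q need not map l^2 to itself; working with l^1
  as domain and l^2 as range avoids all questions about unbounded operators. The gap is defined by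
  positions in an ordered list, so eigenvalues below each level must be counted with algebraic
  multiplicity. The Riccati graph does this without Riesz projections or a deformation to q = 0: all
  root vectors below the level lie in one explicit finite-dimensional space, and the count is linear
  algebra there. Inside the strip multiplicity no longer matters: the final estimate holds for any
  two eigenvalues in the strip, equal or not. For complex q the 2 by 2 matrix is not Hermitian, and
  different diagonal entries would separate its eigenvalues by an amount that small off-diagonal
  entries do not control. Their equality comes from a symmetry of convolution under reflection of
  the index, without complex conjugation. All constants rest on pi^2 >= 9 and v <= n/4; the last
  step has room, as (20/9)(14/13)(n/4) < 2n.\<close>

subsection \<open>Sequences and convolution\<close>

definition ell1 :: "(int \<Rightarrow> complex) set" where
  "ell1 = {c. (\<lambda>k. norm (c k)) summable_on UNIV}"

definition ell1_norm :: "(int \<Rightarrow> complex) \<Rightarrow> real" where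
  "ell1_norm c = (\<Sum>\<^sub>\<infinity>k. norm (c k))"

text \<open>An upper bound tested on finite sets, not a norm: no summability has to be proved first,
  and the bound visibly survives pointwise limits.\<close>

definition ell2_le :: "(int \<Rightarrow> complex) \<Rightarrow> real \<Rightarrow> bool" where
  "ell2_le c C \<longleftrightarrow> (\<forall>H. finite H \<longrightarrow> L2_set (\<lambda>k. norm (c k)) H \<le> C)"

definition conv :: "(int \<Rightarrow> complex) \<Rightarrow> (int \<Rightarrow> complex) \<Rightarrow> int \<Rightarrow> complex" where
  "conv p c k = (\<Sum>\<^sub>\<infinity>j. p (k - j) * c j)"

definition single :: "int \<Rightarrow> int \<Rightarrow> complex" where
  "single l k = (if k = l then 1 else 0)"

lemma ell1_bounded:
  assumes "\<And>H. finite H \<Longrightarrow> (\<Sum>k\<in>H. norm (c k)) \<le> C"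
  shows "c \<in> ell1" and "ell1_norm c \<le> C"
proof -
  have s: "(\<lambda>k. norm (c k)) summable_on UNIV"
    by (rule nonneg_bdd_above_summable_on) (auto intro!: bdd_aboveI2 assms)
  then show "c \<in> ell1" by (simp add: ell1_def)
  show "ell1_norm c \<le> C"
    unfolding ell1_norm_def by (rule infsum_le_finite_sums[OF s]) (auto intro: assms)
qed

lemma sum_le_ell1_norm: "c \<in> ell1 \<Longrightarrow> finite H \<Longrightarrow> (\<Sum>k\<in>H. norm (c k)) \<le> ell1_norm c"
  unfolding ell1_def ell1_norm_def by (rule finite_sum_le_infsum) auto

lemma norm_le_ell1_norm: "c \<in> ell1 \<Longrightarrow> norm (c k) \<le> ell1_norm c"
  using sum_le_ell1_norm[of c "{k}"] by simp

lemma ell1_norm_nonneg: "0 \<le> ell1_norm c"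
  unfolding ell1_norm_def by (rule infsum_nonneg) auto

lemma ell1_mono:
  assumes "d \<in> ell1" "\<And>k. norm (c k) \<le> norm (d k)"
  shows "c \<in> ell1" "ell1_norm c \<le> ell1_norm d"
proof -
  have "(\<Sum>k\<in>H. norm (c k)) \<le> ell1_norm d" if "finite H" for H
    using sum_mono[of H "\<lambda>k. norm (c k)" "\<lambda>k. norm (d k)"] sum_le_ell1_norm[OF assms(1) that] assms(2)
    by fastforce
  then show "c \<in> ell1" "ell1_norm c \<le> ell1_norm d" by (auto intro: ell1_bounded)
qed

lemma
  assumes "c \<in> ell1" "d \<in> ell1"
  shows ell1_add: "(\<lambda>k. c k + d k) \<in> ell1"
    and ell1_norm_add: "ell1_norm (\<lambda>k. c k + d k) \<le> ell1_norm c + ell1_norm d"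
proof -
  have "(\<Sum>k\<in>H. norm (c k + d k)) \<le> ell1_norm c + ell1_norm d" if "finite H" for H
  proof -
    have "(\<Sum>k\<in>H. norm (c k + d k)) \<le> (\<Sum>k\<in>H. norm (c k)) + (\<Sum>k\<in>H. norm (d k))"
      unfolding sum.distrib[symmetric] by (rule sum_mono) (rule norm_triangle_ineq)
    then show ?thesis
      using sum_le_ell1_norm[OF assms(1) that] sum_le_ell1_norm[OF assms(2) that] by linarith
  qed
  then show "(\<lambda>k. c k + d k) \<in> ell1" "ell1_norm (\<lambda>k. c k + d k) \<le> ell1_norm c + ell1_norm d"
    by (auto intro: ell1_bounded)
qed

lemma
  assumes "c \<in> ell1"
  shows ell1_cmult: "(\<lambda>k. z * c k) \<in> ell1"
    and ell1_norm_cmult: "ell1_norm (\<lambda>k. z * c k) \<le> norm z * ell1_norm c"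
proof -
  have "(\<Sum>k\<in>H. norm (z * c k)) \<le> norm z * ell1_norm c" if "finite H" for H
    using mult_left_mono[OF sum_le_ell1_norm[OF assms that], of "norm z"]
    by (simp add: norm_mult sum_distrib_left)
  then show "(\<lambda>k. z * c k) \<in> ell1" "ell1_norm (\<lambda>k. z * c k) \<le> norm z * ell1_norm c"
    by (auto intro: ell1_bounded)
qed

lemma ell1_zero [simp]: "(\<lambda>k. 0) \<in> ell1" "ell1_norm (\<lambda>k. 0) = 0"
  by (auto simp: ell1_def ell1_norm_def)

lemma ell1_diff: "c \<in> ell1 \<Longrightarrow> d \<in> ell1 \<Longrightarrow> (\<lambda>k. c k - d k) \<in> ell1"
  using ell1_add[OF _ ell1_cmult[of d "-1"], of c] by simp

lemma
  assumes "finite A" "\<And>a. a \<in> A \<Longrightarrow> c a \<in> ell1"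
  shows ell1_sum: "(\<lambda>k. \<Sum>a\<in>A. u a * c a k) \<in> ell1"
    and ell1_norm_sum: "ell1_norm (\<lambda>k. \<Sum>a\<in>A. u a * c a k) \<le> (\<Sum>a\<in>A. norm (u a) * ell1_norm (c a))"
proof -
  have "(\<lambda>k. \<Sum>a\<in>A. u a * c a k) \<in> ell1 \<and>
        ell1_norm (\<lambda>k. \<Sum>a\<in>A. u a * c a k) \<le> (\<Sum>a\<in>A. norm (u a) * ell1_norm (c a))"
    using assms
  proof (induction A)
    case (insert a A)
    then have a: "(\<lambda>k. u a * c a k) \<in> ell1" "ell1_norm (\<lambda>k. u a * c a k) \<le> norm (u a) * ell1_norm (c a)"
      by (auto intro: ell1_cmult ell1_norm_cmult)
    from insert have b: "(\<lambda>k. \<Sum>a\<in>A. u a * c a k) \<in> ell1"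
      "ell1_norm (\<lambda>k. \<Sum>a\<in>A. u a * c a k) \<le> (\<Sum>a\<in>A. norm (u a) * ell1_norm (c a))" by auto
    show ?case using insert(1,2) ell1_add[OF a(1) b(1)] ell1_norm_add[OF a(1) b(1)] a(2) b(2) by simp
  qed simp
  then show "(\<lambda>k. \<Sum>a\<in>A. u a * c a k) \<in> ell1"
    "ell1_norm (\<lambda>k. \<Sum>a\<in>A. u a * c a k) \<le> (\<Sum>a\<in>A. norm (u a) * ell1_norm (c a))" by auto
qed

lemma
  assumes "finite A" "\<And>k. k \<notin> A \<Longrightarrow> c k = 0"
  shows ell1_finite_support: "c \<in> ell1"
    and ell1_norm_finite_support: "ell1_norm c = (\<Sum>k\<in>A. norm (c k))"
proof -
  have h: "((\<lambda>k. norm (c k)) has_sum (\<Sum>k\<in>A. norm (c k))) UNIV"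
    by (rule has_sum_finite_neutralI) (use assms in auto)
  show "c \<in> ell1" using h by (auto simp: ell1_def summable_on_def)
  show "ell1_norm c = (\<Sum>k\<in>A. norm (c k))" using h by (simp add: ell1_norm_def infsumI)
qed

lemma single_ell1 [simp]: "single l \<in> ell1" "ell1_norm (single l) = 1"
  using ell1_finite_support[of "{l}" "single l"] ell1_norm_finite_support[of "{l}" "single l"]
  by (auto simp: single_def)

section \<open>Bounds of l^2 type\<close>

lemma ell2_leD: "ell2_le c C \<Longrightarrow> finite H \<Longrightarrow> L2_set (\<lambda>k. norm (c k)) H \<le> C"
  by (simp add: ell2_le_def)

lemma ell2_le_norm: "ell2_le c C \<Longrightarrow> norm (c k) \<le> C"
  using ell2_leD[of c C "{k}"] by (simp add: L2_set_def)

lemma ell2_le_nonneg: "ell2_le c C \<Longrightarrow> 0 \<le> C"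
  using ell2_le_norm[of c C 0] norm_ge_zero[of "c 0"] by linarith

lemma ell2_le_mono: "ell2_le c C \<Longrightarrow> (\<And>k. norm (d k) \<le> norm (c k)) \<Longrightarrow> C \<le> D \<Longrightarrow> ell2_le d D"
  unfolding ell2_le_def by (meson L2_set_mono norm_ge_zero order_trans)

lemma L2_set_norm_sum_le:
  fixes f :: "'a \<Rightarrow> 'b \<Rightarrow> complex"
  shows "L2_set (\<lambda>k. norm (\<Sum>a\<in>A. f a k)) H \<le> (\<Sum>a\<in>A. L2_set (\<lambda>k. norm (f a k)) H)"
proof (induction A rule: infinite_finite_induct)
  case (insert a A)
  have "L2_set (\<lambda>k. norm (\<Sum>a\<in>insert a A. f a k)) H
      \<le> L2_set (\<lambda>k. norm (f a k) + norm (\<Sum>a\<in>A. f a k)) H"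
    using insert by (intro L2_set_mono) (auto intro: norm_triangle_ineq)
  also have "\<dots> \<le> L2_set (\<lambda>k. norm (f a k)) H + L2_set (\<lambda>k. norm (\<Sum>a\<in>A. f a k)) H"
    by (rule L2_set_triangle_ineq)
  finally show ?case using insert by simp
qed (auto simp: L2_set_0')

lemma ell2_le_add: "ell2_le c C \<Longrightarrow> ell2_le d D \<Longrightarrow> ell2_le (\<lambda>k. c k + d k) (C + D)"
  unfolding ell2_le_def
proof (intro allI impI)
  fix H :: "int set"
  assume a: "\<forall>H. finite H \<longrightarrow> L2_set (\<lambda>k. norm (c k)) H \<le> C"
     "\<forall>H. finite H \<longrightarrow> L2_set (\<lambda>k. norm (d k)) H \<le> D" "finite H"
  have "L2_set (\<lambda>k. norm (c k + d k)) H \<le> L2_set (\<lambda>k. norm (c k) + norm (d k)) H"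
    by (intro L2_set_mono) (auto intro: norm_triangle_ineq)
  also have "\<dots> \<le> L2_set (\<lambda>k. norm (c k)) H + L2_set (\<lambda>k. norm (d k)) H"
    by (rule L2_set_triangle_ineq)
  finally show "L2_set (\<lambda>k. norm (c k + d k)) H \<le> C + D" using a by fastforce
qed

lemma ell2_le_uminus: "ell2_le c C \<Longrightarrow> ell2_le (\<lambda>k. - c k) C"
  by (simp add: ell2_le_def)

lemma ell2_le_diff: "ell2_le c C \<Longrightarrow> ell2_le d D \<Longrightarrow> ell2_le (\<lambda>k. c k - d k) (C + D)"
  using ell2_le_add[of c C "\<lambda>k. - d k" D] by (simp add: ell2_le_uminus)

text \<open>A form of Fatou's lemma: for a finite \<open>H\<close> only finitely many coordinates
  enter, so pointwise convergence suffices. It serves both for infinite sums and for closedness of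
  balls in the fixed point argument.\<close>

lemma ell2_le_tendsto:
  assumes "F \<noteq> bot" "\<forall>\<^sub>F i in F. ell2_le (c i) C" "\<And>k. ((\<lambda>i. c i k) \<longlongrightarrow> d k) F"
  shows "ell2_le d C"
  unfolding ell2_le_def
proof (intro allI impI)
  fix H :: "int set" assume H: "finite H"
  have "((\<lambda>i. L2_set (\<lambda>k. norm (c i k)) H) \<longlongrightarrow> L2_set (\<lambda>k. norm (d k)) H) F"
    unfolding L2_set_def by (intro tendsto_intros assms)
  then show "L2_set (\<lambda>k. norm (d k)) H \<le> C"
    by (rule tendsto_upperbound)
      (use assms(1) in \<open>auto intro!: eventually_mono[OF assms(2)] simp: ell2_leD H\<close>)
qed

lemma ell2_le_shift: "ell2_le p v \<Longrightarrow> ell2_le (\<lambda>k. p (k - j)) v"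
  unfolding ell2_le_def
proof (intro allI impI)
  fix H :: "int set" assume a: "\<forall>H. finite H \<longrightarrow> L2_set (\<lambda>k. norm (p k)) H \<le> v" "finite H"
  have "L2_set (\<lambda>k. norm (p (k - j))) H = L2_set (\<lambda>k. norm (p k)) ((\<lambda>k. k - j) ` H)"
    unfolding L2_set_def by (subst sum.reindex) auto
  then show "L2_set (\<lambda>k. norm (p (k - j))) H \<le> v" using a by simp
qed

lemma ell2_le_cmult: "ell2_le p v \<Longrightarrow> ell2_le (\<lambda>k. z * p k) (norm z * v)"
  unfolding ell2_le_def by (auto simp: norm_mult L2_set_right_distrib[symmetric] intro!: mult_left_mono)

section \<open>Convolution from l^1 to l^2\<close>

lemma conv_abs_summable:
  assumes "ell2_le p v" "c \<in> ell1"
  shows "(\<lambda>j. norm (p (k - j) * c j)) summable_on UNIV"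
proof (rule Infinite_Sum.abs_summable_on_comparison_test[where g = "\<lambda>j. v * c j"])
  show "(\<lambda>j. norm (v * c j)) summable_on UNIV"
    using ell1_cmult[OF assms(2), of "of_real v"] by (simp add: ell1_def)
  show "norm (p (k - j) * c j) \<le> norm (v * c j)" for j
    using ell2_le_norm[OF assms(1), of "k - j"] by (simp add: norm_mult mult_right_mono)
qed

lemma conv_summable:
  "ell2_le p v \<Longrightarrow> c \<in> ell1 \<Longrightarrow> (\<lambda>j. p (k - j) * c j) summable_on UNIV"
  by (rule abs_summable_summable) (rule conv_abs_summable)

text \<open>Minkowski's inequality: the result is a superposition of the columns of
  \<open>K\<close>, each of l^2 size at most \<open>v\<close>, with weights \<open>c j\<close>. A
  general kernel is allowed because conjugating a convolution with weights no longer gives a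
  convolution.\<close>

lemma ell2_le_kernel:
  assumes "\<And>j. ell2_le (\<lambda>k. K k j) v" "c \<in> ell1"
  shows "ell2_le (\<lambda>k. \<Sum>\<^sub>\<infinity>j. K k j * c j) (v * ell1_norm c)"
proof (rule ell2_le_tendsto[where F = "finite_subsets_at_top UNIV" and
      c = "\<lambda>J k. \<Sum>j\<in>J. K k j * c j"])
  show "((\<lambda>J. \<Sum>j\<in>J. K k j * c j) \<longlongrightarrow> (\<Sum>\<^sub>\<infinity>j. K k j * c j)) (finite_subsets_at_top UNIV)" for k
  proof (rule infsum_tendsto, rule abs_summable_summable,
      rule Infinite_Sum.abs_summable_on_comparison_test[where g = "\<lambda>j. v * c j"])
    show "(\<lambda>j. norm (v * c j)) summable_on UNIV"
      using ell1_cmult[OF assms(2), of "of_real v"] by (simp add: ell1_def)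
    show "norm (K k j * c j) \<le> norm (v * c j)" for j
      using ell2_le_norm[OF assms(1), of k j] by (simp add: norm_mult mult_right_mono)
  qed
  have "ell2_le (\<lambda>k. \<Sum>j\<in>J. K k j * c j) (v * ell1_norm c)" if J: "finite J" for J
    unfolding ell2_le_def
  proof (intro allI impI)
    fix H :: "int set" assume H: "finite H"
    have "L2_set (\<lambda>k. norm (\<Sum>j\<in>J. K k j * c j)) H
        \<le> (\<Sum>j\<in>J. L2_set (\<lambda>k. norm (K k j * c j)) H)" by (rule L2_set_norm_sum_le)
    also have "\<dots> \<le> (\<Sum>j\<in>J. v * norm (c j))"
      using ell2_leD[OF assms(1) H]
      by (intro sum_mono) (simp add: norm_mult L2_set_left_distrib[symmetric] mult_right_mono)
    also have "\<dots> \<le> v * ell1_norm c"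
      unfolding sum_distrib_left[symmetric]
      using sum_le_ell1_norm[OF assms(2) J] ell2_le_nonneg[OF assms(1)] by (rule mult_left_mono)
    finally show "L2_set (\<lambda>k. norm (\<Sum>j\<in>J. K k j * c j)) H \<le> v * ell1_norm c" .
  qed
  then show "\<forall>\<^sub>F J in finite_subsets_at_top UNIV.
      ell2_le (\<lambda>k. \<Sum>j\<in>J. K k j * c j) (v * ell1_norm c)"
    by (auto intro: eventually_finite_subsets_at_top_weakI)
qed auto

lemma ell2_le_conv: "ell2_le p v \<Longrightarrow> c \<in> ell1 \<Longrightarrow> ell2_le (conv p c) (v * ell1_norm c)"
  unfolding conv_def[abs_def] by (intro ell2_le_kernel ell2_le_shift)

lemma ell2_le_ell1: "c \<in> ell1 \<Longrightarrow> ell2_le c (ell1_norm c)"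
  unfolding ell2_le_def
  by (intro allI impI order_trans[OF L2_set_le_sum sum_le_ell1_norm]) auto

lemma norm_conv_le:
  "ell2_le p v \<Longrightarrow> c \<in> ell1 \<Longrightarrow> norm (conv p c k) \<le> v * ell1_norm c"
  by (rule ell2_le_norm[OF ell2_le_conv])

lemma conv_add:
  assumes "ell2_le p v" "c \<in> ell1" "d \<in> ell1"
  shows "conv p (\<lambda>k. c k + d k) k = conv p c k + conv p d k"
  unfolding conv_def distrib_left
  by (rule infsum_add) (use assms in \<open>auto intro: conv_summable\<close>)

lemma conv_cmult: "conv p (\<lambda>k. z * c k) k = z * conv p c k"
  unfolding conv_def by (simp add: infsum_cmult_right'[symmetric] mult.left_commute)

lemma conv_diff:
  assumes "ell2_le p v" "c \<in> ell1" "d \<in> ell1"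
  shows "conv p (\<lambda>k. c k - d k) k = conv p c k - conv p d k"
  using conv_add[OF assms(1,2) ell1_cmult[OF assms(3), of "-1"], of k] conv_cmult[of p "-1" d k] by simp

lemma conv_sum:
  assumes "ell2_le p v" "finite A" "\<And>a. a \<in> A \<Longrightarrow> c a \<in> ell1"
  shows "conv p (\<lambda>k. \<Sum>a\<in>A. u a * c a k) k = (\<Sum>a\<in>A. u a * conv p (c a) k)"
  using assms(2,3)
proof (induction A)
  case (insert a A)
  then show ?case
    by (simp add: conv_add[OF assms(1)] ell1_cmult ell1_sum conv_cmult)
qed (simp add: conv_def)

lemma conv_single: "conv p (single l) k = p (k - l)"
proof -
  have "((\<lambda>j. p (k - j) * single l j) has_sum p (k - l)) UNIV"
    by (rule has_sum_finite_neutralI[of "{l}"]) (auto simp: single_def)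
  then show ?thesis by (simp add: conv_def infsumI)
qed

text \<open>Cauchy-Schwarz for |x_k| <= (1/d_k) |y_k|. Only a lower bound \<open>d\<close> for the
  true divisor is needed, and \<open>K\<close> collects the indices at which division takes
  place.\<close>

lemma ell1_divide:
  assumes "ell2_le y Y" "\<And>H. finite H \<Longrightarrow> H \<subseteq> K \<Longrightarrow> L2_set (\<lambda>k. 1 / d k) H \<le> s"
    and "\<And>k. k \<in> K \<Longrightarrow> 0 < d k" "\<And>k. k \<in> K \<Longrightarrow> d k * norm (x k) \<le> norm (y k)"
    and "\<And>k. k \<notin> K \<Longrightarrow> x k = 0"
  shows "x \<in> ell1" "ell1_norm x \<le> s * Y"
proof -
  have "(\<Sum>k\<in>H. norm (x k)) \<le> s * Y" if H: "finite H" for H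
  proof -
    have fin: "finite (H \<inter> K)" using H by auto
    have "(\<Sum>k\<in>H. norm (x k)) = (\<Sum>k\<in>H \<inter> K. norm (x k))"
      by (rule sum.mono_neutral_right) (use H assms(5) in auto)
    also have "\<dots> \<le> (\<Sum>k\<in>H \<inter> K. \<bar>1 / d k\<bar> * \<bar>norm (y k)\<bar>)"
    proof (rule sum_mono)
      fix k assume "k \<in> H \<inter> K"
      then show "norm (x k) \<le> \<bar>1 / d k\<bar> * \<bar>norm (y k)\<bar>"
        using assms(3)[of k] assms(4)[of k] by (simp add: field_simps)
    qed
    also have "\<dots> \<le> L2_set (\<lambda>k. 1 / d k) (H \<inter> K) * L2_set (\<lambda>k. norm (y k)) (H \<inter> K)"
      by (rule L2_set_mult_ineq)
    also have "\<dots> \<le> s * Y"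
      using assms(2)[OF fin] ell2_leD[OF assms(1) fin] order_trans[OF L2_set_nonneg assms(2)[OF fin]]
      by (intro mult_mono) auto
    finally show ?thesis .
  qed
  then show "x \<in> ell1" "ell1_norm x \<le> s * Y" by (auto intro: ell1_bounded)
qed

subsection \<open>Lattice sums\<close>

lemma sum_inverse_squares_nat: "(\<Sum>j=1..Suc M. 1 / (real j)\<^sup>2) \<le> 2 - 1 / real (Suc M)"
proof (induction M)
  case (Suc M)
  \<comment> \<open>Telescoping; the resulting bound 2 in place of pi^2/6 is good enough for all
    later constants.\<close>
  have "1 / (real (Suc (Suc M)))\<^sup>2 \<le> 1 / real (Suc M) - 1 / real (Suc (Suc M))"
  proof -
    have "1 / real (Suc M) - 1 / real (Suc (Suc M)) = 1 / (real (Suc M) * real (Suc (Suc M)))"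
      by (simp add: field_simps)
    also have "\<dots> \<ge> 1 / (real (Suc (Suc M)) * real (Suc (Suc M)))"
      by (intro divide_left_mono mult_right_mono mult_pos_pos) auto
    finally show ?thesis by (simp only: power2_eq_square)
  qed
  then show ?case using Suc by simp
qed simp

lemma sum_inverse_squares_int:
  assumes "finite H" "0 \<notin> H"
  shows "(\<Sum>j\<in>H. 1 / (real_of_int j)\<^sup>2) \<le> 4"
proof -
  define M where "M = nat (Max (insert 0 (abs ` H)))"
  have bd: "\<bar>j\<bar> \<le> int (Suc M)" if "j \<in> H" for j
  proof -
    have "\<bar>j\<bar> \<le> Max (insert 0 (abs ` H))" using that assms(1) by (intro Max_ge) auto
    then show ?thesis unfolding M_def by linarith
  qed
  have two: "(\<Sum>j=1..Suc M. 1 / (real j)\<^sup>2) \<le> 2"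
    using sum_inverse_squares_nat[of M] by (smt (verit) divide_nonneg_nonneg of_nat_0_le_iff)
  let ?A = "int ` {1..Suc M}" and ?B = "(\<lambda>j. - int j) ` {1..Suc M}"
  have "H \<subseteq> ?A \<union> ?B"
  proof
    fix j assume j: "j \<in> H"
    then have "j \<noteq> 0" using assms by auto
    then show "j \<in> ?A \<union> ?B"
      using bd[OF j] by (cases "j > 0") (auto simp: image_iff intro!: bexI[of _ "nat \<bar>j\<bar>"])
  qed
  then have "(\<Sum>j\<in>H. 1 / (real_of_int j)\<^sup>2) \<le> (\<Sum>j\<in>?A \<union> ?B. 1 / (real_of_int j)\<^sup>2)"
    by (intro sum_mono2) auto
  also have "\<dots> \<le> (\<Sum>j\<in>?A. 1 / (real_of_int j)\<^sup>2) + (\<Sum>j\<in>?B. 1 / (real_of_int j)\<^sup>2)"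
    by (subst sum_Un) (auto intro: sum_nonneg)
  also have "\<dots> \<le> 4"
    using two by (simp add: sum.reindex inj_on_def o_def)
  finally show ?thesis .
qed

text \<open>An injective relabelling \<open>f\<close> by nonzero integers reduces the sum to the
  inverse squares, whose total is at most 4; the 2 in the bound is its square root.\<close>

lemma L2_set_inverse_le:
  assumes "finite H" "inj_on f H" "0 < (c::real)" "\<And>k. k \<in> H \<Longrightarrow> f k \<noteq> (0::int)"
    and "\<And>k. k \<in> H \<Longrightarrow> d k \<ge> c * \<bar>real_of_int (f k)\<bar>"
  shows "L2_set (\<lambda>k. 1 / d k) H \<le> 2 / c"
proof -
  have "(\<Sum>k\<in>H. (1 / d k)\<^sup>2) \<le> (\<Sum>k\<in>H. (1/c)\<^sup>2 * (1 / (real_of_int (f k))\<^sup>2))"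
  proof (rule sum_mono)
    fix k assume k: "k \<in> H"
    have "1 / d k \<le> 1 / (c * \<bar>real_of_int (f k)\<bar>)"
      using assms(3,5) assms(4)[OF k] k
      by (intro divide_left_mono) (auto intro!: mult_pos_pos intro: less_le_trans[OF _ assms(5)])
    moreover have "0 \<le> d k" using assms(3) assms(5)[OF k] by (smt (verit) mult_nonneg_nonneg abs_ge_zero)
    ultimately have "(1 / d k)\<^sup>2 \<le> (1 / (c * \<bar>real_of_int (f k)\<bar>))\<^sup>2"
      by (intro power_mono) auto
    then show "(1 / d k)\<^sup>2 \<le> (1/c)\<^sup>2 * (1 / (real_of_int (f k))\<^sup>2)"
      by (simp add: power_mult_distrib power_divide)
  qed
  also have "\<dots> = (1/c)\<^sup>2 * (\<Sum>j\<in>f ` H. 1 / (real_of_int j)\<^sup>2)"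
    by (simp add: sum_distrib_left sum.reindex[OF assms(2)])
  also have "\<dots> \<le> (1/c)\<^sup>2 * 4"
    using assms(1,4) by (intro mult_left_mono sum_inverse_squares_int) auto
  also have "\<dots> = (2/c)\<^sup>2" by (simp add: power_divide)
  finally show ?thesis unfolding L2_set_def using assms(3) by (intro real_le_lsqrt) auto
qed

lemma L2_set_inverse_high:
  assumes "finite H" "H \<subseteq> {h. N \<le> \<bar>h\<bar>}" "1 \<le> (N::int)" "0 < (c::real)"
    and "\<And>h. h \<in> H \<Longrightarrow> d h \<ge> c * real_of_int (\<bar>h\<bar> - N + 1)"
  shows "L2_set (\<lambda>h. 1 / d h) H \<le> 2 / c"
\<comment> \<open>Both branches of high modes are moved up to the origin with their signs kept, so
  that |h| = N goes to 1 or -1.\<close>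
proof (rule L2_set_inverse_le[where f = "\<lambda>h. if h \<ge> 0 then h - N + 1 else h + N - 1"])
  show "inj_on (\<lambda>h. if h \<ge> 0 then h - N + 1 else h + N - 1) H"
  proof (rule inj_onI)
    fix x y assume "x \<in> H" "y \<in> H"
    then have "N \<le> \<bar>x\<bar>" "N \<le> \<bar>y\<bar>" using assms(2) by auto
    moreover assume "(if x \<ge> 0 then x - N + 1 else x + N - 1) = (if y \<ge> 0 then y - N + 1 else y + N - 1)"
    ultimately show "x = y" using assms(3) by (auto split: if_splits)
  qed
  show "(if k \<ge> 0 then k - N + 1 else k + N - 1) \<noteq> 0" if "k \<in> H" for k
    using that assms(2,3) by auto
  show "c * \<bar>real_of_int (if 0 \<le> k then k - N + 1 else k + N - 1)\<bar> \<le> d k" if "k \<in> H" for k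
  proof -
    have "\<bar>real_of_int (if 0 \<le> k then k - N + 1 else k + N - 1)\<bar> = real_of_int (\<bar>k\<bar> - N + 1)"
      using that assms(2,3) by auto
    then show ?thesis using assms(5)[OF that] by simp
  qed
qed (use assms in auto)

lemma L2_set_inverse_low:
  assumes "H \<subseteq> {l. \<bar>l\<bar> < N}" "0 < (c::real)"
    and "\<And>l. l \<in> H \<Longrightarrow> d l \<ge> c * real_of_int (N - \<bar>l\<bar>)"
  shows "L2_set (\<lambda>l. 1 / d l) H \<le> 2 / c"
\<comment> \<open>The label is the distance to the nearer edge of the block, with a sign telling the
  two halves apart.\<close>
proof (rule L2_set_inverse_le[where f = "\<lambda>l. if l \<ge> 0 then N - l else - (N + l)"])
  show "finite H" by (rule finite_subset[of _ "{-N..N}"]) (use assms(1) in fastforce, simp)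
  show "inj_on (\<lambda>l. if l \<ge> 0 then N - l else - (N + l)) H"
  proof (rule inj_onI)
    fix x y assume "x \<in> H" "y \<in> H"
    then have "\<bar>x\<bar> < N" "\<bar>y\<bar> < N" using assms(1) by auto
    moreover assume "(if x \<ge> 0 then N - x else - (N + x)) = (if y \<ge> 0 then N - y else - (N + y))"
    ultimately show "x = y" by (auto split: if_splits)
  qed
  show "(if k \<ge> 0 then N - k else - (N + k)) \<noteq> 0" if "k \<in> H" for k
    using that assms(1) by auto
  show "c * \<bar>real_of_int (if k \<ge> 0 then N - k else - (N + k))\<bar> \<le> d k" if "k \<in> H" for k
  proof -
    have "\<bar>real_of_int (if k \<ge> 0 then N - k else - (N + k))\<bar> = real_of_int (N - \<bar>k\<bar>)"
      using that assms(1) by auto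
    then show ?thesis using assms(3)[OF that] by simp
  qed
qed (use assms in auto)

text \<open>Partial fractions: \<open>1/(k\<^sup>2-n\<^sup>2) = (1/(k-n) - 1/(k+n))/(2n)\<close>.\<close>

lemma L2_set_inverse_off_diagonal:
  assumes "finite H" "H \<subseteq> {k. k \<noteq> n \<and> k \<noteq> - n}" "1 \<le> (n::int)" "0 < (c::real)"
    and d: "\<And>k. k \<in> H \<Longrightarrow> d k \<ge> c * \<bar>real_of_int (k\<^sup>2 - n\<^sup>2)\<bar>"
  shows "L2_set (\<lambda>k. 1 / d k) H \<le> 2 / (c * n)"
proof -
  have "(\<Sum>k\<in>H. (1 / d k)\<^sup>2) \<le>
      (\<Sum>k\<in>H. (1/(2*c^2*n^2)) * (1 / (real_of_int (k-n))\<^sup>2 + 1 / (real_of_int (k+n))\<^sup>2))"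
  proof (rule sum_mono)
    fix k assume k: "k \<in> H"
    define x where "x = real_of_int (k - n)"
    define y where "y = real_of_int (k + n)"
    have xy: "x \<noteq> 0" "y \<noteq> 0" "y - x = 2 * n" "real_of_int (k\<^sup>2 - n\<^sup>2) = x * y"
      using k assms(2) unfolding x_def y_def by (auto simp: power2_eq_square algebra_simps)
    have pos: "0 < c * \<bar>x * y\<bar>" using xy assms(4) by simp
    have "1 / d k \<le> 1 / (c * \<bar>x * y\<bar>)"
      using d[OF k] xy(4) pos by (intro divide_left_mono) (auto intro!: mult_pos_pos)
    moreover have "0 \<le> d k" using d[OF k] pos xy(4) by simp
    ultimately have "(1 / d k)\<^sup>2 \<le> (1 / (c * \<bar>x * y\<bar>))\<^sup>2"
      by (intro power_mono) auto
    also have "\<dots> = 1 / (c^2 * (x*y)^2)" by (simp add: power_mult_distrib power_divide)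
    also have "\<dots> = (1/(4*c^2*n^2)) * ((y - x)/(x*y))^2"
      using assms(3,4) xy by (simp add: power_divide power_mult_distrib)
    also have "(y - x)/(x*y) = 1/x - 1/y" using xy by (simp add: field_simps)
    also have "(1/x - 1/y)^2 \<le> 2 * (1/x^2 + 1/y^2)"
      using zero_le_power2[of "1/x + 1/y"] by (simp add: power2_eq_square algebra_simps)
    finally have "(1 / d k)\<^sup>2 \<le> 1/(4*c^2*n^2) * (2 * (1/x^2 + 1/y^2))"
      by (simp add: mult_left_mono divide_right_mono)
    also have "\<dots> = (1/(2*c^2*n^2)) * (1/x^2 + 1/y^2)"
    proof -
      have "1/(4*c^2*n^2) * (2 * t) = 1/(2*c^2*n^2) * t" for t by simp
      then show ?thesis .
    qed
    finally show "(1 / d k)\<^sup>2 \<le> (1/(2*c^2*n^2)) * (1 / (real_of_int (k-n))\<^sup>2 + 1 / (real_of_int (k+n))\<^sup>2)"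
      by (simp add: x_def y_def)
  qed
  also have "\<dots> = (1/(2*c^2*n^2)) * ((\<Sum>k\<in>H. 1 / (real_of_int (k-n))\<^sup>2) + (\<Sum>k\<in>H. 1 / (real_of_int (k+n))\<^sup>2))"
    by (simp only: sum_distrib_left[symmetric] sum.distrib)
  also have "(\<Sum>k\<in>H. 1 / (real_of_int (k-n))\<^sup>2) = (\<Sum>j\<in>(\<lambda>k. k - n) ` H. 1 / (real_of_int j)\<^sup>2)"
    by (simp add: sum.reindex)
  also have "(\<Sum>k\<in>H. 1 / (real_of_int (k+n))\<^sup>2) = (\<Sum>j\<in>(\<lambda>k. k + n) ` H. 1 / (real_of_int j)\<^sup>2)"
    by (simp add: sum.reindex)
  also have "(1/(2*c^2*n^2)) * ((\<Sum>j\<in>(\<lambda>k. k - n) ` H. 1 / (real_of_int j)\<^sup>2)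
      + (\<Sum>j\<in>(\<lambda>k. k + n) ` H. 1 / (real_of_int j)\<^sup>2)) \<le> (1/(2*c^2*n^2)) * (4 + 4)"
    using assms(1,2) by (intro mult_left_mono add_mono sum_inverse_squares_int) auto
  also have "\<dots> = (2/(c*n))\<^sup>2" by (simp add: power_divide power_mult_distrib)
  finally show ?thesis unfolding L2_set_def using assms(3,4) by (intro real_le_lsqrt) auto
qed

subsection \<open>A contraction principle for spaces of functions\<close>

text \<open>
  \<open>S x a\<close> is to be read as ``the norm of \<open>x\<close> is at most \<open>a\<close>''; closedness of balls under pointwise
  limits replaces completeness.
\<close>

lemma contraction_fixpoint:
  fixes S :: "('a \<Rightarrow> complex) \<Rightarrow> real \<Rightarrow> bool"
  assumes add: "\<And>x y a b. S x a \<Longrightarrow> S y b \<Longrightarrow> S (\<lambda>i. x i + y i) (a + b)"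
    and neg: "\<And>x a. S x a \<Longrightarrow> S (\<lambda>i. - x i) a"
    and point: "\<And>x a i. S x a \<Longrightarrow> norm (x i) \<le> K i * a"
    and lim: "\<And>x y a. (\<And>j::nat. S (x j) a) \<Longrightarrow> (\<And>i. (\<lambda>j. x j i) \<longlonglongrightarrow> y i) \<Longrightarrow> S y a"
    and mono: "\<And>x a b. S x a \<Longrightarrow> a \<le> b \<Longrightarrow> S x b"
    and zero: "S (\<lambda>i. 0) C" "0 \<le> C"
    and maps: "\<And>x. S x C \<Longrightarrow> S (F x) C"
    and contr: "\<And>x y a. S x C \<Longrightarrow> S y C \<Longrightarrow> S (\<lambda>i. x i - y i) a \<Longrightarrow> S (\<lambda>i. F x i - F y i) (a / 2)"
  shows "\<exists>x. S x C \<and> F x = x"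
proof -
  define x where "x i = (F ^^ i) (\<lambda>i. 0)" for i
  have x0: "x 0 = (\<lambda>i. 0)" and xS: "x (Suc i) = F (x i)" for i by (auto simp: x_def)
  have ball: "S (x i) C" for i by (induction i) (auto simp: x0 xS zero maps)
  have step: "S (\<lambda>k. x (Suc i) k - x i k) (C / 2 ^ i)" for i
  proof (induction i)
    case 0 then show ?case using ball[of 1] by (simp add: x0)
  next
    case (Suc i)
    show ?case using contr[OF ball ball Suc] by (simp add: xS mult.commute)
  qed
  \<comment> \<open>The bound is the exact geometric sum of the steps i, ..., i + j; the weaker
    2C/2^i alone would not close the induction on j.\<close>
  have tele: "S (\<lambda>k. x (i + j + 1) k - x i k) (2 * C / 2 ^ i - C / 2 ^ (i + j))" for i j
  proof (induction j)
    case 0 then show ?case using step[of i] by simp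
  next
    case (Suc j)
    have e: "2 * C / 2 ^ i - C / 2 ^ (i + j) + C / 2 ^ Suc (i + j) = 2 * C / 2 ^ i - C / 2 ^ (i + Suc j)"
      by (simp add: field_simps)
    show ?case using add[OF Suc step[of "i + j + 1"]] e by (simp add: add.commute)
  qed
  have pw: "norm (x (Suc i) k - x i k) \<le> K k * C * (1/2) ^ i" for i k
    using point[OF step[of i], of k] by (simp add: power_one_over)
  have "\<exists>l. (\<lambda>j. x j k) \<longlonglongrightarrow> l" for k
  proof -
    have "summable (\<lambda>i. x (Suc i) k - x i k)"
      by (rule summable_comparison_test'[where g = "\<lambda>i. K k * C * (1/2) ^ i" and N = 0])
        (auto intro!: summable_mult summable_geometric pw)
    then have "(\<lambda>n. \<Sum>i<n. x (Suc i) k - x i k) \<longlonglongrightarrow> suminf (\<lambda>i. x (Suc i) k - x i k)"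
      by (rule summable_LIMSEQ)
    then show ?thesis unfolding sum_lessThan_telescope[of "\<lambda>i. x i k"] by (auto simp: x0)
  qed
  then obtain y where y: "\<And>k. (\<lambda>j. x j k) \<longlonglongrightarrow> y k" by metis
  have yC: "S y C" using lim[OF ball y] .
  have neardiff: "S (\<lambda>k. y k - x i k) (2 * C / 2 ^ i)" for i
  proof (rule lim[where x = "\<lambda>j k. x (i + j + 1) k - x i k"])
    show "S (\<lambda>k. x (i + j + 1) k - x i k) (2 * C / 2 ^ i)" for j
      by (rule mono[OF tele[of i j]]) (use zero(2) in simp)
    show "(\<lambda>j. x (i + j + 1) k - x i k) \<longlonglongrightarrow> y k - x i k" for k
    proof -
      have "(\<lambda>j. x (j + (i + 1)) k) \<longlonglongrightarrow> y k" using y[of k] by (rule LIMSEQ_ignore_initial_segment)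
      then show ?thesis by (auto intro!: tendsto_intros simp: add_ac)
    qed
  qed
  \<comment> \<open>No continuity of \<open>F\<close> under pointwise limits is available. Instead F
    y is compared with F (x i) by the contraction property, and y with x (i + 1) by
    \<open>neardiff\<close>.\<close>
  have "F y k = y k" for k
  proof -
    have le: "norm (F y k - y k) \<le> K k * (2 * C) * (1/2) ^ i" for i
    proof -
      have "S (\<lambda>k. (F y k - F (x i) k) + - (y k - x (Suc i) k)) (2 * C / 2 ^ i / 2 + 2 * C / 2 ^ Suc i)"
        by (rule add[OF contr[OF yC ball neardiff] neg[OF neardiff]])
      from point[OF this, of k] show ?thesis
        by (simp add: xS power_one_over field_simps)
    qed
    have "(\<lambda>i. K k * (2 * C) * (1/2) ^ i) \<longlonglongrightarrow> K k * (2 * C) * 0"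
      by (intro tendsto_intros LIMSEQ_power_zero) auto
    then have "norm (F y k - y k) \<le> K k * (2 * C) * 0"
      by (rule LIMSEQ_le_const) (use le in blast)
    then show ?thesis by simp
  qed
  then show ?thesis using yC by (auto intro!: exI[of _ y])
qed

subsection \<open>Splitting off the low modes\<close>

text \<open>\<open>N\<close> is a cut-off level, later taken to be any integer from n on with the
  same \<open>v\<close>; hence every constant below may depend on the ratio v/N only.\<close>

locale hill_level =
  fixes p :: "int \<Rightarrow> complex" and v :: real and N :: int
  assumes p: "ell2_le p v" and N: "1 \<le> N" and vN: "4 * v \<le> real_of_int N"
begin

definition low :: "int set" where "low = {l. \<bar>l\<bar> < N}"

lemma finite_low [simp]: "finite low"
  by (rule finite_subset[of _ "{-N..N}"]) (auto simp: low_def)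

lemma v_nonneg: "0 \<le> v" using p by (rule ell2_le_nonneg)

text \<open>The difference of the unperturbed eigenvalues belonging to a high and a low
  mode.\<close>

definition spread :: "int \<Rightarrow> int \<Rightarrow> real" where
  "spread h l = pi\<^sup>2 * real_of_int (h\<^sup>2 - l\<^sup>2)"

lemma pi_squared_ge: "9 \<le> pi\<^sup>2"
  using pi_gt3 power_mono[of 3 pi 2] by simp

text \<open>From (|h| + |l|)(|h| - |l|) with first factor at least N. The two forms serve different
  sums: the first decays in h for fixed l, the second in l for fixed h.\<close>

lemma square_diff_ge:
  assumes "N \<le> \<bar>h\<bar>" "\<bar>l\<bar> < N"
  shows "N * (\<bar>h\<bar> - N + 1) \<le> h\<^sup>2 - l\<^sup>2" "N * (N - \<bar>l\<bar>) \<le> h\<^sup>2 - l\<^sup>2"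
proof -
  have e: "h\<^sup>2 - l\<^sup>2 = (\<bar>h\<bar> + \<bar>l\<bar>) * (\<bar>h\<bar> - \<bar>l\<bar>)"
    by (simp add: algebra_simps power2_eq_square flip: abs_mult)
  show "N * (\<bar>h\<bar> - N + 1) \<le> h\<^sup>2 - l\<^sup>2" "N * (N - \<bar>l\<bar>) \<le> h\<^sup>2 - l\<^sup>2"
    unfolding e using assms N by (auto intro!: mult_mono)
qed

lemma spread_ge:
  assumes "N \<le> \<bar>h\<bar>" "\<bar>l\<bar> < N"
  shows "9 * real_of_int N * real_of_int (\<bar>h\<bar> - N + 1) \<le> spread h l" "9 * real_of_int N * real_of_int (N - \<bar>l\<bar>) \<le> spread h l"
proof -
  have "9 * real_of_int x \<le> spread h l" if "x \<le> h\<^sup>2 - l\<^sup>2" "0 \<le> x" for x :: int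
  proof -
    have "real_of_int x \<le> real_of_int (h\<^sup>2 - l\<^sup>2)" using that(1) by (simp only: of_int_le_iff)
    then show ?thesis
      unfolding spread_def using that(2) pi_squared_ge by (intro mult_mono) auto
  qed
  from this[OF square_diff_ge(1)[OF assms]] this[OF square_diff_ge(2)[OF assms]]
  show "9 * real_of_int N * real_of_int (\<bar>h\<bar> - N + 1) \<le> spread h l" "9 * real_of_int N * real_of_int (N - \<bar>l\<bar>) \<le> spread h l"
    using assms N by (auto simp: mult.assoc)
qed

lemma spread_pos: "N \<le> \<bar>h\<bar> \<Longrightarrow> \<bar>l\<bar> < N \<Longrightarrow> 0 < spread h l"
  using N by (intro less_le_trans[OF _ spread_ge(2)] mult_pos_pos) auto

text \<open>
  The graph of a map from the low to the high modes is invariant if and only if its matrix \<open>X\<close>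
  solves a Riccati equation. The unknown of the fixed point problem is
  \<open>Z\<^sub>l\<^sub>h = - (h\<^sup>2 - l\<^sup>2) \<pi>\<^sup>2 X\<^sub>l\<^sub>h\<close>, measured by the largest \<open>\<ell>\<^sup>2\<close>-norm of its columns.
\<close>

definition graph_map :: "(int \<times> int \<Rightarrow> complex) \<Rightarrow> int \<Rightarrow> int \<Rightarrow> complex" where
  "graph_map Z l h = (if N \<le> \<bar>h\<bar> then - Z (l, h) / of_real (spread h l) else 0)"

definition image_column :: "(int \<times> int \<Rightarrow> complex) \<Rightarrow> int \<Rightarrow> int \<Rightarrow> complex" where
  "image_column Z l = conv p (\<lambda>k. single l k + graph_map Z l k)"

definition riccati :: "(int \<times> int \<Rightarrow> complex) \<Rightarrow> int \<times> int \<Rightarrow> complex" where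
  "riccati Z = (\<lambda>(l, h). if \<bar>l\<bar> < N \<and> N \<le> \<bar>h\<bar>
     then image_column Z l h - (\<Sum>m\<in>low. image_column Z l m * graph_map Z m h) else 0)"

definition columns_le :: "(int \<times> int \<Rightarrow> complex) \<Rightarrow> real \<Rightarrow> bool" where
  "columns_le Z a \<longleftrightarrow> (\<forall>l\<in>low. ell2_le (\<lambda>h. Z (l, h)) a) \<and>
     (\<forall>l h. \<not> (\<bar>l\<bar> < N \<and> N \<le> \<bar>h\<bar>) \<longrightarrow> Z (l, h) = 0)"

lemma columns_le_nonneg: "columns_le Z a \<Longrightarrow> 0 \<le> a"
  using N ell2_le_nonneg[of "\<lambda>h. Z (0, h)" a] by (simp add: columns_le_def low_def)

lemma graph_map_ell1:
  assumes "columns_le Z a" "l \<in> low"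
  shows "graph_map Z l \<in> ell1" "ell1_norm (graph_map Z l) \<le> 2 / (9 * real_of_int N) * a"
proof -
  have *: "ell2_le (\<lambda>h. Z (l, h)) a" using assms by (auto simp: columns_le_def)
  have l: "\<bar>l\<bar> < N" using assms(2) by (simp add: low_def)
  note d = ell1_divide[OF *, where K = "{h. N \<le> \<bar>h\<bar>}" and d = "\<lambda>h. spread h l"
      and s = "2 / (9 * real_of_int N)" and x = "graph_map Z l"]
  have 1: "L2_set (\<lambda>h. 1 / spread h l) H \<le> 2 / (9 * real_of_int N)" if "finite H" "H \<subseteq> {h. N \<le> \<bar>h\<bar>}" for H
    using that spread_ge(1)[OF _ l] N by (intro L2_set_inverse_high) auto
  have 2: "spread h l * norm (graph_map Z l h) \<le> norm (Z (l, h))" if "N \<le> \<bar>h\<bar>" for h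
    using spread_pos[OF that l] that by (simp add: graph_map_def norm_divide)
  show "graph_map Z l \<in> ell1" "ell1_norm (graph_map Z l) \<le> 2 / (9 * real_of_int N) * a"
    using d 1 2 spread_pos[OF _ l] by (auto simp: graph_map_def)
qed

text \<open>Here the decay of the divisor in l is used: column l has size at most a/(9N(N - |l|)),
  and Cauchy-Schwarz against \<open>u\<close> over the low modes gives a bound that does not grow
  with their number 2N - 1.\<close>

lemma graph_map_ell2:
  assumes "columns_le Z a" "ell2_le u U"
  shows "ell2_le (\<lambda>h. \<Sum>l\<in>low. u l * graph_map Z l h) (2 / (9 * real_of_int N) * a * U)"
  unfolding ell2_le_def
proof (intro allI impI)
  fix H :: "int set" assume H: "finite H"
  have a: "0 \<le> a" by (rule columns_le_nonneg[OF assms(1)])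
  have col: "L2_set (\<lambda>h. norm (graph_map Z l h)) H \<le> a * \<bar>1 / (9 * real_of_int N * (N - \<bar>l\<bar>))\<bar>" if l: "l \<in> low" for l
  proof -
    have lN: "\<bar>l\<bar> < N" using l by (simp add: low_def)
    have pos: "0 < 9 * real_of_int N * real_of_int (N - \<bar>l\<bar>)" using N lN by simp
    have "norm (graph_map Z l h) \<le> 1 / (9 * real_of_int N * (N - \<bar>l\<bar>)) * norm (Z (l, h))" for h
    proof (cases "N \<le> \<bar>h\<bar>")
      case True
      have "norm (graph_map Z l h) = norm (Z (l, h)) / spread h l"
        using spread_pos[OF True lN] True by (simp add: graph_map_def norm_divide)
      also have "\<dots> \<le> norm (Z (l, h)) / (9 * real_of_int N * real_of_int (N - \<bar>l\<bar>))"
        using spread_ge(2)[OF True lN]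
        by (intro divide_left_mono norm_ge_zero mult_pos_pos[OF spread_pos[OF True lN] pos])
      finally show ?thesis by simp
    qed (use pos in \<open>auto simp: graph_map_def\<close>)
    then have "L2_set (\<lambda>h. norm (graph_map Z l h)) H
        \<le> L2_set (\<lambda>h. 1 / (9 * real_of_int N * (N - \<bar>l\<bar>)) * norm (Z (l, h))) H"
      by (intro L2_set_mono) auto
    also have "\<dots> = 1 / (9 * real_of_int N * (N - \<bar>l\<bar>)) * L2_set (\<lambda>h. norm (Z (l, h))) H"
      using pos by (intro L2_set_right_distrib[symmetric]) simp
    also have "\<dots> \<le> 1 / (9 * real_of_int N * (N - \<bar>l\<bar>)) * a"
      using pos assms(1) l H by (intro mult_left_mono) (auto simp: columns_le_def ell2_leD)
    finally show ?thesis using pos by simp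
  qed
  have "L2_set (\<lambda>h. norm (\<Sum>l\<in>low. u l * graph_map Z l h)) H
      \<le> (\<Sum>l\<in>low. L2_set (\<lambda>h. norm (u l * graph_map Z l h)) H)"
    by (rule L2_set_norm_sum_le)
  also have "\<dots> = (\<Sum>l\<in>low. norm (u l) * L2_set (\<lambda>h. norm (graph_map Z l h)) H)"
    by (simp add: norm_mult L2_set_right_distrib)
  also have "\<dots> \<le> (\<Sum>l\<in>low. norm (u l) * (a * \<bar>1 / (9 * real_of_int N * (N - \<bar>l\<bar>))\<bar>))"
    by (intro sum_mono mult_left_mono col) auto
  also have "\<dots> = a * (\<Sum>l\<in>low. \<bar>norm (u l)\<bar> * \<bar>1 / (9 * real_of_int N * (N - \<bar>l\<bar>))\<bar>)"
    by (simp add: sum_distrib_left mult_ac)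
  also have "\<dots> \<le> a * (L2_set (\<lambda>l. norm (u l)) low * L2_set (\<lambda>l. 1 / (9 * real_of_int N * (N - \<bar>l\<bar>))) low)"
    using a by (intro mult_left_mono L2_set_mult_ineq)
  also have "\<dots> \<le> a * (U * (2 / (9 * real_of_int N)))"
  proof (intro mult_left_mono mult_mono a)
    show "L2_set (\<lambda>l. 1 / (9 * real_of_int N * (N - \<bar>l\<bar>))) low \<le> 2 / (9 * real_of_int N)"
      using N by (intro L2_set_inverse_low[where N = N]) (auto simp: low_def)
    show "L2_set (\<lambda>l. norm (u l)) low \<le> U" by (rule ell2_leD[OF assms(2) finite_low])
    show "0 \<le> U" by (rule ell2_le_nonneg[OF assms(2)])
  qed auto
  finally show "L2_set (\<lambda>h. norm (\<Sum>l\<in>low. u l * graph_map Z l h)) H \<le> 2 / (9 * real_of_int N) * a * U"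
    by (simp add: mult_ac)
qed

lemma scaled_v_le: "2 / (9 * real_of_int N) * v \<le> 1 / 18"
  using vN N by (simp add: field_simps)

lemma image_column_le:
  assumes "columns_le Z (2 * v)" "l \<in> low"
  shows "ell2_le (image_column Z l) (10 / 9 * v)"
proof -
  have "ell1_norm (\<lambda>k. single l k + graph_map Z l k) \<le> 1 + 1 / 9"
    using ell1_norm_add[OF single_ell1(1) graph_map_ell1(1)[OF assms], of l]
      graph_map_ell1(2)[OF assms] scaled_v_le by simp
  then show ?thesis
    unfolding image_column_def
    using v_nonneg mult_left_mono[of "ell1_norm (\<lambda>k. single l k + graph_map Z l k)" "10/9" v]
    by (intro ell2_le_mono[OF ell2_le_conv[OF p ell1_add[OF single_ell1(1) graph_map_ell1(1)[OF assms]]]])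
      (auto simp: mult_ac)
qed

lemma graph_map_diff:
  "graph_map Z l h - graph_map Z' l h = graph_map (\<lambda>i. Z i - Z' i) l h"
  by (simp add: graph_map_def diff_divide_distrib)

lemma image_column_diff:
  assumes "columns_le Z a" "columns_le Z' a'" "columns_le (\<lambda>i. Z i - Z' i) b" "l \<in> low"
  shows "ell2_le (\<lambda>k. image_column Z l k - image_column Z' l k) (b / 18)"
proof -
  have "image_column Z l k - image_column Z' l k = conv p (graph_map (\<lambda>i. Z i - Z' i) l) k" for k
    unfolding image_column_def
    by (subst conv_diff[OF p, symmetric])
      (auto simp: graph_map_diff intro!: ell1_add graph_map_ell1(1) assms)
  moreover have "v * ell1_norm (graph_map (\<lambda>i. Z i - Z' i) l) \<le> b / 18"
  proof -
    have "v * ell1_norm (graph_map (\<lambda>i. Z i - Z' i) l) \<le> v * (2 / (9 * real_of_int N) * b)"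
      by (rule mult_left_mono[OF graph_map_ell1(2)[OF assms(3,4)] v_nonneg])
    also have "\<dots> = 2 / (9 * real_of_int N) * v * b" by simp
    also have "\<dots> \<le> 1 / 18 * b"
      by (rule mult_right_mono[OF scaled_v_le columns_le_nonneg[OF assms(3)]])
    finally show ?thesis by simp
  qed
  ultimately show ?thesis
    using ell2_le_mono[OF ell2_le_conv[OF p graph_map_ell1(1)[OF assms(3,4)]]] by simp
qed

lemma columns_leI:
  assumes "\<And>l. l \<in> low \<Longrightarrow> ell2_le (f l) a" "\<And>l h. l \<in> low \<Longrightarrow> N \<le> \<bar>h\<bar> \<Longrightarrow> Z (l, h) = f l h"
    "\<And>l h. \<not> (\<bar>l\<bar> < N \<and> N \<le> \<bar>h\<bar>) \<Longrightarrow> Z (l, h) = 0"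
  shows "columns_le Z a"
  unfolding columns_le_def
proof (intro conjI ballI allI impI)
  fix l assume l: "l \<in> low"
  have "norm (Z (l, h)) \<le> norm (f l h)" for h
    using assms(2)[OF l, of h] assms(3)[of l h] by (cases "N \<le> \<bar>h\<bar>") auto
  then show "ell2_le (\<lambda>h. Z (l, h)) a" by (rule ell2_le_mono[OF assms(1)[OF l] _ order_refl])
qed (use assms(3) in blast)

lemma scaled_le: "0 \<le> a \<Longrightarrow> 2 / (9 * real_of_int N) * (2 * v) * a \<le> a / 9"
  using mult_right_mono[OF scaled_v_le, of "2 * a"] by (simp add: mult_ac)

text \<open>The linear term has size at most 10/9 v and the quadratic one a ninth of that, which
  leaves room in the ball of radius 2v.\<close>

lemma riccati_maps:
  assumes "columns_le Z (2 * v)"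
  shows "columns_le (riccati Z) (2 * v)"
proof (rule columns_leI)
  fix l assume l: "l \<in> low"
  note W = image_column_le[OF assms l]
  have "10 / 9 * v + 2 / (9 * real_of_int N) * (2 * v) * (10 / 9 * v) \<le> 2 * v"
    using scaled_le[of "10 / 9 * v"] v_nonneg by simp
  then show "ell2_le (\<lambda>h. image_column Z l h - (\<Sum>m\<in>low. image_column Z l m * graph_map Z m h)) (2 * v)"
    using ell2_le_mono[OF ell2_le_diff[OF W graph_map_ell2[OF assms W]] order_refl] by blast
qed (auto simp: riccati_def low_def)

text \<open>The difference of the quadratic terms is split so that one factor changes at a time; the
  total factor is 1/18 + 1/162 + 10/162, well below 1/2.\<close>

lemma riccati_contraction:
  assumes "columns_le Z (2 * v)" "columns_le Z' (2 * v)" "columns_le (\<lambda>i. Z i - Z' i) a"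
  shows "columns_le (\<lambda>i. riccati Z i - riccati Z' i) (a / 2)"
proof (rule columns_leI)
  fix l assume l: "l \<in> low"
  define D where "D k = image_column Z l k - image_column Z' l k" for k
  have D: "ell2_le D (a / 18)"
    unfolding D_def by (rule image_column_diff[OF assms l])
  note W = image_column_le[OF assms(2) l]
  have a: "0 \<le> a" by (rule columns_le_nonneg[OF assms(3)])
  have "2 / (9 * real_of_int N) * a * (10 / 9 * v) \<le> 10 / 162 * a"
    using mult_right_mono[OF scaled_v_le, of "10 / 9 * a"] a by (simp add: mult_ac)
  then have "a / 18 + (2 / (9 * real_of_int N) * (2 * v) * (a / 18) + 2 / (9 * real_of_int N) * a * (10 / 9 * v)) \<le> a / 2"
    using scaled_le[of "a / 18"] a by simp
  then show "ell2_le (\<lambda>h. D h - ((\<Sum>m\<in>low. D m * graph_map Z m h) +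
      (\<Sum>m\<in>low. image_column Z' l m * graph_map (\<lambda>i. Z i - Z' i) m h))) (a / 2)"
    using ell2_le_mono[OF ell2_le_diff[OF D ell2_le_add[OF graph_map_ell2[OF assms(1) D]
        graph_map_ell2[OF assms(3) W]]] order_refl] by blast
  fix h assume h: "N \<le> \<bar>h\<bar>"
  show "riccati Z (l, h) - riccati Z' (l, h) = D h - ((\<Sum>m\<in>low. D m * graph_map Z m h) +
      (\<Sum>m\<in>low. image_column Z' l m * graph_map (\<lambda>i. Z i - Z' i) m h))"
  proof -
    have "(\<Sum>m\<in>low. image_column Z l m * graph_map Z m h) - (\<Sum>m\<in>low. image_column Z' l m * graph_map Z' m h)
        = (\<Sum>m\<in>low. D m * graph_map Z m h) +
          (\<Sum>m\<in>low. image_column Z' l m * graph_map (\<lambda>i. Z i - Z' i) m h)"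
      unfolding sum.distrib[symmetric] sum_subtractf[symmetric]
      by (rule sum.cong) (auto simp: D_def graph_map_diff[symmetric] algebra_simps)
    moreover have "a - b = s \<Longrightarrow> w - a - (w' - b) = (w - w') - s" for a b s w w' :: complex by auto
    ultimately have "image_column Z l h - (\<Sum>m\<in>low. image_column Z l m * graph_map Z m h) -
        (image_column Z' l h - (\<Sum>m\<in>low. image_column Z' l m * graph_map Z' m h)) =
        D h - ((\<Sum>m\<in>low. D m * graph_map Z m h) +
          (\<Sum>m\<in>low. image_column Z' l m * graph_map (\<lambda>i. Z i - Z' i) m h))"
      unfolding D_def[of h] by blast
    then show ?thesis using l h by (simp add: riccati_def low_def)
  qed
qed (auto simp: riccati_def)

lemma riccati_fixpoint: "\<exists>Z. columns_le Z (2 * v) \<and> riccati Z = Z"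
proof (rule contraction_fixpoint[where K = "\<lambda>_. 1"])
  show "columns_le (\<lambda>i. x i + y i) (a + b)" if "columns_le x a" "columns_le y b" for x y a b
    using that by (auto simp: columns_le_def intro: ell2_le_add)
  show "columns_le (\<lambda>i. - x i) a" if "columns_le x a" for x a
    using that by (auto simp: columns_le_def intro: ell2_le_uminus)
  show "norm (x i) \<le> 1 * a" if "columns_le x a" for x a i
  proof (cases i)
    case (Pair l h)
    show ?thesis
      using that columns_le_nonneg[OF that]
      by (cases "\<bar>l\<bar> < N \<and> N \<le> \<bar>h\<bar>") (auto simp: Pair columns_le_def low_def dest: ell2_le_norm)
  qed
  show "columns_le y a" if "\<And>j::nat. columns_le (x j) a" "\<And>i. (\<lambda>j. x j i) \<longlonglongrightarrow> y i" for x y a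
    unfolding columns_le_def
  proof (intro conjI ballI allI impI)
    fix l assume "l \<in> low"
    then show "ell2_le (\<lambda>h. y (l, h)) a"
      using that by (intro ell2_le_tendsto[where F = sequentially and c = "\<lambda>j h. x j (l, h)"])
        (auto simp: columns_le_def)
  next
    fix l h assume "\<not> (\<bar>l\<bar> < N \<and> N \<le> \<bar>h\<bar>)"
    then have "x j (l, h) = 0" for j using that(1)[of j] by (auto simp: columns_le_def)
    then show "y (l, h) = 0" using that(2)[of "(l, h)"] by (simp add: LIMSEQ_const_iff)
  qed
  show "columns_le x b" if "columns_le x a" "a \<le> b" for x a b
    using that by (fastforce simp: columns_le_def ell2_le_def)
  show "columns_le (\<lambda>i. 0) (2 * v)" "0 \<le> 2 * v"
    using v_nonneg by (auto simp: columns_le_def ell2_le_def L2_set_0')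
qed (auto intro: riccati_maps riccati_contraction)

lemma invariant_graph:
  obtains X :: "int \<Rightarrow> int \<Rightarrow> complex" where
    "\<And>l h. \<bar>h\<bar> < N \<Longrightarrow> X l h = 0"
    "\<And>l. l \<in> low \<Longrightarrow> X l \<in> ell1" "\<And>l. l \<in> low \<Longrightarrow> ell1_norm (X l) \<le> 1 / 9"
    "\<And>u U. ell2_le u U \<Longrightarrow> ell2_le (\<lambda>h. \<Sum>l\<in>low. u l * X l h) (U / 9)"
    "\<And>l h. l \<in> low \<Longrightarrow> N \<le> \<bar>h\<bar> \<Longrightarrow>
       of_real (pi\<^sup>2) * (of_int h)\<^sup>2 * X l h + conv p (\<lambda>k. single l k + X l k) h =
       of_real (pi\<^sup>2) * (of_int l)\<^sup>2 * X l h + (\<Sum>m\<in>low. conv p (\<lambda>k. single l k + X l k) m * X m h)"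
proof -
  obtain Z where Z: "columns_le Z (2 * v)" "riccati Z = Z" using riccati_fixpoint by blast
  show thesis
  proof (rule that[of "graph_map Z"])
    show "ell1_norm (graph_map Z l) \<le> 1 / 9" if "l \<in> low" for l
      using graph_map_ell1(2)[OF Z(1) that] scaled_le[of 1] by simp
    show "ell2_le (\<lambda>h. \<Sum>l\<in>low. u l * graph_map Z l h) (U / 9)" if "ell2_le u U" for u U
      using ell2_le_mono[OF graph_map_ell2[OF Z(1) that] order_refl] scaled_le ell2_le_nonneg[OF that]
      by blast
    show "of_real (pi\<^sup>2) * (of_int h)\<^sup>2 * graph_map Z l h + conv p (\<lambda>k. single l k + graph_map Z l k) h =
       of_real (pi\<^sup>2) * (of_int l)\<^sup>2 * graph_map Z l h +
       (\<Sum>m\<in>low. conv p (\<lambda>k. single l k + graph_map Z l k) m * graph_map Z m h)"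
      if l: "l \<in> low" and h: "N \<le> \<bar>h\<bar>" for l h
    proof -
      have lN: "\<bar>l\<bar> < N" using l by (simp add: low_def)
      have "complex_of_real (spread h l) * graph_map Z l h = - riccati Z (l, h)"
        using spread_pos[OF h lN] h by (simp add: graph_map_def Z(2))
      also have "riccati Z (l, h) = image_column Z l h - (\<Sum>m\<in>low. image_column Z l m * graph_map Z m h)"
        using h lN by (simp add: riccati_def)
      finally have "complex_of_real (spread h l) * graph_map Z l h =
          - (image_column Z l h - (\<Sum>m\<in>low. image_column Z l m * graph_map Z m h))" .
      moreover have "complex_of_real (spread h l) = of_real (pi\<^sup>2) * (of_int h)\<^sup>2 - of_real (pi\<^sup>2) * (of_int l)\<^sup>2"
        by (simp add: spread_def right_diff_distrib)
      moreover have "x = a - b \<Longrightarrow> x * g = - (w - s) \<Longrightarrow> a * g + w = b * g + s" for x a b g w s :: complex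
        by (auto simp: left_diff_distrib algebra_simps)
      ultimately show ?thesis unfolding image_column_def by blast
    qed
  qed (auto simp: graph_map_def intro: graph_map_ell1(1)[OF Z(1)])
qed

end

section \<open>Root vectors in sequence space and the invariant graph\<close>

definition hill_op :: "(int \<Rightarrow> complex) \<Rightarrow> (int \<Rightarrow> complex) \<Rightarrow> int \<Rightarrow> complex" where
  "hill_op p c k = of_real (pi\<^sup>2) * (of_int k)\<^sup>2 * c k + conv p c k"

text \<open>The domain condition is only \<open>ell1\<close>; that the function lies in the H^2
  domain follows from the equation itself, see \<open>sequence_imp_hill_graph\<close>.\<close>

primrec root_seq :: "(int \<Rightarrow> complex) \<Rightarrow> complex \<Rightarrow> nat \<Rightarrow> (int \<Rightarrow> complex) set" where
  "root_seq p z 0 = {\<lambda>k. 0}"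
| "root_seq p z (Suc m) = {c \<in> ell1. \<exists>d\<in>root_seq p z m. \<forall>k. hill_op p c k = z * c k + d k}"

lemma hill_op_sum:
  assumes "ell2_le p v" "finite A" "\<And>a. a \<in> A \<Longrightarrow> c a \<in> ell1"
  shows "hill_op p (\<lambda>k. \<Sum>a\<in>A. u a * c a k) k = (\<Sum>a\<in>A. u a * hill_op p (c a) k)"
proof -
  have "conv p (\<lambda>k. \<Sum>a\<in>A. u a * c a k) k = (\<Sum>a\<in>A. u a * conv p (c a) k)"
    using assms by (rule conv_sum)
  then show ?thesis
    by (simp add: hill_op_def sum_distrib_left sum.distrib distrib_left mult_ac)
qed

lemma hill_op_diff:
  assumes "ell2_le p v" "c \<in> ell1" "d \<in> ell1"
  shows "hill_op p (\<lambda>k. c k - d k) k = hill_op p c k - hill_op p d k"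
  unfolding hill_op_def conv_diff[OF assms] by (simp add: algebra_simps)

lemma root_seq_ell1: "c \<in> root_seq p z m \<Longrightarrow> c \<in> ell1"
  by (cases m) auto

lemma ell1_norm_le_zero: "c \<in> ell1 \<Longrightarrow> ell1_norm c \<le> 0 \<Longrightarrow> c k = 0"
  using norm_le_ell1_norm[of c k] by (metis norm_le_zero_iff order_trans)

locale hill_invariant_graph = hill_level +
  fixes X :: "int \<Rightarrow> int \<Rightarrow> complex"
  assumes X_low: "\<bar>h\<bar> < N \<Longrightarrow> X l h = 0"
    and X_ell1: "l \<in> low \<Longrightarrow> X l \<in> ell1"
    and X_norm: "l \<in> low \<Longrightarrow> ell1_norm (X l) \<le> 1 / 9"
    and X_ell2: "ell2_le u U \<Longrightarrow> ell2_le (\<lambda>h. \<Sum>l\<in>low. u l * X l h) (U / 9)"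
    and X_riccati: "l \<in> low \<Longrightarrow> N \<le> \<bar>h\<bar> \<Longrightarrow>
       of_real (pi\<^sup>2) * (of_int h)\<^sup>2 * X l h + conv p (\<lambda>k. single l k + X l k) h =
       of_real (pi\<^sup>2) * (of_int l)\<^sup>2 * X l h + (\<Sum>m\<in>low. conv p (\<lambda>k. single l k + X l k) m * X m h)"
begin

definition Y :: "int \<Rightarrow> int \<Rightarrow> complex" where "Y l k = single l k + X l k"

text \<open>The matrix of the operator on the graph in the basis \<open>Y\<close>: for low m, entry
  (m, l) is coordinate m of the image of \<open>Y l\<close>.\<close>

definition A :: "int \<Rightarrow> int \<Rightarrow> complex" where
  "A m l = of_real (pi\<^sup>2) * (of_int l)\<^sup>2 * single l m + conv p (Y l) m"

lemma Y_ell1: "l \<in> low \<Longrightarrow> Y l \<in> ell1"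
  unfolding Y_def by (intro ell1_add single_ell1 X_ell1)

lemma Y_norm: "l \<in> low \<Longrightarrow> ell1_norm (Y l) \<le> 10 / 9"
  using ell1_norm_add[OF single_ell1(1) X_ell1[of l], of l] X_norm[of l]
  by (simp add: Y_def[abs_def])

lemma Y_low: "m \<in> low \<Longrightarrow> Y l m = single l m"
  by (simp add: Y_def X_low low_def)

lemma sum_single: "m \<in> low \<Longrightarrow> (\<Sum>l\<in>low. u l * single l m) = u m"
  by (simp add: single_def if_distrib[of "\<lambda>x. _ * x"] sum.delta' cong: if_cong)

lemma sum_Y_low: "m \<in> low \<Longrightarrow> (\<Sum>l\<in>low. u l * Y l m) = u m"
  using sum_single[of m u] by (simp add: Y_low)

lemma sum_Y_high: "N \<le> \<bar>h\<bar> \<Longrightarrow> (\<Sum>l\<in>low. u l * Y l h) = (\<Sum>l\<in>low. u l * X l h)"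
  by (rule sum.cong) (auto simp: Y_def single_def low_def)

text \<open>Invariance of the graph: on low coordinates this is the choice of \<open>A\<close>, on
  high coordinates it is the Riccati equation.\<close>

lemma hill_op_Y:
  assumes l: "l \<in> low"
  shows "hill_op p (Y l) k = (\<Sum>m\<in>low. A m l * Y m k)"
proof (cases "k \<in> low")
  case True
  then show ?thesis
    using sum_Y_low[OF True, of "\<lambda>m. A m l"] by (simp add: hill_op_def A_def Y_low single_def)
next
  case False
  then have k: "N \<le> \<bar>k\<bar>" by (simp add: low_def)
  have "k \<noteq> l" using False l by auto
  then have Yk: "Y l k = X l k" by (simp add: Y_def single_def)
  have "(\<Sum>m\<in>low. A m l * Y m k) =
      (\<Sum>m\<in>low. (of_real (pi\<^sup>2) * (of_int l)\<^sup>2 * X m k) * single m l) + (\<Sum>m\<in>low. conv p (Y l) m * X m k)"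
    unfolding sum_Y_high[OF k] A_def sum.distrib[symmetric]
    by (rule sum.cong) (auto simp: algebra_simps single_def)
  also have "(\<Sum>m\<in>low. (of_real (pi\<^sup>2) * (of_int l)\<^sup>2 * X m k) * single m l) = of_real (pi\<^sup>2) * (of_int l)\<^sup>2 * X l k"
    by (rule sum_single[OF l])
  finally show ?thesis
    using X_riccati[OF l k, folded Y_def] by (simp add: hill_op_def Yk)
qed

lemma sum_Y_ell1: "(\<lambda>k. \<Sum>l\<in>low. u l * Y l k) \<in> ell1"
  by (intro ell1_sum Y_ell1) auto

lemma hill_op_sum_Y:
  "hill_op p (\<lambda>k. \<Sum>l\<in>low. u l * Y l k) k = (\<Sum>m\<in>low. (\<Sum>l\<in>low. u l * A m l) * Y m k)"
proof -
  have "hill_op p (\<lambda>k. \<Sum>l\<in>low. u l * Y l k) k = (\<Sum>l\<in>low. u l * hill_op p (Y l) k)"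
    by (rule hill_op_sum[OF p]) (auto intro: Y_ell1)
  also have "\<dots> = (\<Sum>l\<in>low. \<Sum>m\<in>low. u l * (A m l * Y m k))"
    by (rule sum.cong) (auto simp: hill_op_Y sum_distrib_left)
  also have "\<dots> = (\<Sum>m\<in>low. \<Sum>l\<in>low. u l * (A m l * Y m k))" by (rule sum.swap)
  also have "\<dots> = (\<Sum>m\<in>low. (\<Sum>l\<in>low. u l * A m l) * Y m k)"
    by (simp add: sum_distrib_right mult.assoc)
  finally show ?thesis .
qed

text \<open>
  Modulo the invariant subspace the operator acts on the high modes, where it is injective because
  its diagonal part dominates.
\<close>

lemma high_modes_vanish:
  assumes z: "Re z \<le> pi\<^sup>2 * (of_int N)\<^sup>2 - N"
    and y: "y \<in> ell1" "\<And>l. l \<in> low \<Longrightarrow> y l = 0"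
    and e: "\<And>k. hill_op p y k - z * y k = (\<Sum>l\<in>low. e l * Y l k)"
  shows "y k = 0"
proof -
  define B where "B = v * ell1_norm y"
  have conv_y: "ell2_le (conv p y) B" unfolding B_def by (rule ell2_le_conv[OF p y(1)])
  \<comment> \<open>Since y vanishes on the low modes, the low rows of the equation determine
    \<open>e\<close>; substituting it into the high rows leaves a closed equation for y with
    right-hand side -g.\<close>
  have el: "e l = conv p y l" if "l \<in> low" for l
    using e[of l] y(2)[OF that] sum_Y_low[OF that, of e] by (simp add: hill_op_def)
  define g where "g h = conv p y h - (\<Sum>l\<in>low. conv p y l * X l h)" for h
  have g: "ell2_le g (B + B / 9)"
    unfolding g_def by (intro ell2_le_diff conv_y X_ell2)
  define d where "d h = pi\<^sup>2 * (of_int h)\<^sup>2 - Re z" for h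
  \<comment> \<open>The margin N in the hypothesis on z supplies the summand +1, without which the
    divisor could vanish at |h| = N.\<close>
  have d_ge: "N * real_of_int (\<bar>h\<bar> - N + 1) \<le> d h" if "N \<le> \<bar>h\<bar>" for h
  proof -
    have "N * (\<bar>h\<bar> - N) \<le> h\<^sup>2 - N\<^sup>2"
    proof -
      have "h\<^sup>2 - N\<^sup>2 = (\<bar>h\<bar> + N) * (\<bar>h\<bar> - N)"
        by (simp add: algebra_simps power2_eq_square flip: abs_mult)
      then show ?thesis using that N by (auto intro!: mult_right_mono)
    qed
    then have "real_of_int (N * (\<bar>h\<bar> - N)) \<le> real_of_int (h\<^sup>2 - N\<^sup>2)" by (simp only: of_int_le_iff)
    moreover have "0 \<le> real_of_int (N * (\<bar>h\<bar> - N))" using that N by simp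
    ultimately have "real_of_int (N * (\<bar>h\<bar> - N)) \<le> pi\<^sup>2 * real_of_int (h\<^sup>2 - N\<^sup>2)"
      using pi_squared_ge mult_mono[of 1 "pi\<^sup>2" "real_of_int (N * (\<bar>h\<bar> - N))" "real_of_int (h\<^sup>2 - N\<^sup>2)"] by simp
    then show ?thesis using z by (simp add: d_def algebra_simps)
  qed
  have dpos: "0 < d h" if "N \<le> \<bar>h\<bar>" for h
  proof -
    have "0 < N * real_of_int (\<bar>h\<bar> - N + 1)" using that N by (intro mult_pos_pos) auto
    then show ?thesis using d_ge[OF that] by linarith
  qed
  have dy: "d h * norm (y h) \<le> norm (g h)" if h: "N \<le> \<bar>h\<bar>" for h
  proof -
    have "(\<Sum>l\<in>low. e l * Y l h) = (\<Sum>l\<in>low. conv p y l * X l h)"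
      unfolding sum_Y_high[OF h] by (rule sum.cong) (auto simp: el)
    then have "(of_real (pi\<^sup>2 * (of_int h)\<^sup>2) - z) * y h = - g h"
      using e[of h] by (simp add: hill_op_def g_def algebra_simps)
    then have "norm (of_real (pi\<^sup>2 * (of_int h)\<^sup>2) - z) * norm (y h) = norm (g h)"
      by (metis norm_minus_cancel norm_mult)
    moreover have "d h \<le> norm (of_real (pi\<^sup>2 * (of_int h)\<^sup>2) - z)"
      using complex_Re_le_cmod[of "of_real (pi\<^sup>2 * (of_int h)\<^sup>2) - z"] by (simp add: d_def)
    ultimately show ?thesis by (metis mult_right_mono norm_ge_zero)
  qed
  have "ell1_norm y \<le> 2 / N * (B + B / 9)"
  proof (rule ell1_divide(2)[OF g, where K = "{h. N \<le> \<bar>h\<bar>}" and d = d])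
    show "L2_set (\<lambda>h. 1 / d h) H \<le> 2 / N" if "finite H" "H \<subseteq> {h. N \<le> \<bar>h\<bar>}" for H
      using that N d_ge by (intro L2_set_inverse_high) auto
    show "y k = 0" if "k \<notin> {h. N \<le> \<bar>h\<bar>}" for k using that y(2) by (auto simp: low_def)
  qed (use dy dpos in auto)
  also have "\<dots> = (20 / 9 * v / N) * ell1_norm y" by (simp add: B_def field_simps)
  \<comment> \<open>With v/N <= 1/4 the factor drops below 1, so y is forced to vanish.\<close>
  also have "\<dots> \<le> (5 / 9) * ell1_norm y"
    using vN N by (intro mult_right_mono ell1_norm_nonneg) (simp add: field_simps)
  finally have "ell1_norm y \<le> 0" by simp
  then show ?thesis by (rule ell1_norm_le_zero[OF y(1)])
qed

text \<open>Induction along the Jordan chain: c minus the graph vector with the same low part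
  vanishes on the low modes, and applying the operator minus z to it gives a vector of the graph,
  because the graph is invariant and contains d by induction. So \<open>high_modes_vanish\<close>
  applies.\<close>

lemma root_seq_in_graph:
  assumes z: "Re z \<le> pi\<^sup>2 * (of_int N)\<^sup>2 - N"
  shows "c \<in> root_seq p z m \<Longrightarrow> c k = (\<Sum>l\<in>low. c l * Y l k)"
proof (induction m arbitrary: c k)
  case (Suc m)
  then obtain d where c: "c \<in> ell1" and d: "d \<in> root_seq p z m" "\<And>k. hill_op p c k = z * c k + d k"
    by auto
  define y where "y k = c k - (\<Sum>l\<in>low. c l * Y l k)" for k
  have "y k = 0"
  proof (rule high_modes_vanish[OF z])
    show "y \<in> ell1" unfolding y_def by (intro ell1_diff c sum_Y_ell1)
    show "y l = 0" if "l \<in> low" for l using that by (simp add: y_def sum_Y_low)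
    fix k
    have "hill_op p y k = hill_op p c k - (\<Sum>m\<in>low. (\<Sum>l\<in>low. c l * A m l) * Y m k)"
      unfolding y_def hill_op_diff[OF p c sum_Y_ell1] hill_op_sum_Y ..
    moreover have "hill_op p c k = z * c k + (\<Sum>l\<in>low. d l * Y l k)"
      using d(2)[of k] Suc.IH[OF d(1), of k] by simp
    ultimately have "hill_op p y k - z * y k =
        (\<Sum>l\<in>low. d l * Y l k) - (\<Sum>m\<in>low. (\<Sum>l\<in>low. c l * A m l) * Y m k) + z * (\<Sum>l\<in>low. c l * Y l k)"
      by (simp add: y_def algebra_simps)
    also have "\<dots> = (\<Sum>m\<in>low. (d m - (\<Sum>l\<in>low. c l * A m l) + z * c m) * Y m k)"
      by (simp add: sum_distrib_left sum.distrib sum_subtractf algebra_simps)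
    finally show "hill_op p y k - z * y k = (\<Sum>m\<in>low. (d m - (\<Sum>l\<in>low. c l * A m l) + z * c m) * Y m k)" .
  qed
  then show ?case by (simp add: y_def)
qed simp

text \<open>A vector of the graph is controlled by its low part \<open>x\<close>, and for such z the
  low rows can be solved for x; the result is again a strict contraction of x into itself. The
  margin N on Re z plays the same part as in \<open>high_modes_vanish\<close>.\<close>

lemma low_eigenvalue_bound:
  assumes z: "pi\<^sup>2 * (of_int (N - 1))\<^sup>2 + N \<le> Re z"
    and c: "c = (\<lambda>k. \<Sum>l\<in>low. u l * Y l k)" and eig: "\<And>k. hill_op p c k = z * c k"
  shows "c k = 0"
proof -
  have c1: "c \<in> ell1" unfolding c by (rule sum_Y_ell1)
  have cl: "c l = u l" if "l \<in> low" for l using that by (simp add: c sum_Y_low)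
  define x where "x k = (if k \<in> low then c k else 0)" for k
  have x1: "x \<in> ell1" and xn: "ell1_norm x = (\<Sum>k\<in>low. norm (u k))"
    using ell1_finite_support[OF finite_low, of x] ell1_norm_finite_support[OF finite_low, of x] cl
    by (auto simp: x_def)
  have cn: "ell1_norm c \<le> 10 / 9 * ell1_norm x"
  proof -
    have "ell1_norm c \<le> (\<Sum>l\<in>low. norm (u l) * ell1_norm (Y l))"
      unfolding c by (rule ell1_norm_sum) (auto intro: Y_ell1)
    also have "\<dots> \<le> (\<Sum>l\<in>low. norm (u l) * (10 / 9))"
      by (intro sum_mono mult_left_mono Y_norm) auto
    finally show ?thesis unfolding xn sum_distrib_right[symmetric] by (simp add: mult.commute)
  qed
  define d where "d l = Re z - pi\<^sup>2 * (of_int l)\<^sup>2" for l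
  have d_ge: "N * real_of_int (N - \<bar>l\<bar>) \<le> d l" if "l \<in> low" for l
  proof -
    have l: "\<bar>l\<bar> < N" using that by (simp add: low_def)
    have "N * (N - 1 - \<bar>l\<bar>) \<le> 9 * ((N - 1)\<^sup>2 - l\<^sup>2)"
    proof (cases "\<bar>l\<bar> = N - 1")
      case True
      then have "l\<^sup>2 = (N - 1)\<^sup>2" by (metis power2_abs)
      with True show ?thesis by simp
    next
      case False
      have "(N - 1)\<^sup>2 - l\<^sup>2 = (N - 1 + \<bar>l\<bar>) * (N - 1 - \<bar>l\<bar>)"
        by (simp add: algebra_simps power2_eq_square flip: abs_mult)
      moreover have "N * (N - 1 - \<bar>l\<bar>) \<le> (9 * (N - 1 + \<bar>l\<bar>)) * (N - 1 - \<bar>l\<bar>)"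
        using False l by (intro mult_right_mono) auto
      ultimately show ?thesis by (simp only: mult.assoc)
    qed
    then have a: "real_of_int (N * (N - 1 - \<bar>l\<bar>)) \<le> 9 * real_of_int ((N - 1)\<^sup>2 - l\<^sup>2)"
      by (metis of_int_le_iff of_int_mult of_int_numeral)
    moreover have "0 \<le> real_of_int (N * (N - 1 - \<bar>l\<bar>))" using l N by simp
    ultimately have "9 * real_of_int ((N - 1)\<^sup>2 - l\<^sup>2) \<le> pi\<^sup>2 * real_of_int ((N - 1)\<^sup>2 - l\<^sup>2)"
      using pi_squared_ge by (intro mult_right_mono) auto
    with a have "real_of_int (N * (N - 1 - \<bar>l\<bar>)) \<le> pi\<^sup>2 * real_of_int ((N - 1)\<^sup>2 - l\<^sup>2)" by linarith
    then show ?thesis using z by (simp add: d_def algebra_simps)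
  qed
  have dpos: "0 < d l" if "l \<in> low" for l
  proof -
    have "0 < N * real_of_int (N - \<bar>l\<bar>)" using that N by (intro mult_pos_pos) (auto simp: low_def)
    then show ?thesis using d_ge[OF that] by linarith
  qed
  have dx: "d l * norm (x l) \<le> norm (conv p c l)" if l: "l \<in> low" for l
  proof -
    have "(z - of_real (pi\<^sup>2 * (of_int l)\<^sup>2)) * x l = conv p c l"
      using eig[of l] l by (simp add: hill_op_def x_def algebra_simps)
    then have "norm (z - of_real (pi\<^sup>2 * (of_int l)\<^sup>2)) * norm (x l) = norm (conv p c l)"
      by (metis norm_mult)
    moreover have "d l \<le> norm (z - of_real (pi\<^sup>2 * (of_int l)\<^sup>2))"
      using complex_Re_le_cmod[of "z - of_real (pi\<^sup>2 * (of_int l)\<^sup>2)"] by (simp add: d_def)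
    ultimately show ?thesis by (metis mult_right_mono norm_ge_zero)
  qed
  have "ell1_norm x \<le> 2 / N * (v * ell1_norm c)"
  proof (rule ell1_divide(2)[OF ell2_le_conv[OF p c1], where K = low and d = d])
    show "L2_set (\<lambda>h. 1 / d h) H \<le> 2 / N" if "finite H" "H \<subseteq> low" for H
      using that N d_ge by (intro L2_set_inverse_low) (auto simp: low_def)
  qed (use dx dpos in \<open>auto simp: x_def\<close>)
  also have "\<dots> \<le> 2 / N * (v * (10 / 9 * ell1_norm x))"
    using cn v_nonneg N by (intro mult_left_mono) auto
  also have "\<dots> = (20 / 9 * v / N) * ell1_norm x" by simp
  also have "\<dots> \<le> (5 / 9) * ell1_norm x"
    using vN N by (intro mult_right_mono ell1_norm_nonneg) (simp add: field_simps)
  finally have "ell1_norm x \<le> 0" by simp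
  then have "ell1_norm c \<le> 0" using cn by simp
  then show ?thesis by (rule ell1_norm_le_zero[OF c1])
qed

end

lemma (in hill_level) low_spectral_subspace:
  obtains Y A :: "int \<Rightarrow> int \<Rightarrow> complex" where
    "\<And>l. l \<in> low \<Longrightarrow> Y l \<in> ell1"
    "\<And>l m. l \<in> low \<Longrightarrow> m \<in> low \<Longrightarrow> Y l m = single l m"
    "\<And>u k. hill_op p (\<lambda>k. \<Sum>l\<in>low. u l * Y l k) k = (\<Sum>m\<in>low. (\<Sum>l\<in>low. u l * A m l) * Y m k)"
    "\<And>z m c k. Re z \<le> pi\<^sup>2 * (of_int N)\<^sup>2 - N \<Longrightarrow> c \<in> root_seq p z m \<Longrightarrow> c k = (\<Sum>l\<in>low. c l * Y l k)"
    "\<And>z u c k. pi\<^sup>2 * (of_int (N - 1))\<^sup>2 + N \<le> Re z \<Longrightarrow> c = (\<lambda>k. \<Sum>l\<in>low. u l * Y l k) \<Longrightarrow>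
       (\<And>k. hill_op p c k = z * c k) \<Longrightarrow> c k = 0"
proof -
  obtain X where "hill_invariant_graph p v N X"
  proof (rule invariant_graph)
    fix X
    assume "\<And>l h. \<bar>h\<bar> < N \<Longrightarrow> X l h = 0"
      "\<And>l. l \<in> low \<Longrightarrow> X l \<in> ell1" "\<And>l. l \<in> low \<Longrightarrow> ell1_norm (X l) \<le> 1 / 9"
      "\<And>u U. ell2_le u U \<Longrightarrow> ell2_le (\<lambda>h. \<Sum>l\<in>low. u l * X l h) (U / 9)"
      "\<And>l h. l \<in> low \<Longrightarrow> N \<le> \<bar>h\<bar> \<Longrightarrow>
       of_real (pi\<^sup>2) * (of_int h)\<^sup>2 * X l h + conv p (\<lambda>k. single l k + X l k) h =
       of_real (pi\<^sup>2) * (of_int l)\<^sup>2 * X l h + (\<Sum>m\<in>low. conv p (\<lambda>k. single l k + X l k) m * X m h)"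
    then have "hill_invariant_graph p v N X" by unfold_locales auto
    then show thesis using that by blast
  qed
  then interpret hill_invariant_graph p v N X .
  show thesis
    by (rule that[of Y A]) (auto intro: Y_ell1 Y_low hill_op_sum_Y root_seq_in_graph low_eigenvalue_bound)
qed

subsection \<open>Generalized eigenspaces\<close>

text \<open>The finite-dimensional space sits in the space of all functions, where multiplicities
  are defined, and \<open>T\<close> is required to be linear on \<open>E\<close> only.\<close>

locale complex_operator = vector_space scale
  for scale :: "complex \<Rightarrow> 'b::ab_group_add \<Rightarrow> 'b" (infixr "*s" 75) +
  fixes T :: "'b \<Rightarrow> 'b" and E :: "'b set" and G :: "'b set"
  assumes finite_G: "finite G" and E_span: "E = span G"
    and T_in: "x \<in> E \<Longrightarrow> T x \<in> E"
    and T_add: "x \<in> E \<Longrightarrow> y \<in> E \<Longrightarrow> T (x + y) = T x + T y"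
    and T_scale: "x \<in> E \<Longrightarrow> T (c *s x) = c *s T x"
begin

lemma subspace_E: "subspace E" by (simp add: E_span)

lemma E_closed:
  "0 \<in> E" "x \<in> E \<Longrightarrow> y \<in> E \<Longrightarrow> x + y \<in> E" "x \<in> E \<Longrightarrow> c *s x \<in> E" "x \<in> E \<Longrightarrow> y \<in> E \<Longrightarrow> x - y \<in> E"
  using subspace_E by (auto simp: subspace_0 subspace_add subspace_scale subspace_diff)

lemma T_zero: "T 0 = 0"
  using T_scale[OF E_closed(1), of 0] by simp

text \<open>This is p(T) x, evaluated by Horner's rule.\<close>

definition act :: "complex poly \<Rightarrow> 'b \<Rightarrow> 'b" where
  "act p x = fold_coeffs (\<lambda>a y. a *s x + T y) p 0"

lemma act_zero_poly [simp]: "act 0 x = 0"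
  by (simp add: act_def)

lemma act_pCons: "act (pCons a p) x = a *s x + T (act p x)"
  by (cases "a = 0 \<and> p = 0")
    (auto simp: act_def T_zero fold_coeffs_pCons_coeff_not_0_eq fold_coeffs_pCons_not_0_0_eq)

lemma act_in: "x \<in> E \<Longrightarrow> act p x \<in> E"
  by (induction p) (auto simp: act_pCons intro!: E_closed T_in)

lemma act_add_poly: "x \<in> E \<Longrightarrow> act (p + q) x = act p x + act q x"
  by (induction p q rule: poly_induct2)
    (auto simp: act_pCons T_add act_in scale_left_distrib)

lemma act_smult: "x \<in> E \<Longrightarrow> act (smult c p) x = c *s act p x"
  by (induction p) (auto simp: act_pCons T_scale act_in scale_right_distrib)

lemma act_mult: "x \<in> E \<Longrightarrow> act (p * q) x = act p (act q x)"
  by (induction p) (auto simp: act_pCons act_add_poly act_smult)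

lemma act_one [simp]: "act 1 x = x"
  by (simp add: one_pCons act_pCons T_zero)

lemma act_zero [simp]: "act p 0 = 0"
  by (induction p) (auto simp: act_pCons T_zero)

lemma act_add: "x \<in> E \<Longrightarrow> y \<in> E \<Longrightarrow> act p (x + y) = act p x + act p y"
  by (induction p) (auto simp: act_pCons T_add act_in scale_right_distrib)

lemma act_scale: "x \<in> E \<Longrightarrow> act p (c *s x) = c *s act p x"
  by (induction p) (auto simp: act_pCons T_scale act_in scale_right_distrib mult.commute)

lemma act_linear: "act [:- z, 1:] x = T x - z *s x"
  by (simp add: act_pCons T_zero)

lemma act_monom: "act (monom 1 i) x = (T ^^ i) x"
  by (induction i) (auto simp: act_pCons monom_Suc one_pCons[symmetric])

lemma act_sum_poly: "x \<in> E \<Longrightarrow> act (\<Sum>i\<in>I. f i) x = (\<Sum>i\<in>I. act (f i) x)"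
  by (induction I rule: infinite_finite_induct) (auto simp: act_add_poly)

lemma annihilating_poly:
  assumes "x \<in> E"
  shows "\<exists>p. p \<noteq> 0 \<and> act p x = 0"
proof -
  define f where "f i = (T ^^ i) x" for i
  have fE: "f i \<in> E" for i
    unfolding f_def act_monom[symmetric] by (rule act_in[OF assms])
  define I where "I = {..card G}"
  show ?thesis
  proof (cases "inj_on f I")
    \<comment> \<open>Dependence is a property of sets, so a repeated iterate has to be treated
      apart; it gives the annihilating polynomial X^i - X^j.\<close>
    case False
    then obtain i j where ij: "i \<noteq> j" "f i = f j" by (auto simp: inj_on_def)
    have "coeff (monom 1 i - monom 1 j :: complex poly) i \<noteq> 0" using ij by simp
    then have "monom 1 i - monom 1 j \<noteq> (0 :: complex poly)" by (metis coeff_0)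
    moreover have "act (monom 1 i + smult (-1) (monom 1 j)) x = 0"
      using ij by (simp add: act_add_poly[OF assms] act_smult[OF assms] act_monom f_def del: smult_minus_left)
    ultimately show ?thesis by (intro exI[of _ "monom 1 i - monom 1 j"]) simp
  next
    case True
    have "dependent (f ` I)"
    proof (rule ccontr)
      assume "independent (f ` I)"
      then have "card (f ` I) \<le> card G"
        using independent_span_bound[OF finite_G] fE E_span by auto
      then show False using card_image[OF True] by (simp add: I_def)
    qed
    then obtain u where u: "\<exists>v\<in>f ` I. u v \<noteq> 0" "(\<Sum>v\<in>f ` I. u v *s v) = 0"
      using dependent_finite[of "f ` I"] by (auto simp: I_def)
    define p where "p = (\<Sum>i\<in>I. smult (u (f i)) (monom 1 i))"
    have "act p x = (\<Sum>i\<in>I. u (f i) *s f i)"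
      unfolding p_def act_sum_poly[OF assms]
      by (rule sum.cong) (auto simp: act_smult[OF assms] act_monom f_def simp del: smult_monom)
    also have "\<dots> = 0" using u(2) by (simp add: sum.reindex[OF True])
    finally have "act p x = 0" .
    moreover have "p \<noteq> 0"
    proof -
      obtain i where i: "i \<in> I" "u (f i) \<noteq> 0" using u(1) by auto
      have "coeff p i = (\<Sum>j\<in>I. if j = i then u (f i) else 0)"
        unfolding p_def coeff_sum by (rule sum.cong) auto
      then have "coeff p i = u (f i)" using i(1) by (simp add: I_def)
      then show ?thesis using i(2) by auto
    qed
    ultimately show ?thesis by blast
  qed
qed

section \<open>Primary decomposition\<close>

definition gen_eigenspace :: "complex \<Rightarrow> 'b set" where
  "gen_eigenspace z = {x \<in> E. \<exists>k. act ([:- z, 1:] ^ k) x = 0}"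

lemma bezout_linear_power:
  fixes q :: "complex poly"
  assumes "poly q z \<noteq> 0"
  shows "\<exists>u v. u * [:- z, 1:] ^ k + v * q = 1"
proof (induction k)
  case 0
  show ?case by (intro exI[of _ 1] exI[of _ 0]) simp
next
  case (Suc k)
  then obtain u v where uv: "u * [:- z, 1:] ^ k + v * q = 1" by blast
  define a where "a = poly q z"
  \<comment> \<open>With L = X - z, the polynomial Q - L S is the constant q(z) and J its inverse,
    so the left-hand side is 1; the right-hand side is the Bezout identity for the next
    power.\<close>
  have *: "(U * M + V * Q) * (Q - L * S) * J = (- (U * S * J)) * (L * M) + ((U * M + V * (Q - L * S)) * J) * Q"
    for U M V Q L S J :: "complex poly" by (simp add: algebra_simps)
  have "[:- z, 1:] dvd q - [:a:]" by (simp add: a_def poly_eq_0_iff_dvd[symmetric])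
  then obtain s where s: "q - [:a:] = [:- z, 1:] * s" by (elim dvdE)
  have "[:a:] * [:inverse a:] = 1" using assms by (simp add: a_def one_pCons)
  moreover have "[:a:] = q - [:- z, 1:] * s" using s by (simp add: algebra_simps)
  ultimately have "1 = (u * [:- z, 1:] ^ k + v * q) * (q - [:- z, 1:] * s) * [:inverse a:]"
    using uv by simp
  also have "\<dots> = (- (u * s * [:inverse a:])) * [:- z, 1:] ^ Suc k +
      ((u * [:- z, 1:] ^ k + v * (q - [:- z, 1:] * s)) * [:inverse a:]) * q"
    unfolding power_Suc by (rule *)
  finally show ?case by metis
qed

lemma act_linear_power_zero:
  assumes "poly q z \<noteq> 0" "x \<in> E" "act ([:- z, 1:] ^ k) x = 0" "act q x = 0"
  shows "x = 0"
proof -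
  obtain u v where "u * [:- z, 1:] ^ k + v * q = 1"
    using bezout_linear_power[OF assms(1)] by blast
  then have "act (u * [:- z, 1:] ^ k + v * q) x = x" by simp
  then show ?thesis using assms by (simp add: act_add_poly act_mult)
qed

text \<open>Strong induction on the degree. A root z with its full order m splits p into coprime
  factors (X - z)^m and q; the Bezout identity writes x as a vector killed by q, of smaller degree,
  plus one killed by (X - z)^m.\<close>

lemma in_span_gen_eigenspaces:
  "p \<noteq> 0 \<Longrightarrow> x \<in> E \<Longrightarrow> act p x = 0 \<Longrightarrow> x \<in> span (\<Union>z. gen_eigenspace z)"
proof (induction "degree p" arbitrary: p x rule: less_induct)
  case less
  show ?case
  proof (cases "degree p = 0")
    case True
    then obtain a where a: "p = [:a:]" by (rule degree_eq_zeroE)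
    then have "a \<noteq> 0" "a *s x = 0" using less by (auto simp: act_pCons T_zero)
    then have "x = 0" by simp
    then show ?thesis by (simp add: span_zero)
  next
    case False
    then obtain z where z: "poly p z = 0"
      using fundamental_theorem_of_algebra[of p] by (auto simp: constant_degree)
    define m where "m = order z p"
    obtain q where q: "p = [:- z, 1:] ^ m * q" "\<not> [:- z, 1:] dvd q"
      using order_decomp[OF less(2), of z] by (auto simp: m_def)
    have m: "0 < m" using z less(2) by (simp add: m_def order_root)
    have q0: "q \<noteq> 0" using q less(2) by auto
    have "degree p = m + degree q"
      unfolding q(1) using q0 by (subst degree_mult_eq) (auto simp: degree_linear_power)
    then have deg: "degree q < degree p" using m by simp
    have "poly q z \<noteq> 0" using q(2) by (simp add: poly_eq_0_iff_dvd)
    then obtain u v where uv: "u * [:- z, 1:] ^ m + v * q = 1"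
      using bezout_linear_power by blast
    define x1 where "x1 = act (u * [:- z, 1:] ^ m) x"
    define x2 where "x2 = act (v * q) x"
    have xE: "x1 \<in> E" "x2 \<in> E" using less(3) by (auto simp: x1_def x2_def act_in)
    have "x = x1 + x2"
      unfolding x1_def x2_def by (simp only: act_add_poly[OF less(3), symmetric] uv act_one)
    moreover have "act q x1 = act u (act p x)"
      unfolding x1_def q(1) by (simp add: act_mult[OF less(3), symmetric] mult_ac)
    then have "act q x1 = 0" using less(4) by simp
    then have "x1 \<in> span (\<Union>z. gen_eigenspace z)" by (rule less(1)[OF deg q0 xE(1)])
    moreover have "act ([:- z, 1:] ^ m) x2 = act v (act p x)"
      unfolding x2_def q(1) by (simp add: act_mult[OF less(3), symmetric] mult_ac)
    then have "x2 \<in> gen_eigenspace z" using less(4) xE by (auto simp: gen_eigenspace_def)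
    then have "x2 \<in> span (\<Union>z. gen_eigenspace z)" by (auto intro: span_base)
    ultimately show ?thesis by (simp add: span_add)
  qed
qed

lemma subspace_gen_eigenspace: "subspace (gen_eigenspace z)"
proof (rule subspaceI)
  show "0 \<in> gen_eigenspace z" by (auto simp: gen_eigenspace_def E_closed)
  fix x y assume "x \<in> gen_eigenspace z" "y \<in> gen_eigenspace z"
  then obtain k l where xy: "x \<in> E" "y \<in> E" and "act ([:- z, 1:] ^ k) x = 0" "act ([:- z, 1:] ^ l) y = 0"
    by (auto simp: gen_eigenspace_def)
  then have "act ([:- z, 1:] ^ (l + k)) x = 0" "act ([:- z, 1:] ^ (k + l)) y = 0"
    by (auto simp only: power_add act_mult act_zero)
  then have "act ([:- z, 1:] ^ (l + k)) (x + y) = 0" using xy by (simp add: act_add add.commute)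
  then show "x + y \<in> gen_eigenspace z" using xy by (auto simp: gen_eigenspace_def E_closed)
next
  fix c x assume "x \<in> gen_eigenspace z"
  then show "c *s x \<in> gen_eigenspace z"
    by (auto simp: gen_eigenspace_def act_scale E_closed)
qed

lemma gen_eigenspace_disjoint:
  assumes "x \<in> gen_eigenspace z" "x \<in> span (\<Union>y\<in>-{z}. gen_eigenspace y)"
  shows "x = 0"
proof -
  \<comment> \<open>A subspace containing every generalized eigenspace except the one at z, and by
    coprimality meeting that one only in 0.\<close>
  define S where "S = {x \<in> E. \<exists>q. poly q z \<noteq> 0 \<and> act q x = 0}"
  have "subspace S"
  proof (rule subspaceI)
    show "0 \<in> S" by (auto simp: S_def E_closed intro: exI[of _ 1])
    fix x y assume "x \<in> S" "y \<in> S"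
    then obtain p q where xy: "x \<in> E" "y \<in> E" and pq: "poly p z \<noteq> 0" "act p x = 0" "poly q z \<noteq> 0" "act q y = 0"
      by (auto simp: S_def)
    then have "act (q * p) x = 0" "act (p * q) y = 0" by (auto simp only: act_mult act_zero)
    then have "act (p * q) (x + y) = 0" using xy by (simp add: act_add mult.commute)
    then show "x + y \<in> S" using xy pq by (auto simp: S_def E_closed intro!: exI[of _ "p * q"])
  next
    fix c x assume "x \<in> S"
    then show "c *s x \<in> S" by (auto simp: S_def act_scale E_closed)
  qed
  moreover have "(\<Union>y\<in>-{z}. gen_eigenspace y) \<subseteq> S"
  proof
    fix x assume "x \<in> (\<Union>y\<in>-{z}. gen_eigenspace y)"
    then obtain y k where "y \<noteq> z" "x \<in> E" "act ([:- y, 1:] ^ k) x = 0"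
      by (auto simp: gen_eigenspace_def)
    then show "x \<in> S" by (auto simp: S_def intro!: exI[of _ "[:- y, 1:] ^ k"])
  qed
  ultimately have "x \<in> S" using assms(2) span_minimal by blast
  then obtain q where q: "poly q z \<noteq> 0" "act q x = 0" by (auto simp: S_def)
  obtain k where k: "x \<in> E" "act ([:- z, 1:] ^ k) x = 0" using assms(1) by (auto simp: gen_eigenspace_def)
  show ?thesis by (rule act_linear_power_zero[OF q(1) k q(2)])
qed

text \<open>The last nonzero vector of the chain x, (T - z) x, (T - z)^2 x, ... is an
  eigenvector.\<close>

lemma gen_eigenspace_zero_or_eigenvector:
  assumes "x \<in> gen_eigenspace z" "x \<noteq> 0"
  shows "\<exists>y\<in>E. y \<noteq> 0 \<and> T y = z *s y"
proof -
  obtain k where "x \<in> E" "act ([:- z, 1:] ^ k) x = 0" using assms(1) by (auto simp: gen_eigenspace_def)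
  then show ?thesis using assms(2)
  proof (induction k arbitrary: x)
    case (Suc k)
    show ?case
    proof (cases "act [:- z, 1:] x = 0")
      case True
      then show ?thesis using Suc by (auto simp: act_linear)
    next
      case False
      have "act ([:- z, 1:] ^ k) (act [:- z, 1:] x) = 0"
        using Suc(3) unfolding act_mult[OF Suc(2), symmetric] by (simp add: power_Suc2 del: power_Suc)
      then show ?thesis using Suc.IH[OF act_in[OF Suc(2)]] False by blast
    qed
  qed simp
qed

theorem sum_dim_gen_eigenspaces:
  "finite {z. dim (gen_eigenspace z) \<noteq> 0}"
  "(\<Sum>z | dim (gen_eigenspace z) \<noteq> 0. dim (gen_eigenspace z)) = dim E"
proof -
  let ?U = "\<Union>z. gen_eigenspace z"
  have UE: "?U \<subseteq> E" by (auto simp: gen_eigenspace_def)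
  \<comment> \<open>A basis adapted to the decomposition: its members are taken from the generalized
    eigenspaces, and its parts \<open>D z\<close> turn out to be bases of them.\<close>
  obtain B where B: "B \<subseteq> ?U" "independent B" "?U \<subseteq> span B"
    using maximal_independent_subset[of ?U] by blast
  have E: "span B = E"
  proof
    show "span B \<subseteq> E" using B(1) UE subspace_E by (intro span_minimal) auto
    show "E \<subseteq> span B"
    proof
      fix x assume x: "x \<in> E"
      then obtain p where "p \<noteq> 0" "act p x = 0" using annihilating_poly by blast
      then have "x \<in> span ?U" using in_span_gen_eigenspaces x by blast
      then show "x \<in> span B" using B(3) span_minimal subspace_span by blast
    qed
  qed
  have finB: "finite B"
    using independent_span_bound[OF finite_G B(2)] B(1) UE E_span by auto
  define D where "D z = B \<inter> gen_eigenspace z" for z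
  have span_D: "span (D z) = gen_eigenspace z" for z
  proof
    show "span (D z) \<subseteq> gen_eigenspace z"
      by (rule span_minimal[OF _ subspace_gen_eigenspace]) (simp add: D_def)
    show "gen_eigenspace z \<subseteq> span (D z)"
    proof
      fix x assume x: "x \<in> gen_eigenspace z"
      then have "x \<in> span B" using E by (auto simp: gen_eigenspace_def)
      moreover have "B = D z \<union> (B - D z)" by (auto simp: D_def)
      ultimately have "x \<in> span (D z \<union> (B - D z))" by metis
      then obtain a b where ab: "x = a + b" "a \<in> span (D z)" "b \<in> span (B - D z)"
        unfolding span_Un by auto
      \<comment> \<open>So b lies in the generalized eigenspace of z and also in the span of the
        others, hence vanishes.\<close>
      have "b = x - a" using ab by simp
      then have "b \<in> gen_eigenspace z"
        using x ab(2) \<open>span (D z) \<subseteq> gen_eigenspace z\<close> subspace_diff[OF subspace_gen_eigenspace] by blast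
      moreover have "b \<in> span (\<Union>y\<in>-{z}. gen_eigenspace y)"
        using ab(3) B(1) by (elim subsetD[OF span_mono, rotated]) (auto simp: D_def)
      ultimately have "b = 0" by (rule gen_eigenspace_disjoint)
      then show "x \<in> span (D z)" using ab by simp
    qed
  qed
  have indep_D: "independent (D z)" for z
    using B(2) by (rule independent_mono) (auto simp: D_def)
  have dim_D: "dim (gen_eigenspace z) = card (D z)" for z
    using dim_span_eq_card_independent[OF indep_D[of z]] span_D by simp
  have disj: "D y \<inter> D z = {}" if "y \<noteq> z" for y z
  proof (rule ccontr)
    assume "D y \<inter> D z \<noteq> {}"
    then obtain b where b: "b \<in> B" "b \<in> gen_eigenspace y" "b \<in> gen_eigenspace z" by (auto simp: D_def)
    then have "b = 0" using that by (intro gen_eigenspace_disjoint[of b z]) (auto intro!: span_base)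
    then show False using b(1) B(2) dependent_zero by blast
  qed
  have nz: "{z. dim (gen_eigenspace z) \<noteq> 0} = {z. D z \<noteq> {}}"
    using finB by (auto simp: dim_D D_def)
  have finD: "finite {z. D z \<noteq> {}}"
  proof (rule finite_imageD)
    show "finite (D ` {z. D z \<noteq> {}})"
      by (rule finite_subset[of _ "Pow B"]) (use finB in \<open>auto simp: D_def\<close>)
    show "inj_on D {z. D z \<noteq> {}}" using disj by (fastforce simp: inj_on_def)
  qed
  then show "finite {z. dim (gen_eigenspace z) \<noteq> 0}" unfolding nz .
  have "(\<Sum>z | dim (gen_eigenspace z) \<noteq> 0. dim (gen_eigenspace z)) = (\<Sum>z | D z \<noteq> {}. card (D z))"
    unfolding nz by (simp add: dim_D)
  also have "\<dots> = card (\<Union>z\<in>{z. D z \<noteq> {}}. D z)"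
    using finD finB disj by (subst card_UN_disjoint) (auto simp: D_def)
  also have "(\<Union>z\<in>{z. D z \<noteq> {}}. D z) = B"
  proof (intro equalityI subsetI)
    fix b assume b: "b \<in> B"
    then obtain z where "b \<in> gen_eigenspace z" using B(1) by blast
    then have "b \<in> D z" using b by (simp add: D_def)
    then show "b \<in> (\<Union>z\<in>{z. D z \<noteq> {}}. D z)" by blast
  qed (auto simp: D_def)
  also have "card B = dim E" using dim_span_eq_card_independent[OF B(2)] E by simp
  finally show "(\<Sum>z | dim (gen_eigenspace z) \<noteq> 0. dim (gen_eigenspace z)) = dim E" .
qed

end

subsection \<open>Fourier coefficients of functions of period 2\<close>

abbreviation circ :: "real measure" where "circ \<equiv> lebesgue_on {0..2}"

definition mode :: "int \<Rightarrow> real \<Rightarrow> complex" where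
  "mode k x = cis (pi * of_int k * x)"

definition fcoeff :: "(real \<Rightarrow> complex) \<Rightarrow> int \<Rightarrow> complex" where
  "fcoeff f k = (1 / 2) * (LINT x|circ. f x * mode (- k) x)"

definition fseries :: "(int \<Rightarrow> complex) \<Rightarrow> real \<Rightarrow> complex" where
  "fseries c x = (\<Sum>\<^sub>\<infinity>k. c k * mode k x)"

lemma norm_mode [simp]: "norm (mode k x) = 1"
  by (simp add: mode_def)

lemma mode_mult: "mode j x * mode k x = mode (j + k) x"
  by (simp add: mode_def cis_mult algebra_simps)

lemma mode_0 [simp]: "mode 0 x = 1" by (simp add: mode_def)

lemma cis_int: "cis (2 * pi * of_int k) = 1"
  by (rule cis_multiple_2pi) simp

lemma mode_periodic: "mode k (x + 2) = mode k x"
proof -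
  have "mode k (x + 2) = mode k x * cis (2 * pi * of_int k)"
    by (simp add: mode_def cis_mult algebra_simps)
  then show ?thesis by (simp add: cis_int)
qed

lemma continuous_mode [continuous_intros]: "continuous_on S (mode k)"
  unfolding mode_def by (intro continuous_intros)

lemma circ_finite: "finite_measure circ"
  by (rule finite_measure_lebesgue_on) simp

lemma circ_measurable_continuous:
  fixes f :: "real \<Rightarrow> complex"
  shows "continuous_on {0..2} f \<Longrightarrow> f \<in> borel_measurable circ"
  by (rule continuous_imp_measurable_on_sets_lebesgue) auto

lemma integrable_circ_mult:
  fixes f h :: "real \<Rightarrow> complex"
  assumes "integrable circ f" "continuous_on {0..2} h" "\<And>x. norm (h x) \<le> B"
  shows "integrable circ (\<lambda>x. f x * h x)"
proof (rule Bochner_Integration.integrable_bound[where f = "\<lambda>x. of_real B * f x"])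
  show "(\<lambda>x. f x * h x) \<in> borel_measurable circ"
    using assms(1) circ_measurable_continuous[OF assms(2)] by (intro borel_measurable_times) auto
  have "norm (f x) * norm (h x) \<le> \<bar>B\<bar> * norm (f x)" for x
    using assms(3)[of x] by (subst mult.commute) (intro mult_right_mono, auto)
  then show "AE x in circ. norm (f x * h x) \<le> norm (of_real B * f x)"
    by (simp add: norm_mult)
qed (use assms(1) in auto)

lemma integrable_circ_mode: "integrable circ f \<Longrightarrow> integrable circ (\<lambda>x. f x * mode k x)"
  by (rule integrable_circ_mult[where B = 1]) (auto intro: continuous_intros)

lemma integrable_circ_continuous:
  fixes h :: "real \<Rightarrow> complex"
  shows "continuous_on {0..2} h \<Longrightarrow> integrable circ h"
  by (intro absolutely_integrable_imp_integrable absolutely_integrable_continuous_real) auto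

lemma integral_circ:
  fixes f :: "real \<Rightarrow> complex"
  shows "integrable circ f \<Longrightarrow> (LINT x|circ. f x) = integral {0..2} f"
  by (rule lebesgue_integral_eq_integral) auto

lemma fcoeff_add: "integrable circ f \<Longrightarrow> integrable circ g \<Longrightarrow> fcoeff (\<lambda>x. f x + g x) k = fcoeff f k + fcoeff g k"
  by (simp add: fcoeff_def distrib_right integrable_circ_mode)

lemma fcoeff_diff: "integrable circ f \<Longrightarrow> integrable circ g \<Longrightarrow> fcoeff (\<lambda>x. f x - g x) k = fcoeff f k - fcoeff g k"
  by (simp add: fcoeff_def left_diff_distrib integrable_circ_mode right_diff_distrib)

lemma fcoeff_cmult: "fcoeff (\<lambda>x. a * f x) k = a * fcoeff f k"
  by (simp add: fcoeff_def mult.assoc)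

lemma fcoeff_mult_mode: "fcoeff (\<lambda>x. f x * mode j x) k = fcoeff f (k - j)"
  by (simp add: fcoeff_def mult.assoc mode_mult)

lemma norm_fcoeff_le:
  assumes "integrable circ f"
  shows "norm (fcoeff f k) \<le> (LINT x|circ. norm (f x))"
proof -
  have "norm (LINT x|circ. f x * mode (- k) x) \<le> (LINT x|circ. norm (f x * mode (- k) x))"
    by (rule integral_norm_bound)
  then have "norm (fcoeff f k) \<le> (1 / 2) * (LINT x|circ. norm (f x))"
    by (simp add: fcoeff_def norm_mult)
  moreover have "0 \<le> (LINT x|circ. norm (f x))" by simp
  ultimately show ?thesis by linarith
qed

lemma fseries_summable:
  assumes "c \<in> ell1"
  shows "(\<lambda>k. c k * mode k x) summable_on UNIV"
  by (rule abs_summable_summable) (use assms in \<open>simp add: ell1_def norm_mult\<close>)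

lemma norm_fseries_le:
  assumes "c \<in> ell1"
  shows "norm (fseries c x) \<le> ell1_norm c"
proof -
  have "norm (fseries c x) \<le> (\<Sum>\<^sub>\<infinity>k. norm (c k * mode k x))"
    unfolding fseries_def by (rule norm_infsum_bound) (use assms in \<open>simp add: ell1_def norm_mult\<close>)
  then show ?thesis by (simp add: ell1_norm_def norm_mult)
qed

lemma fseries_periodic: "fseries c (x + 2) = fseries c x"
  by (simp add: fseries_def mode_periodic)

lemma fseries_add: "c \<in> ell1 \<Longrightarrow> d \<in> ell1 \<Longrightarrow> fseries (\<lambda>k. c k + d k) x = fseries c x + fseries d x"
  unfolding fseries_def distrib_right by (intro infsum_add fseries_summable)

lemma fseries_cmult: "fseries (\<lambda>k. a * c k) x = a * fseries c x"
  unfolding fseries_def mult.assoc by (rule infsum_cmult_right')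

lemma fseries_zero [simp]: "fseries (\<lambda>k. 0) x = 0"
  by (simp add: fseries_def)

lemma fseries_sum:
  assumes "finite A" "\<And>a. a \<in> A \<Longrightarrow> c a \<in> ell1"
  shows "fseries (\<lambda>k. \<Sum>a\<in>A. u a * c a k) x = (\<Sum>a\<in>A. u a * fseries (c a) x)"
  using assms
proof (induction A)
  case (insert a A)
  then show ?case by (simp add: fseries_add ell1_cmult ell1_sum fseries_cmult)
qed simp

section \<open>Tails, continuity and products of Fourier series; the indices in \<open>J\<close> are
  those removed\<close>

definition cutoff :: "int set \<Rightarrow> (int \<Rightarrow> complex) \<Rightarrow> int \<Rightarrow> complex" where
  "cutoff J c k = (if k \<in> J then 0 else c k)"

lemma cutoff_ell1: "c \<in> ell1 \<Longrightarrow> cutoff J c \<in> ell1"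
  by (rule ell1_mono) (auto simp: cutoff_def)

lemma fseries_cutoff:
  assumes "c \<in> ell1" "finite J"
  shows "fseries (cutoff J c) x = fseries c x - (\<Sum>j\<in>J. c j * mode j x)"
proof -
  define d where "d k = (if k \<in> J then c k else 0)" for k
  have "d \<in> ell1" by (rule ell1_finite_support[OF assms(2)]) (simp add: d_def)
  moreover have "c = (\<lambda>k. cutoff J c k + d k)" by (auto simp: cutoff_def d_def)
  ultimately have "fseries c x = fseries (cutoff J c) x + fseries d x"
    using fseries_add[OF cutoff_ell1[OF assms(1)]] by metis
  moreover have "((\<lambda>k. d k * mode k x) has_sum (\<Sum>j\<in>J. c j * mode j x)) UNIV"
    by (rule has_sum_finite_neutralI[OF assms(2)]) (auto simp: d_def)
  then have "fseries d x = (\<Sum>j\<in>J. c j * mode j x)" by (simp add: fseries_def infsumI)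
  ultimately show ?thesis by simp
qed

lemma ell1_norm_cutoff:
  assumes "c \<in> ell1"
  shows "((\<lambda>J. ell1_norm (cutoff J c)) \<longlongrightarrow> 0) (finite_subsets_at_top UNIV)"
proof -
  have "((\<lambda>J. ell1_norm c - (\<Sum>j\<in>J. norm (c j))) \<longlongrightarrow> ell1_norm c - ell1_norm c) (finite_subsets_at_top UNIV)"
    unfolding ell1_norm_def using assms by (intro tendsto_intros infsum_tendsto) (simp add: ell1_def)
  moreover have "\<forall>\<^sub>F J in finite_subsets_at_top UNIV. ell1_norm c - (\<Sum>j\<in>J. norm (c j)) = ell1_norm (cutoff J c)"
  proof (rule eventually_finite_subsets_at_top_weakI)
    fix J :: "int set" assume J: "finite J"
    have "((\<lambda>k. norm (c k)) has_sum ell1_norm c) UNIV"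
      using assms by (simp add: ell1_def ell1_norm_def)
    moreover have "((\<lambda>k. if k \<in> J then norm (c k) else 0) has_sum (\<Sum>j\<in>J. norm (c j))) UNIV"
      by (rule has_sum_finite_neutralI[OF J]) auto
    ultimately have "((\<lambda>k. norm (c k) + - (if k \<in> J then norm (c k) else 0)) has_sum
        (ell1_norm c + - (\<Sum>j\<in>J. norm (c j)))) UNIV"
      by (intro has_sum_add has_sum_uminusI)
    also have "(\<lambda>k. norm (c k) + - (if k \<in> J then norm (c k) else 0)) = (\<lambda>k. norm (cutoff J c k))"
      by (auto simp: cutoff_def)
    finally show "ell1_norm c - (\<Sum>j\<in>J. norm (c j)) = ell1_norm (cutoff J c)"
      by (simp add: ell1_norm_def infsumI)
  qed
  ultimately show ?thesis by (simp add: tendsto_cong)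
qed

lemma continuous_fseries:
  assumes "c \<in> ell1"
  shows "continuous_on S (fseries c)"
proof (rule uniform_limit_theorem[where F = "finite_subsets_at_top UNIV" and
      f = "\<lambda>J x. \<Sum>j\<in>J. c j * mode j x"])
  show "uniform_limit S (\<lambda>J x. \<Sum>j\<in>J. c j * mode j x) (fseries c) (finite_subsets_at_top UNIV)"
  proof (rule uniform_limitI)
    fix e :: real assume "0 < e"
    then have "\<forall>\<^sub>F J in finite_subsets_at_top UNIV. dist (ell1_norm (cutoff J c)) 0 < e"
      by (rule tendstoD[OF ell1_norm_cutoff[OF assms]])
    moreover have "\<forall>\<^sub>F J in finite_subsets_at_top (UNIV :: int set). finite J"
      by (rule eventually_finite_subsets_at_top_weakI)
    ultimately show "\<forall>\<^sub>F J in finite_subsets_at_top UNIV. \<forall>x\<in>S. dist (\<Sum>j\<in>J. c j * mode j x) (fseries c x) < e"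
    proof eventually_elim
      case (elim J)
      have "norm (fseries c x - (\<Sum>j\<in>J. c j * mode j x)) < e" for x
        using norm_fseries_le[OF cutoff_ell1[OF assms], of J x] elim
        by (simp add: fseries_cutoff[OF assms])
      then show ?case by (simp add: dist_norm norm_minus_commute)
    qed
  qed
qed (auto intro!: always_eventually continuous_intros)

text \<open>For finite sums multiplication by a mode shifts the coefficients; the tail is uniformly
  small in the l^1 norm, which suffices for q merely integrable.\<close>

lemma fcoeff_mult_fseries:
  assumes q: "integrable circ q" and c: "c \<in> ell1"
  shows "fcoeff (\<lambda>x. q x * fseries c x) k = conv (fcoeff q) c k"
proof -
  have qs: "integrable circ (\<lambda>x. q x * fseries d x)" if "d \<in> ell1" for d
    by (rule integrable_circ_mult[OF q continuous_fseries[OF that] norm_fseries_le[OF that]])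
  have qm: "integrable circ (\<lambda>x. q x * (\<Sum>j\<in>J. c j * mode j x))" for J
    unfolding sum_distrib_left
    by (intro Bochner_Integration.integrable_sum) (simp add: mult.left_commute integrable_circ_mode q)
  have fin: "fcoeff (\<lambda>x. q x * (\<Sum>j\<in>J. c j * mode j x)) k = (\<Sum>j\<in>J. fcoeff q (k - j) * c j)" for J
  proof (induction J rule: infinite_finite_induct)
    case (insert j J)
    have "fcoeff (\<lambda>x. q x * (\<Sum>j\<in>insert j J. c j * mode j x)) k =
        fcoeff (\<lambda>x. c j * (q x * mode j x) + q x * (\<Sum>j\<in>J. c j * mode j x)) k"
      using insert by (simp add: algebra_simps)
    also have "\<dots> = c j * fcoeff q (k - j) + fcoeff (\<lambda>x. q x * (\<Sum>j\<in>J. c j * mode j x)) k"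
      by (subst fcoeff_add)
        (auto intro!: integrable_mult_right integrable_circ_mode q qm simp: fcoeff_cmult fcoeff_mult_mode)
    finally show ?case using insert by (simp add: mult.commute)
  qed (auto simp: fcoeff_def)
  define Q where "Q = (LINT x|circ. norm (q x))"
  have bound: "norm ((\<Sum>j\<in>J. fcoeff q (k - j) * c j) - fcoeff (\<lambda>x. q x * fseries c x) k)
      \<le> Q * ell1_norm (cutoff J c)" if J: "finite J" for J
  proof -
    have "fcoeff (\<lambda>x. q x * fseries c x) k - (\<Sum>j\<in>J. fcoeff q (k - j) * c j)
        = fcoeff (\<lambda>x. q x * fseries (cutoff J c) x) k"
      unfolding fin[symmetric] fseries_cutoff[OF c J] right_diff_distrib
      by (rule fcoeff_diff[symmetric, OF qs[OF c] qm])
    moreover have "norm (fcoeff (\<lambda>x. q x * fseries (cutoff J c) x) k)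
        \<le> (LINT x|circ. norm (q x * fseries (cutoff J c) x))"
      by (rule norm_fcoeff_le[OF qs[OF cutoff_ell1[OF c]]])
    moreover have "(LINT x|circ. norm (q x * fseries (cutoff J c) x)) \<le>
        (LINT x|circ. norm (q x) * ell1_norm (cutoff J c))"
    proof (rule integral_mono)
      show "integrable circ (\<lambda>x. norm (q x * fseries (cutoff J c) x))"
        by (intro integrable_norm qs cutoff_ell1 c)
      show "norm (q x * fseries (cutoff J c) x) \<le> norm (q x) * ell1_norm (cutoff J c)" for x
        unfolding norm_mult by (intro mult_left_mono norm_fseries_le cutoff_ell1 c) simp
    qed (use q in auto)
    ultimately show ?thesis by (simp add: Q_def norm_minus_commute)
  qed
  have "((\<lambda>j. fcoeff q (k - j) * c j) has_sum fcoeff (\<lambda>x. q x * fseries c x) k) UNIV"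
    unfolding has_sum_def
  proof (rule Lim_null_comparison[THEN LIM_zero_cancel])
    show "\<forall>\<^sub>F J in finite_subsets_at_top UNIV. norm ((\<Sum>j\<in>J. fcoeff q (k - j) * c j) - fcoeff (\<lambda>x. q x * fseries c x) k)
      \<le> Q * ell1_norm (cutoff J c)"
      by (rule eventually_finite_subsets_at_top_weakI) (rule bound)
    show "((\<lambda>J. Q * ell1_norm (cutoff J c)) \<longlongrightarrow> 0) (finite_subsets_at_top UNIV)"
      using tendsto_mult_right_zero[OF ell1_norm_cutoff[OF c]] .
  qed
  then show ?thesis by (simp add: conv_def infsumI)
qed

lemma integral_mode:
  assumes "k \<noteq> 0" "t \<le> s"
  shows "(mode k has_integral (mode k s - mode k t) / (\<i> * of_real pi * of_int k)) {t..s}"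
proof -
  have "((\<lambda>x. mode k x / (\<i> * of_real pi * of_int k)) has_vector_derivative mode k x) (at x within {t..s})" for x
  proof -
    have "((\<lambda>z. exp (z * (\<i> * of_real pi * of_int k)) / (\<i> * of_real pi * of_int k)) has_field_derivative
        exp (of_real x * (\<i> * of_real pi * of_int k))) (at (of_real x))"
      using assms(1) by (auto intro!: derivative_eq_intros)
    then have "((\<lambda>x. exp (of_real x * (\<i> * of_real pi * of_int k)) / (\<i> * of_real pi * of_int k)) has_vector_derivative
        exp (of_real x * (\<i> * of_real pi * of_int k))) (at x within {t..s})"
      by (rule has_vector_derivative_real_field)
    moreover have "exp (of_real x * (\<i> * of_real pi * of_int k)) = mode k x" for x
      by (simp add: mode_def cis_conv_exp mult_ac)
    ultimately show ?thesis by simp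
  qed
  from fundamental_theorem_of_calculus[OF assms(2) this] show ?thesis
    by (simp add: diff_divide_distrib)
qed

lemma fcoeff_one: "fcoeff (\<lambda>x. 1) k = (if k = 0 then 1 else 0)"
proof (cases "k = 0")
  case True
  then show ?thesis by (simp add: fcoeff_def measure_restrict_space scaleR_conv_of_real)
next
  case False
  have "(LINT x|circ. mode (- k) x) = integral {0..2} (mode (- k))"
    by (rule integral_circ) (intro integrable_circ_continuous continuous_intros)
  also have "\<dots> = (mode (- k) 2 - mode (- k) 0) / (\<i> * of_real pi * of_int (- k))"
    by (rule integral_unique, rule integral_mode) (use False in auto)
  also have "mode (- k) 2 = mode (- k) 0" using mode_periodic[of "- k" 0] by simp
  finally show ?thesis using False by (simp add: fcoeff_def)
qed

lemma fcoeff_fseries: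
  assumes "c \<in> ell1"
  shows "fcoeff (fseries c) k = c k"
proof -
  \<comment> \<open>The product formula with q = 1, whose coefficient sequence is the unit for
    convolution.\<close>
  have "fcoeff (\<lambda>x. 1 * fseries c x) k = conv (fcoeff (\<lambda>x. 1)) c k"
    by (rule fcoeff_mult_fseries[OF _ assms]) (intro integrable_circ_continuous continuous_intros)
  also have "\<dots> = c k"
  proof -
    have "((\<lambda>j. (if k - j = 0 then 1 else 0) * c j) has_sum c k) UNIV"
      by (rule has_sum_finite_neutralI[of "{k}"]) auto
    then show ?thesis by (simp add: conv_def fcoeff_one infsumI)
  qed
  finally show ?thesis by simp
qed

subsection \<open>Uniqueness of the Fourier coefficients of continuous functions\<close>

text \<open>A nonnegative trigonometric polynomial of degree 1 with its peak at a. Its powers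
  concentrate at a, and multiplying by them only recombines Fourier coefficients.\<close>

definition bump :: "real \<Rightarrow> real \<Rightarrow> real" where
  "bump a x = (1 + cos (pi * (x - a))) / 2"

lemma bump_nonneg: "0 \<le> bump a x"
proof -
  have "- 1 \<le> c \<Longrightarrow> 0 \<le> (1 + c) / 2" for c :: real by simp
  then show ?thesis unfolding bump_def using cos_ge_minus_one by blast
qed

lemma bump_mode:
  "of_real (bump a x) = (1 / 2) * mode 0 x + (cis (- pi * a) / 4) * mode 1 x + (cis (pi * a) / 4) * mode (- 1) x"
proof -
  have "of_real (cos (pi * (x - a))) = (cis (pi * (x - a)) + cis (- (pi * (x - a)))) / 2"
    by (simp add: complex_eq_iff)
  also have "cis (pi * (x - a)) = cis (- pi * a) * mode 1 x"
    by (simp add: mode_def cis_mult algebra_simps)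
  also have "cis (- (pi * (x - a))) = cis (pi * a) * mode (- 1) x"
    by (simp add: mode_def cis_mult algebra_simps)
  finally show ?thesis by (simp add: bump_def add_divide_distrib)
qed

lemma continuous_bump [continuous_intros]: "continuous_on S (bump a)"
  unfolding bump_def by (intro continuous_intros) auto

lemma fcoeff_mult_bump_zero:
  assumes f: "continuous_on {0..2} f" and zero: "\<And>k. fcoeff f k = 0"
  shows "fcoeff (\<lambda>x. f x * of_real (bump a x ^ N)) k = 0"
proof (induction N arbitrary: k)
  case (Suc N)
  define g where "g x = f x * of_real (bump a x ^ N)" for x
  have g: "integrable circ g"
    unfolding g_def by (intro integrable_circ_continuous continuous_intros f)
  have "(\<lambda>x. f x * of_real (bump a x ^ Suc N)) =
     (\<lambda>x. (1 / 2) * (g x * mode 0 x) + ((cis (- pi * a) / 4) * (g x * mode 1 x) + (cis (pi * a) / 4) * (g x * mode (- 1) x)))"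
    by (rule ext) (simp add: g_def bump_mode algebra_simps)
  then show ?case
    using Suc.IH
    by (simp only: fcoeff_add fcoeff_cmult fcoeff_mult_mode integrable_circ_mode g
        integrable_mult_right Bochner_Integration.integrable_add flip: g_def) simp
qed (simp add: zero)

lemma cos_pi_le:
  assumes "0 \<le> d" "d \<le> s" "s \<le> 2 - d"
  shows "cos (pi * s) \<le> cos (pi * d)"
proof (cases "s \<le> 1")
  case True
  then show ?thesis using assms by (intro cos_monotone_0_pi_le) auto
next
  case False
  have "cos (pi * s) = cos (pi * (2 - s))"
    using cos_2pi_minus[of "pi * s"] by (simp add: algebra_simps)
  also have "\<dots> \<le> cos (pi * d)"
    using assms False by (intro cos_monotone_0_pi_le) auto
  finally show ?thesis .
qed

lemma bump_le:
  assumes "0 \<le> d" "d \<le> \<bar>x - a\<bar>" "\<bar>x - a\<bar> \<le> 2 - d"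
  shows "bump a x \<le> bump 0 d"
proof -
  have "cos (pi * (x - a)) = cos (pi * \<bar>x - a\<bar>)"
    by (metis abs_if cos_minus mult_minus_right)
  then show ?thesis using cos_pi_le[OF assms] by (simp add: bump_def)
qed

text \<open>If f(a) were nonzero, then integrating f against high powers of the bump would isolate
  its value near a, while all these integrals vanish.\<close>

lemma fcoeff_zero_interior:
  assumes f: "continuous_on {0..2} f" and zero: "\<And>k. fcoeff f k = 0" and a: "0 < a" "a < 2"
  shows "f a = 0"
proof (rule ccontr)
  assume "f a \<noteq> 0"
  define e where "e = norm (f a) / 2"
  have e: "0 < e" using \<open>f a \<noteq> 0\<close> by (simp add: e_def)
  obtain d0 where d0: "0 < d0" "\<And>x. x \<in> {0..2} \<Longrightarrow> dist x a < d0 \<Longrightarrow> dist (f x) (f a) < e"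
    using f a e unfolding continuous_on_iff by fastforce
  define d where "d = Min {d0, a, 2 - a, 1} / 2"
  have d: "0 < d" "d < d0" "d < a" "d < 2 - a" "d < 1" using d0 a by (auto simp: d_def)
  have "bounded (f ` {0..2})" using f by (intro compact_imp_bounded compact_continuous_image) auto
  then obtain M where "\<forall>y\<in>f ` {0..2}. norm y \<le> M" unfolding bounded_iff by blast
  then have M: "norm (f x) \<le> M" if "x \<in> {0..2}" for x using that by blast
  have M0: "0 \<le> M" using order_trans[OF norm_ge_zero M[of 1]] by simp
  \<comment> \<open>\<open>r\<close> bounds the bump from above off the d-neighbourhood of a,
    \<open>s\<close> from below on the half as wide one; r < s lets the peak win as N grows.\<close>
  define r s where "r = bump 0 d" and "s = bump 0 (d / 2)"
  have rs: "0 \<le> r" "r < s" "0 < s"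
  proof -
    have "cos (pi * d) < cos (pi * (d / 2))"
      using d by (intro cos_monotone_0_pi) auto
    then show "r < s" by (simp add: r_def s_def bump_def)
    show "0 \<le> r" by (simp add: r_def bump_nonneg)
    with \<open>r < s\<close> show "0 < s" by simp
  qed
  have key: "e * d * s ^ N \<le> 4 * M * r ^ N" for N
  proof -
    define w where "w x = bump a x ^ N" for x
    have w: "continuous_on A w" for A unfolding w_def by (intro continuous_intros)
    have w0: "0 \<le> w x" for x by (simp add: w_def bump_nonneg)
    have iw: "w integrable_on A" if "A = {x..y}" for A x y
      using that w by (auto intro: integrable_continuous_real)
    have z: "integral {0..2} (\<lambda>x. f x * of_real (w x)) = 0"
      using fcoeff_mult_bump_zero[OF f zero, of a N 0]
        integral_circ[OF integrable_circ_continuous, of "\<lambda>x. f x * of_real (w x)"] f w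
      by (simp add: fcoeff_def w_def continuous_intros)
    have i1: "(\<lambda>x. f a * of_real (w x)) integrable_on {0..2}" "(\<lambda>x. f x * of_real (w x)) integrable_on {0..2}"
      by (intro integrable_continuous_real continuous_intros w f)+
    have "f a * of_real (integral {0..2} w) = integral {0..2} (\<lambda>x. f a * of_real (w x))"
    proof -
      have "integral {0..2} (complex_of_real \<circ> w) = complex_of_real (integral {0..2} w)"
        by (rule integral_linear[OF iw[OF refl] bounded_linear_of_real])
      then show ?thesis by (simp add: o_def)
    qed
    also have "\<dots> = integral {0..2} (\<lambda>x. f a * of_real (w x) - f x * of_real (w x))"
      by (simp add: integral_diff i1 z)
    finally have "norm (f a * of_real (integral {0..2} w))
        = norm (integral {0..2} (\<lambda>x. f a * of_real (w x) - f x * of_real (w x)))" by (rule arg_cong)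
    moreover have "0 \<le> integral {0..2} w"
      by (rule integral_nonneg[OF iw[OF refl]]) (rule w0)
    ultimately have "2 * e * integral {0..2} w = norm (integral {0..2} (\<lambda>x. f a * of_real (w x) - f x * of_real (w x)))"
      by (simp add: e_def norm_mult)
    also have "\<dots> \<le> integral {0..2} (\<lambda>x. e * w x + 2 * M * r ^ N)"
    proof (rule integral_norm_bound_integral)
      show "(\<lambda>x. f a * of_real (w x) - f x * of_real (w x)) integrable_on {0..2}"
        by (intro integrable_diff i1)
      show "(\<lambda>x. e * w x + 2 * M * r ^ N) integrable_on {0..2}"
        by (intro integrable_continuous_real continuous_intros w)
      fix x :: real assume x: "x \<in> {0..2}"
      have eq: "norm (f a * of_real (w x) - f x * of_real (w x)) = norm (f x - f a) * w x"
        using w0[of x] by (simp add: left_diff_distrib[symmetric] norm_mult norm_minus_commute)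
      show "norm (f a * of_real (w x) - f x * of_real (w x)) \<le> e * w x + 2 * M * r ^ N"
      proof (cases "\<bar>x - a\<bar> < d")
        case True
        then have "norm (f x - f a) \<le> e"
          using d0(2)[OF x] d by (auto simp: dist_norm)
        then have "norm (f x - f a) * w x \<le> e * w x" by (rule mult_right_mono[OF _ w0])
        moreover have "0 \<le> 2 * M * r ^ N" using M0 rs by simp
        ultimately show ?thesis unfolding eq by linarith
      next
        case False
        have "\<bar>x - a\<bar> \<le> 2 - d" using x d by auto
        then have "w x \<le> r ^ N"
          unfolding w_def r_def using bump_le[of d x a] False d by (intro power_mono bump_nonneg) auto
        moreover have "norm (f x - f a) \<le> 2 * M"
          using norm_triangle_ineq4[of "f x" "f a"] M[OF x] M[of a] a by auto
        ultimately have "norm (f x - f a) * w x \<le> 2 * M * r ^ N"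
          using M0 w0 by (intro mult_mono) auto
        moreover have "0 \<le> e * w x" using e w0 by simp
        ultimately show ?thesis unfolding eq by linarith
      qed
    qed
    also have "\<dots> = e * integral {0..2} w + 4 * M * r ^ N"
      by (subst integral_add) (auto intro!: integrable_continuous_real continuous_intros w)
    finally have A: "e * integral {0..2} w \<le> 4 * M * r ^ N" by simp
    \<comment> \<open>Lower bound for the mass of the bump near its peak, an interval of length
      d.\<close>
    have "d * s ^ N = integral {a - d / 2..a + d / 2} (\<lambda>x. s ^ N)" using d by simp
    also have "\<dots> \<le> integral {a - d / 2..a + d / 2} w"
    proof (rule integral_le)
      fix x assume x: "x \<in> {a - d / 2..a + d / 2}"
      have "cos (pi * (d / 2)) \<le> cos (pi * \<bar>x - a\<bar>)"
      proof (intro cos_monotone_0_pi_le mult_left_mono)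
        show "\<bar>x - a\<bar> \<le> d / 2" using x unfolding atLeastAtMost_iff by linarith
      qed (use d in auto)
      moreover have "cos (pi * (x - a)) = cos (pi * \<bar>x - a\<bar>)"
        by (metis abs_if cos_minus mult_minus_right)
      ultimately have "s \<le> bump a x" by (simp add: s_def bump_def)
      then show "s ^ N \<le> w x" unfolding w_def using rs by (intro power_mono) auto
    qed (auto intro: iw)
    also have "\<dots> \<le> integral {0..2} w"
      using d a w0 by (intro integral_subset_le iw[OF refl]) auto
    finally have "e * (d * s ^ N) \<le> e * integral {0..2} w" using e by simp
    then show ?thesis using A by simp
  qed
  have "(\<lambda>N. (r / s) ^ N) \<longlonglongrightarrow> 0"
  proof (rule LIMSEQ_power_zero)
    show "norm (r / s) < 1" using rs by (simp add: abs_of_nonneg)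
  qed
  then have "(\<lambda>N. 4 * M * (r / s) ^ N) \<longlonglongrightarrow> 4 * M * 0" by (rule tendsto_mult_left)
  moreover have "e * d \<le> 4 * M * (r / s) ^ N" for N
    using key[of N] rs by (simp add: power_divide field_simps)
  ultimately have "e * d \<le> 4 * M * 0" by (intro LIMSEQ_le_const) auto
  then show False using e d by (simp add: mult_le_0_iff)
qed

lemma periodic_int:
  assumes "\<And>x::real. f (x + 2) = f x"
  shows "f (x + 2 * of_int k) = f x"
proof (induction k rule: int_induct[where k = 0])
  case (step1 i)
  then show ?case using assms[of "x + 2 * of_int i"] by (simp add: algebra_simps)
next
  case (step2 i)
  then show ?case using assms[of "x + 2 * of_int (i - 1)"] by (simp add: algebra_simps)
qed simp

lemma fcoeff_zero_imp_zero:
  assumes f: "continuous_on UNIV f" and per: "\<And>x. f (x + 2) = f x" and zero: "\<And>k. fcoeff f k = 0"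
  shows "f x = 0"
proof -
  have int: "f x = 0" if "0 < x" "x < 2" for x
    using fcoeff_zero_interior[OF continuous_on_subset[OF f] zero that] by auto
  have f0: "f 0 = 0"
  proof (rule tendsto_unique)
    show "(f \<longlongrightarrow> f 0) (at_right 0)"
      using f by (simp add: continuous_on_def filterlim_at_within_If) (meson UNIV_I at_le filterlim_mono order_refl subset_UNIV)
    have "\<forall>\<^sub>F x in at_right 0. f x = 0"
      unfolding eventually_at_right_field using int by (intro exI[of _ 2]) auto
    then show "(f \<longlongrightarrow> 0) (at_right 0)" by (rule tendsto_eventually)
  qed simp
  define y where "y = x - 2 * of_int \<lfloor>x / 2\<rfloor>"
  have y: "0 \<le> y" "y < 2" unfolding y_def by linarith+
  have "f x = f (y + 2 * of_int \<lfloor>x / 2\<rfloor>)" by (simp add: y_def)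
  also have "\<dots> = f y" by (rule periodic_int[where f = f, OF per])
  also have "\<dots> = 0" using int[of y] f0 y by (cases "y = 0") auto
  finally show ?thesis .
qed

lemma fcoeff_inject:
  assumes "continuous_on UNIV f" "\<And>x. f (x + 2) = f x" "continuous_on UNIV g" "\<And>x. g (x + 2) = g x"
    and eq: "\<And>k. fcoeff f k = fcoeff g k"
  shows "f = g"
proof (rule ext)
  fix x
  have i: "integrable circ f" "integrable circ g"
    using assms by (auto intro!: integrable_circ_continuous intro: continuous_on_subset)
  have "f x - g x = 0"
    by (rule fcoeff_zero_imp_zero[of "\<lambda>x. f x - g x"])
      (auto intro!: continuous_intros assms simp: fcoeff_diff i assms)
  then show "f x = g x" by simp
qed

subsection \<open>Derivatives in \<open>L\<^sup>2\<close>\<close>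

lemma L2_circle_measurable: "f \<in> L2_circle T \<Longrightarrow> f \<in> borel_measurable (lebesgue_on {0..T})"
  by (auto simp: L2_circle_def intro: measurable_restrict_space1)

lemma L2_circle_integrable:
  assumes "f \<in> L2_circle 2"
  shows "integrable circ f"
proof (rule Bochner_Integration.integrable_bound[where f = "\<lambda>x. 1 + (norm (f x))\<^sup>2"])
  show "integrable circ (\<lambda>x. 1 + (norm (f x))\<^sup>2)"
    using assms by (intro Bochner_Integration.integrable_add) (auto simp: L2_circle_def)
  show "f \<in> borel_measurable circ" by (rule L2_circle_measurable[OF assms])
  have "t \<le> 1 + t\<^sup>2" for t :: real using zero_le_power2[of "t - 1 / 2"]
    by (simp add: power2_eq_square algebra_simps)
  then have "norm (f x) \<le> norm (1 + (norm (f x))\<^sup>2)" for x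
    by (simp add: abs_of_nonneg)
  then show "AE x in circ. norm (f x) \<le> norm (1 + (norm (f x))\<^sup>2)" by simp
qed

lemma continuous_L2_circle:
  fixes f :: "real \<Rightarrow> complex"
  assumes "continuous_on UNIV f" "\<And>x. f (x + 2) = f x"
  shows "f \<in> L2_circle 2"
proof -
  have "continuous_on {0..2} (\<lambda>x. (norm (f x))\<^sup>2)"
    by (intro continuous_intros continuous_on_subset[OF assms(1)]) auto
  then have "integrable circ (\<lambda>x. (norm (f x))\<^sup>2)"
    by (intro absolutely_integrable_imp_integrable absolutely_integrable_continuous_real) auto
  moreover have "f \<in> borel_measurable lebesgue"
    using continuous_imp_measurable_on_sets_lebesgue[OF assms(1)] by (simp add: lebesgue_on_UNIV_eq)
  ultimately show ?thesis using assms(2) by (simp add: L2_circle_def)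
qed

lemma continuous_has_L2_derivative:
  assumes "has_L2_derivative 2 f g"
  shows "continuous_on UNIV f"
proof -
  have g: "(g has_integral (f b - f a)) {a..b}" if "a \<le> b" for a b
    using assms that by (simp add: has_L2_derivative_def)
  have "isCont f a" for a
  proof -
    have "continuous_on {a - 1..a + 1} (\<lambda>x. f (a - 1) + integral {a - 1..x} g)"
      using g[of "a - 1" "a + 1"]
      by (intro continuous_intros indefinite_integral_continuous_1) (auto simp: integrable_on_def)
    moreover have "f (a - 1) + integral {a - 1..x} g = f x" if "x \<in> {a - 1..a + 1}" for x
      using integral_unique[OF g[of "a - 1" x]] that by simp
    ultimately have "continuous_on {a - 1..a + 1} f"
      by (rule continuous_on_eq)
    then show ?thesis by (rule continuous_on_interior) simp
  qed
  then show ?thesis by (simp add: continuous_at_imp_continuous_on)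
qed

text \<open>Integration by parts with a derivative that is only integrable: both sides arise from
  one double integral over the triangle t <= x, by Fubini.\<close>

lemma fcoeff_has_L2_derivative:
  assumes "has_L2_derivative 2 f g"
  shows "fcoeff g k = \<i> * of_real pi * of_int k * fcoeff f k"
proof -
  have gint: "(g has_integral (f b - f a)) {a..b}" if "a \<le> b" for a b
    using assms that by (simp add: has_L2_derivative_def)
  have g: "integrable circ g"
    using assms by (auto simp: has_L2_derivative_def intro: L2_circle_integrable)
  have "f 2 = f 0" using assms unfolding has_L2_derivative_def by (metis add_0)
  then have g0: "(LINT x|circ. g x) = 0"
    using integral_circ[OF g] integral_unique[OF gint[of 0 2]] by simp
  show ?thesis
  proof (cases "k = 0")
    case True
    then show ?thesis using g0 by (simp add: fcoeff_def)
  next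
    case False
    define h where "h = mode (- k)"
    have h_cont: "continuous_on S h" for S unfolding h_def by (rule continuous_mode)
    have norm_h: "norm (h x) = 1" for x by (simp add: h_def)
    have [measurable]: "g \<in> borel_measurable circ" using g by auto
    have [measurable]: "h \<in> borel_measurable circ" by (rule circ_measurable_continuous[OF h_cont])
    have [measurable]: "(\<lambda>x. x) \<in> borel_measurable circ"
      using id_borel_measurable_lebesgue_on[of "{0..2}"] by (simp add: id_def)
    interpret finite_measure circ by (rule circ_finite)
    interpret pair_sigma_finite circ circ ..
    \<comment> \<open>Integrating over t first recovers f x - f 0, integrating over x first gives a
      primitive of the mode; the boundary terms drop out because g and h have mean zero.\<close>
    define \<phi> where "\<phi> t x = (if t \<le> x then g t * h x else 0)" for t x
    have [measurable]: "case_prod \<phi> \<in> borel_measurable (circ \<Otimes>\<^sub>M circ)"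
      unfolding \<phi>_def by measurable
    have inner_int: "integrable circ (\<lambda>x. \<phi> t x)" for t
      by (rule integrable_const_bound[where B = "norm (g t)"])
        (simp_all add: \<phi>_def norm_mult norm_h)
    have int: "integrable (circ \<Otimes>\<^sub>M circ) (case_prod \<phi>)"
    proof (rule Fubini_integrable)
      show "integrable circ (\<lambda>t. LINT x|circ. norm (case_prod \<phi> (t, x)))"
      proof (rule Bochner_Integration.integrable_bound[where f = "\<lambda>t. 2 * g t"])
        show "(\<lambda>t. LINT x|circ. norm (case_prod \<phi> (t, x))) \<in> borel_measurable circ"
          by measurable
        have "(LINT x|circ. norm (\<phi> t x)) \<le> (LINT x|circ. norm (g t))" for t
        proof (rule integral_mono)
          show "integrable circ (\<lambda>x. norm (\<phi> t x))" by (intro integrable_norm inner_int)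
        qed (auto simp: \<phi>_def norm_mult norm_h)
        then show "AE t in circ. norm (LINT x|circ. norm (case_prod \<phi> (t, x))) \<le> norm (2 * g t)"
          by (simp add: measure_restrict_space norm_mult)
      qed (use g in auto)
      show "AE t in circ. integrable circ (\<lambda>x. case_prod \<phi> (t, x))" using inner_int by simp
    qed simp
    define K where "K = \<i> * of_real pi * of_int (- k)"
    have K: "K \<noteq> 0" using False by (simp add: K_def)
    have h2: "h 2 = 1" using mode_periodic[of "- k" 0] by (simp add: h_def mode_def)
    have inner_x: "(LINT x|circ. \<phi> t x) = g t * ((1 - h t) / K)" if "t \<in> {0..2}" for t
    proof -
      have "(LINT x|circ. \<phi> t x) = integral {0..2} (\<lambda>x. if x \<in> {t..2} then g t * h x else 0)"
        unfolding integral_circ[OF inner_int] by (rule integral_cong) (auto simp: \<phi>_def)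
      also have "\<dots> = integral {t..2} (\<lambda>x. g t * h x)"
        unfolding Henstock_Kurzweil_Integration.integral_restrict_Int using that by simp
      also have "\<dots> = g t * ((h 2 - h t) / K)"
        unfolding h_def K_def using that False
        by (intro integral_unique has_integral_mult_right integral_mode) auto
      finally show ?thesis by (simp add: h2)
    qed
    have inner_t: "(LINT t|circ. \<phi> t x) = (f x - f 0) * h x" if x: "x \<in> {0..2}" for x
    proof -
      have "integrable circ (\<lambda>t. \<phi> t x)"
      proof (rule Bochner_Integration.integrable_bound[OF g])
        show "(\<lambda>t. \<phi> t x) \<in> borel_measurable circ" unfolding \<phi>_def by measurable
      qed (auto simp: \<phi>_def norm_mult norm_h)
      then have "(LINT t|circ. \<phi> t x) = integral {0..2} (\<lambda>t. \<phi> t x)" by (rule integral_circ)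
      also have "\<dots> = integral {0..2} (\<lambda>t. if t \<in> {0..x} then g t * h x else 0)"
        by (rule integral_cong) (auto simp: \<phi>_def)
      also have "\<dots> = integral {0..x} (\<lambda>t. g t * h x)"
        unfolding Henstock_Kurzweil_Integration.integral_restrict_Int using x by simp
      also have "\<dots> = (f x - f 0) * h x"
        using x by (intro integral_unique has_integral_mult_left gint) auto
      finally show ?thesis .
    qed
    have f: "integrable circ f"
      by (intro integrable_circ_continuous continuous_on_subset[OF continuous_has_L2_derivative[OF assms]]) simp
    have fh: "integrable circ (\<lambda>x. f x * h x)" "integrable circ h" "integrable circ (\<lambda>x. g x * h x)"
      unfolding h_def by (intro integrable_circ_mode f g integrable_circ_continuous continuous_mode)+
    have h0: "(LINT x|circ. h x) = 0"
      using fcoeff_one[of k] False by (simp add: fcoeff_def h_def)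
    have "(LINT x|circ. f x * h x) = (LINT x|circ. f x * h x - f 0 * h x)"
      using fh by (simp add: h0)
    also have "\<dots> = (LINT x|circ. LINT t|circ. \<phi> t x)"
      by (rule Bochner_Integration.integral_cong) (auto simp: inner_t left_diff_distrib)
    also have "\<dots> = (LINT t|circ. LINT x|circ. \<phi> t x)"
      by (rule Fubini_integral[OF int])
    also have "\<dots> = (LINT t|circ. g t / K - (g t * h t) / K)"
      by (rule Bochner_Integration.integral_cong) (auto simp: inner_x diff_divide_distrib right_diff_distrib)
    also have "\<dots> = - (LINT t|circ. g t * h t) / K"
      using g fh by (simp add: g0)
    finally have "K * (LINT x|circ. f x * h x) = - (LINT t|circ. g t * h t)"
      using K by simp
    then show ?thesis by (simp add: fcoeff_def h_def K_def)
  qed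
qed

text \<open>Mean zero of f is exactly what makes the primitive periodic; subtracting its own mean
  then allows a second integration.\<close>

lemma L2_antiderivative:
  assumes f: "f \<in> L2_circle 2" and f0: "fcoeff f 0 = 0"
  obtains F where "has_L2_derivative 2 F f" "fcoeff F 0 = 0"
proof -
  have per: "f (x + 2) = f x" for x using f by (simp add: L2_circle_def)
  have shift: "f \<circ> (+) (2 * of_int k) = f" for k
    using periodic_int[where f = f, OF per] by (auto simp: o_def add.commute)
  have i02: "f integrable_on {0..2}"
    by (rule integrable_on_lebesgue_on[OF L2_circle_integrable[OF f]]) auto
  have ipos: "f integrable_on {0..2 * real n}" for n
  proof (induction n)
    case (Suc n)
    have "(f \<circ> (+) (2 * of_int (int n))) integrable_on {0..2}"
      unfolding shift by (rule i02)
    then have "f integrable_on {2 * real n..2 * real n + 2}"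
      unfolding integrable_on_shift_Icc_real by (simp add: add.commute)
    then have "f integrable_on {0..2 * real n + 2}"
      by - (rule Henstock_Kurzweil_Integration.integrable_combine[where c = "2 * real n"], use Suc in auto)
    then show ?case by (simp add: add.commute)
  qed (use integrable_on_refl[of f "0::real"] in simp)
  have int: "f integrable_on {a..b}" for a b
  proof -
    obtain n where n: "max \<bar>a\<bar> \<bar>b\<bar> \<le> real n" using real_arch_simple by blast
    have "(f \<circ> (+) (2 * of_int (- int n))) integrable_on {0..2 * real (2 * n)}"
      unfolding shift by (rule ipos)
    then have "f integrable_on {- (2 * real n)..2 * real n}"
      unfolding integrable_on_shift_Icc_real by simp
    then show ?thesis by (rule integrable_on_subinterval) (use n in auto)
  qed
  define J where "J x = (if 0 \<le> x then integral {0..x} f else - integral {x..0} f)" for x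
  have J: "J b - J a = integral {a..b} f" if "a \<le> b" for a b
    using that Henstock_Kurzweil_Integration.integral_combine[of 0 a b f] Henstock_Kurzweil_Integration.integral_combine[of a 0 b f]
      Henstock_Kurzweil_Integration.integral_combine[of a b 0 f] int
    by (auto simp: J_def algebra_simps)
  have shift_int: "integral {a + 2..b + 2} f = integral {a..b} f" for a b
  proof -
    have "f \<circ> (+) 2 = f" using shift[of 1] by simp
    then show ?thesis using integral_shift_Icc_real[of a b f 2] by metis
  qed
  have J2: "J 2 = 0"
    using f0 integral_circ[OF L2_circle_integrable[OF f]] by (simp add: J_def fcoeff_def)
  have Jper: "J (x + 2) = J x" for x
  proof (cases "0 \<le> x")
    case True
    then have "J x = integral {0..x} f" by (simp add: J_def)
    then show ?thesis using J[of 2 "x + 2"] shift_int[of 0 x] J2 True by simp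
  next
    case False
    then have "J x = - integral {x..0} f" by (simp add: J_def)
    then show ?thesis using J[of "x + 2" 2] shift_int[of x 0] J2 False
      by (simp add: minus_equation_iff[of "J (x + 2)"])
  qed
  have der: "has_L2_derivative 2 (\<lambda>x. J x - a) f" for a
    unfolding has_L2_derivative_def
  proof (intro conjI allI impI)
    show "(f has_integral J y - a - (J x - a)) {x..y}" if "x \<le> y" for x y
      using J[OF that] integrable_integral[OF int, of x y] by simp
  qed (simp_all add: f Jper)
  show thesis
  proof (rule that)
    show "has_L2_derivative 2 (\<lambda>x. J x - fcoeff J 0) f" by (rule der)
    have "continuous_on UNIV J" using continuous_has_L2_derivative[OF der[of 0]] by simp
    from continuous_on_subset[OF this] have "integrable circ J" by (intro integrable_circ_continuous) simp
    then show "fcoeff (\<lambda>x. J x - fcoeff J 0) 0 = 0"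
      using fcoeff_diff[of J "\<lambda>x. fcoeff J 0" 0] fcoeff_cmult[of "fcoeff J 0" "\<lambda>x. 1" 0] fcoeff_one[of 0]
      by simp
  qed
qed

subsection \<open>Hill's operator on sequences\<close>

lemma L2_circle_mult:
  assumes q: "q \<in> L2_circle 2" and c: "c \<in> ell1" and d: "d \<in> ell1"
  shows "(\<lambda>x. q x * fseries c x - fseries d x) \<in> L2_circle 2"
proof -
  have [measurable]: "q \<in> borel_measurable lebesgue" "fseries c \<in> borel_measurable lebesgue" "fseries d \<in> borel_measurable lebesgue"
    using q continuous_L2_circle[OF continuous_fseries[OF c] fseries_periodic]
      continuous_L2_circle[OF continuous_fseries[OF d] fseries_periodic] by (auto simp: L2_circle_def)
  have meas: "(\<lambda>x. q x * fseries c x - fseries d x) \<in> borel_measurable lebesgue" by measurable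
  define C D where "C = ell1_norm c" and "D = ell1_norm d"
  have "integrable circ (\<lambda>x. (norm (q x * fseries c x - fseries d x))\<^sup>2)"
  proof (rule Bochner_Integration.integrable_bound[where f = "\<lambda>x. 2 * C\<^sup>2 * (norm (q x))\<^sup>2 + 2 * D\<^sup>2"])
    show "integrable circ (\<lambda>x. 2 * C\<^sup>2 * (norm (q x))\<^sup>2 + 2 * D\<^sup>2)"
      using q by (intro Bochner_Integration.integrable_add integrable_mult_right) (auto simp: L2_circle_def)
    have "(\<lambda>x. q x * fseries c x - fseries d x) \<in> borel_measurable circ"
      using meas by (rule measurable_restrict_space1)
    then show "(\<lambda>x. (norm (q x * fseries c x - fseries d x))\<^sup>2) \<in> borel_measurable circ" by measurable
    have "(norm (q x * fseries c x - fseries d x))\<^sup>2 \<le> 2 * C\<^sup>2 * (norm (q x))\<^sup>2 + 2 * D\<^sup>2" for x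
    proof -
      have "norm (q x * fseries c x - fseries d x) \<le> norm (q x) * C + D"
        unfolding C_def D_def
        by (rule order_trans[OF norm_triangle_ineq4])
          (intro add_mono norm_fseries_le d, simp add: norm_mult mult_left_mono norm_fseries_le c)
      then have "(norm (q x * fseries c x - fseries d x))\<^sup>2 \<le> (norm (q x) * C + D)\<^sup>2"
        by (intro power_mono) auto
      also have "\<dots> \<le> 2 * C\<^sup>2 * (norm (q x))\<^sup>2 + 2 * D\<^sup>2"
        using zero_le_power2[of "norm (q x) * C - D"] by (simp add: power2_eq_square algebra_simps)
      finally show ?thesis .
    qed
    then show "AE x in circ. norm ((norm (q x * fseries c x - fseries d x))\<^sup>2)
        \<le> norm (2 * C\<^sup>2 * (norm (q x))\<^sup>2 + 2 * D\<^sup>2)"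
      by (intro always_eventually allI) (simp add: abs_of_nonneg)
  qed
  then show ?thesis using meas q by (simp add: L2_circle_def fseries_periodic)
qed

text \<open>The second derivative is integrable, so its coefficients are bounded and those of f are
  O(1/k^2), hence in l^1. Uniqueness for continuous functions identifies f with its series.\<close>

lemma hill_graph_imp_sequence:
  assumes q: "q \<in> L2_circle 2" and e: "e \<in> ell1"
    and hill: "hill_graph q f (\<lambda>x. z * f x + fseries e x)"
  shows "\<exists>c\<in>ell1. f = fseries c \<and> (\<forall>k. hill_op (fcoeff q) c k = z * c k + e k)"
proof -
  obtain f1 f2 where f1: "has_L2_derivative 2 f f1" and f2: "has_L2_derivative 2 f1 f2"
    and ae: "AE x in lebesgue. z * f x + fseries e x = - f2 x + q x * f x"
    using hill by (auto simp: hill_graph_def)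
  define c where "c = fcoeff f"
  have f2_coeff: "fcoeff f2 k = - (of_real (pi\<^sup>2) * (of_int k)\<^sup>2 * c k)" for k
    unfolding fcoeff_has_L2_derivative[OF f2] fcoeff_has_L2_derivative[OF f1] c_def
    by (simp add: power2_eq_square algebra_simps)
  have f2_L2: "f2 \<in> L2_circle 2" using f2 by (simp add: has_L2_derivative_def)
  define C where "C = (LINT x|circ. norm (f2 x))"
  have c_le: "norm (c k) \<le> C * (1 / (of_int k)\<^sup>2)" if "k \<noteq> 0" for k
  proof -
    have "pi\<^sup>2 * (of_int k)\<^sup>2 * norm (c k) \<le> C"
      using norm_fcoeff_le[OF L2_circle_integrable[OF f2_L2], of k]
      unfolding f2_coeff C_def by (simp add: norm_mult norm_power)
    moreover have "1 * ((of_int k)\<^sup>2 * norm (c k)) \<le> pi\<^sup>2 * ((of_int k)\<^sup>2 * norm (c k))"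
      using pi_gt3 by (intro mult_right_mono) (auto simp: one_le_power)
    ultimately show ?thesis using that by (simp add: field_simps)
  qed
  have c: "c \<in> ell1"
  proof (rule ell1_bounded(1))
    fix H :: "int set" assume H: "finite H"
    have "(\<Sum>k\<in>H. norm (c k)) \<le> (\<Sum>k\<in>insert 0 H. norm (c k))"
      using H by (intro sum_mono2) auto
    also have "\<dots> = norm (c 0) + (\<Sum>k\<in>H - {0}. norm (c k))" by (rule sum.insert_remove[OF H])
    also have "(\<Sum>k\<in>H - {0}. norm (c k)) \<le> (\<Sum>k\<in>H - {0}. C * (1 / (of_int k)\<^sup>2))"
      by (intro sum_mono c_le) auto
    also have "\<dots> \<le> C * 4"
      unfolding sum_distrib_left[symmetric] using H
      by (intro mult_left_mono sum_inverse_squares_int) (auto simp: C_def)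
    finally show "(\<Sum>k\<in>H. norm (c k)) \<le> norm (c 0) + C * 4" by simp
  qed
  have fc: "f = fseries c"
  proof (rule fcoeff_inject)
    show "continuous_on UNIV f" by (rule continuous_has_L2_derivative[OF f1])
    show "f (x + 2) = f x" for x using f1 by (simp add: has_L2_derivative_def)
    show "fcoeff f k = fcoeff (fseries c) k" for k
      unfolding fcoeff_fseries[OF c] by (simp add: c_def)
  qed (auto intro: continuous_fseries c fseries_periodic)
  define d where "d k = z * c k + e k" for k
  have d: "d \<in> ell1" unfolding d_def by (intro ell1_add ell1_cmult c e)
  have fd: "fseries d x = z * f x + fseries e x" for x
    unfolding d_def fc by (simp add: fseries_add ell1_cmult c e fseries_cmult)
  have qf: "integrable circ (\<lambda>x. q x * fseries c x)"
    by (rule integrable_circ_mult[OF L2_circle_integrable[OF q] continuous_fseries[OF c] norm_fseries_le[OF c]])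
  have "hill_op (fcoeff q) c k = z * c k + e k" for k
  proof -
    have "fcoeff f2 k = fcoeff (\<lambda>x. q x * fseries c x - fseries d x) k"
    proof -
      have ae': "AE x in circ. f2 x = q x * fseries c x - fseries d x"
      proof -
        have "AE x in lebesgue. f2 x = q x * fseries c x - fseries d x"
          using ae by eventually_elim (simp add: fd fc[symmetric])
        then show ?thesis by (auto simp: AE_restrict_space_iff elim: eventually_mono)
      qed
      have m: "f2 \<in> borel_measurable circ" "(\<lambda>x. q x * fseries c x - fseries d x) \<in> borel_measurable circ"
        using L2_circle_measurable f2_L2 L2_circle_mult[OF q c d] by blast+
      have "(LINT x|circ. f2 x * mode (- k) x) = (LINT x|circ. (q x * fseries c x - fseries d x) * mode (- k) x)"
      proof (rule integral_cong_AE)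
        show "AE x in circ. f2 x * mode (- k) x = (q x * fseries c x - fseries d x) * mode (- k) x"
          using ae' by eventually_elim simp
      qed (intro borel_measurable_times m circ_measurable_continuous continuous_mode)+
      then show ?thesis by (simp add: fcoeff_def)
    qed
    also have "\<dots> = conv (fcoeff q) c k - d k"
      by (subst fcoeff_diff[OF qf]) (auto intro!: integrable_circ_continuous continuous_fseries d
          simp: fcoeff_fseries[OF d] fcoeff_mult_fseries[OF L2_circle_integrable[OF q] c])
    finally show ?thesis unfolding f2_coeff by (simp add: hill_op_def d_def algebra_simps)
  qed
  then show ?thesis using c fc by blast
qed

text \<open>The candidate second derivative q f - d is in L^2 and its mean vanishes by row 0 of the
  equation; integrating twice and matching coefficients gives back the series.\<close>

lemma sequence_imp_hill_graph:
  assumes q: "q \<in> L2_circle 2" and c: "c \<in> ell1" and d: "d \<in> ell1"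
    and eq: "\<And>k. hill_op (fcoeff q) c k = d k"
  shows "hill_graph q (fseries c) (fseries d)"
proof -
  define f2 where "f2 x = q x * fseries c x - fseries d x" for x
  have f2: "f2 \<in> L2_circle 2" unfolding f2_def by (rule L2_circle_mult[OF q c d])
  have qf: "integrable circ (\<lambda>x. q x * fseries c x)"
    by (rule integrable_circ_mult[OF L2_circle_integrable[OF q] continuous_fseries[OF c] norm_fseries_le[OF c]])
  have "fcoeff f2 k = conv (fcoeff q) c k - d k" for k
    unfolding f2_def
    by (subst fcoeff_diff[OF qf]) (auto intro!: integrable_circ_continuous continuous_fseries d
        simp: fcoeff_fseries[OF d] fcoeff_mult_fseries[OF L2_circle_integrable[OF q] c])
  then have f2_coeff: "fcoeff f2 k = - (of_real (pi\<^sup>2) * (of_int k)\<^sup>2 * c k)" for k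
    unfolding eq[symmetric] hill_op_def by simp
  then have "fcoeff f2 0 = 0" by simp
  then obtain f1 where f1: "has_L2_derivative 2 f1 f2" "fcoeff f1 0 = 0"
    by (rule L2_antiderivative[OF f2])
  have "f1 \<in> L2_circle 2"
    using f1(1) by (intro continuous_L2_circle continuous_has_L2_derivative) (auto simp: has_L2_derivative_def)
  then obtain F where F: "has_L2_derivative 2 F f1" "fcoeff F 0 = 0"
    using f1(2) by (rule L2_antiderivative)
  have F_cont: "continuous_on UNIV F" by (rule continuous_has_L2_derivative[OF F(1)])
  have F_per: "F (x + 2) = F x" for x using F(1) by (simp add: has_L2_derivative_def)
  have "(\<lambda>x. F x + c 0) = fseries c"
  proof (rule fcoeff_inject)
    fix k
    have i: "integrable circ F"
      by (intro integrable_circ_continuous continuous_on_subset[OF F_cont]) simp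
    have "fcoeff (\<lambda>x. F x + c 0) k = fcoeff F k + c 0 * (if k = 0 then 1 else 0)"
      using fcoeff_add[OF i, of "\<lambda>x. c 0" k] fcoeff_cmult[of "c 0" "\<lambda>x. 1" k] by (simp add: fcoeff_one)
    also have "\<dots> = c k"
    proof (cases "k = 0")
      case False
      have "\<i> * of_real pi * of_int k * (\<i> * of_real pi * of_int k * fcoeff F k) = - (of_real (pi\<^sup>2) * (of_int k)\<^sup>2 * c k)"
        using f2_coeff[of k] unfolding fcoeff_has_L2_derivative[OF f1(1)] fcoeff_has_L2_derivative[OF F(1)] .
      then have "(of_real pi * of_int k) * ((of_real pi * of_int k) * (fcoeff F k - c k)) = 0"
        by (simp add: power2_eq_square algebra_simps)
      then show ?thesis using False by simp
    qed (simp add: F(2))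
    finally show "fcoeff (\<lambda>x. F x + c 0) k = fcoeff (fseries c) k" by (simp add: fcoeff_fseries[OF c])
  qed (auto intro!: continuous_intros F_cont continuous_fseries c simp: F_per fseries_periodic)
  then have "has_L2_derivative 2 (fseries c) f1"
    using F(1) by (auto simp: has_L2_derivative_def fun_eq_iff simp flip: \<open>(\<lambda>x. F x + c 0) = fseries c\<close>)
  moreover have "AE x in lebesgue. fseries d x = - f2 x + q x * fseries c x"
    by (simp add: f2_def)
  ultimately show ?thesis using f1(1) by (auto simp: hill_graph_def)
qed

lemma root_space_eq:
  assumes q: "q \<in> L2_circle 2"
  shows "root_space q z m = fseries ` root_seq (fcoeff q) z m"
proof (induction m)
  case 0
  then show ?case by (auto simp: image_iff fun_eq_iff)
next
  case (Suc m)
  show ?case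
  proof (intro equalityI subsetI)
    fix f assume "f \<in> root_space q z (Suc m)"
    then obtain g where "g \<in> root_space q z m" "hill_graph q f (\<lambda>x. z * f x + g x)" by auto
    then obtain e where e: "e \<in> root_seq (fcoeff q) z m" "hill_graph q f (\<lambda>x. z * f x + fseries e x)"
      using Suc by auto
    then show "f \<in> fseries ` root_seq (fcoeff q) z (Suc m)"
      using hill_graph_imp_sequence[OF q root_seq_ell1[OF e(1)] e(2)] by auto
  next
    fix f assume "f \<in> fseries ` root_seq (fcoeff q) z (Suc m)"
    then obtain c e where c: "f = fseries c" "c \<in> ell1" and e: "e \<in> root_seq (fcoeff q) z m"
      and eq: "\<And>k. hill_op (fcoeff q) c k = z * c k + e k" by auto
    have e1: "e \<in> ell1" by (rule root_seq_ell1[OF e])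
    have "hill_graph q (fseries c) (fseries (\<lambda>k. z * c k + e k))"
      by (rule sequence_imp_hill_graph[OF q c(2) _ eq]) (intro ell1_add ell1_cmult c e1)
    moreover have "fseries (\<lambda>k. z * c k + e k) = (\<lambda>x. z * fseries c x + fseries e x)"
      by (rule ext) (simp add: fseries_add ell1_cmult c e1 fseries_cmult)
    moreover have "fseries e \<in> root_space q z m" using Suc e by blast
    ultimately show "f \<in> root_space q z (Suc m)" using c(1) by auto
  qed
qed

lemma
  assumes q: "q \<in> L2_circle 1"
  shows L2_circle_double: "q \<in> L2_circle 2"
    and fcoeff_double: "fcoeff q k = (if even k then fourier_coeff q (k div 2) else 0)"
proof -
  have per: "q (x + 1) = q x" for x using q by (simp add: L2_circle_def)
  have per': "q (1 + x) = q x" for x using per[of x] by (simp only: add.commute)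
  have per2: "q (x + 2) = q x" for x using per[of x] per[of "x + 1"] by (simp add: add.assoc)
  have "(\<lambda>x. (norm (q x))\<^sup>2) integrable_on {0..1}"
  proof (rule integrable_on_lebesgue_on)
    show "integrable (lebesgue_on {0..1}) (\<lambda>x. (norm (q x))\<^sup>2)"
      using q unfolding L2_circle_def mem_Collect_eq by (elim conjE)
  qed simp
  moreover from this have "(\<lambda>x. (norm (q x))\<^sup>2) integrable_on {1..2}"
    using integrable_on_shift_Icc_real[of "\<lambda>x. (norm (q x))\<^sup>2" 1 0 1] by (simp add: o_def per')
  ultimately have "(\<lambda>x. (norm (q x))\<^sup>2) integrable_on {0..2}"
    by - (rule Henstock_Kurzweil_Integration.integrable_combine[where c = 1], auto)
  then have "(\<lambda>x. (norm (q x))\<^sup>2) absolutely_integrable_on {0..2}"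
    by (intro nonnegative_absolutely_integrable_1) auto
  then have "integrable circ (\<lambda>x. (norm (q x))\<^sup>2)"
    by (rule absolutely_integrable_imp_integrable) auto
  then show L2: "q \<in> L2_circle 2" using q per2 by (simp add: L2_circle_def)
  define F where "F x = q x * mode (- k) x" for x
  have F_circ: "integrable circ F" unfolding F_def by (rule integrable_circ_mode[OF L2_circle_integrable[OF L2]])
  have F_int: "F integrable_on {0..2}" by (rule integrable_on_lebesgue_on[OF F_circ]) auto
  have F_leb: "integrable (lebesgue_on {0..1}) F"
    by (rule integrable_subinterval[OF F_circ]) auto
  \<comment> \<open>The factor (-1)^k picked up on the second unit interval: odd coefficients
    cancel, even ones are those of period 1.\<close>
  define s where "s = cis (pi * of_int (- k))"
  have "integral {0..2} F = integral {0..1} F + integral {1..2} F"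
    by (rule Henstock_Kurzweil_Integration.integral_combine[symmetric, OF _ _ F_int]) auto
  also have "integral {1..2} F = integral {0..1} (F \<circ> (+) 1)"
    using integral_shift_Icc_real[of 0 1 F 1] by simp
  also have "F \<circ> (+) 1 = (\<lambda>x. F x * s)"
  proof (rule ext)
    fix x
    have "mode (- k) (1 + x) = mode (- k) x * s" by (simp add: s_def mode_def cis_mult algebra_simps)
    then show "(F \<circ> (+) 1) x = F x * s" by (simp add: F_def per')
  qed
  also have "integral {0..1} (\<lambda>x. F x * s) = integral {0..1} F * s" by simp
  finally have "integral {0..2} F = integral {0..1} F * (1 + s)" by (simp add: distrib_left)
  moreover have "fcoeff q k = (1 / 2) * integral {0..2} F"
    unfolding integral_circ[OF F_circ, symmetric] by (simp add: fcoeff_def F_def[abs_def])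
  ultimately have *: "fcoeff q k = (1 / 2) * (integral {0..1} F * (1 + s))" by simp
  show "fcoeff q k = (if even k then fourier_coeff q (k div 2) else 0)"
  proof (cases "even k")
    case True
    then obtain j where j: "k = 2 * j" by auto
    have "s = 1" unfolding s_def j using cis_int[of "- j"] by (simp add: mult_ac)
    then have "fcoeff q k = integral {0..1} F" using * by simp
    also have "\<dots> = (LINT x|lebesgue_on {0..1}. F x)"
      by (rule lebesgue_integral_eq_integral[symmetric, OF F_leb]) auto
    also have "\<dots> = fourier_coeff q j"
      unfolding fourier_coeff_def F_def mode_def cis_conv_exp j by (simp add: mult_ac)
    finally show ?thesis using j by simp
  next
    case False
    then obtain j where j: "k = 2 * j + 1" by (auto elim: oddE)
    have "s = cis (2 * pi * of_int (- j)) * cis (- pi)"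
      unfolding s_def j cis_mult by (simp add: algebra_simps)
    then have "s = - 1" using cis_int[of "- j"] by (simp add: complex_eq_iff)
    then show ?thesis using * False by simp
  qed
qed

subsection \<open>Lyapunov-Schmidt reduction to the modes \<open>\<plusminus>n\<close>\<close>

text \<open>Convolution is symmetric for the bilinear pairing of x_k with y_{-k}: substituting j by
  -j turns the kernel into p(j - k), and the double sum may be exchanged as it converges
  absolutely.\<close>

lemma conv_symmetric:
  assumes "ell2_le p v" "x \<in> ell1" "y \<in> ell1"
  shows "(\<Sum>\<^sub>\<infinity>k. conv p y (- k) * x k) = (\<Sum>\<^sub>\<infinity>k. conv p x k * y (- k))"
proof -
  have bij: "bij_betw (uminus :: int \<Rightarrow> int) UNIV UNIV"
    by (rule bij_betwI[where g = uminus]) auto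
  define y' where "y' k = y (- k)" for k
  have y': "(\<lambda>k. norm (y' k)) summable_on UNIV"
    using assms(3) summable_on_reindex_bij_betw[OF bij, of "\<lambda>k. norm (y k)"] by (simp add: ell1_def y'_def)
  have x: "(\<lambda>k. norm (x k)) summable_on UNIV" using assms(2) by (simp add: ell1_def)
  have conv_y: "conv p y (- k) = (\<Sum>\<^sub>\<infinity>j. p (j - k) * y' j)" for k
    unfolding conv_def y'_def
    using infsum_reindex_bij_betw[OF bij, of "\<lambda>j. p (- k - j) * y j"] by simp
  have prod: "(\<lambda>i. norm (case i of (k, j) \<Rightarrow> x k * y' j)) summable_on UNIV \<times> UNIV"
    by (rule summable_on_SigmaI[where g = "\<lambda>k. norm (x k) * (\<Sum>\<^sub>\<infinity>j. norm (y' j))"])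
      (auto simp: norm_mult intro!: has_sum_cmult_right has_sum_infsum y' summable_on_cmult_left x)
  have sm: "(\<lambda>(k, j). p (j - k) * y' j * x k) summable_on UNIV \<times> UNIV"
  proof (rule abs_summable_summable, rule Infinite_Sum.abs_summable_on_comparison_test[where
        g = "\<lambda>i. of_real v * (case i of (k, j) \<Rightarrow> x k * y' j)"])
    show "(\<lambda>i. norm (of_real v * (case i of (k, j) \<Rightarrow> x k * y' j))) summable_on UNIV \<times> UNIV"
      unfolding norm_mult by (rule summable_on_cmult_right) (use prod in \<open>simp add: norm_mult\<close>)
    show "norm (case i of (k, j) \<Rightarrow> p (j - k) * y' j * x k)
        \<le> norm (complex_of_real v * (case i of (k, j) \<Rightarrow> x k * y' j))" for i
    proof (cases i)
      case (Pair k j)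
      have "norm (p (j - k)) * norm (x k * y' j) \<le> \<bar>v\<bar> * norm (x k * y' j)"
        using ell2_le_norm[OF assms(1), of "j - k"] by (intro mult_right_mono) auto
      then show ?thesis by (simp add: Pair norm_mult mult_ac)
    qed
  qed
  have "(\<Sum>\<^sub>\<infinity>k. conv p y (- k) * x k) = (\<Sum>\<^sub>\<infinity>k. \<Sum>\<^sub>\<infinity>j. p (j - k) * y' j * x k)"
    unfolding conv_y by (simp add: infsum_cmult_left')
  also have "\<dots> = (\<Sum>\<^sub>\<infinity>j. \<Sum>\<^sub>\<infinity>k. p (j - k) * y' j * x k)"
    by (rule infsum_swap_banach[OF sm])
  also have "\<dots> = (\<Sum>\<^sub>\<infinity>j. conv p x j * y' j)"
    unfolding conv_def infsum_cmult_left'[symmetric] by (simp add: mult_ac)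
  finally show ?thesis by (simp add: y'_def)
qed

text \<open>The exponent is halved because coefficient j of the 1-periodic potential carries the
  index k = 2j for period 2.\<close>

locale hill_gap =
  fixes p :: "int \<Rightarrow> complex" and a v :: real and n :: int
  assumes weighted: "ell2_le (\<lambda>k. of_real (exp (a * \<bar>of_int k\<bar> / 2)) * p k) v"
    and a: "0 \<le> a" and n: "1 \<le> n" and vn: "4 * v \<le> of_int n"
begin

lemma p: "ell2_le p v"
proof (rule ell2_le_mono[OF weighted _ order_refl])
  fix k
  have "1 \<le> exp (a * \<bar>of_int k\<bar> / 2)" using a by simp
  then show "norm (p k) \<le> norm (complex_of_real (exp (a * \<bar>of_int k\<bar> / 2)) * p k)"
    using mult_right_mono[of 1 "exp (a * \<bar>of_int k\<bar> / 2)" "norm (p k)"] by (simp add: norm_mult)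
qed

lemma v_nonneg: "0 \<le> v" using p by (rule ell2_le_nonneg)

section \<open>Weights centred at a mode\<close>

definition wt :: "int \<Rightarrow> int \<Rightarrow> real" where
  "wt s k = exp (a * \<bar>of_int (k - s)\<bar> / 2)"

lemma wt_ge: "1 \<le> wt s k" using a by (simp add: wt_def)

lemma wt_pos: "0 < wt s k" by (simp add: wt_def)

lemma wt_self [simp]: "wt s s = 1" by (simp add: wt_def)

definition scaled :: "int \<Rightarrow> (int \<Rightarrow> complex) \<Rightarrow> int \<Rightarrow> complex" where
  "scaled s c k = of_real (wt s k) * c k"

lemma unscaled:
  assumes "scaled s c \<in> ell1"
  shows "c \<in> ell1" "ell1_norm c \<le> ell1_norm (scaled s c)"
proof -
  have "norm (c k) \<le> norm (scaled s c k)" for k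
    using mult_right_mono[OF wt_ge[of s k], of "norm (c k)"] wt_pos[of s k]
    by (simp add: scaled_def norm_mult)
  then show "c \<in> ell1" "ell1_norm c \<le> ell1_norm (scaled s c)"
    using ell1_mono[OF assms] by blast+
qed

text \<open>The triangle inequality makes the ratio of weights at k and j at most exp (a |k - j| /
  2), which the weighted bound on \<open>p\<close> absorbs, whatever the centre s.\<close>

lemma scaled_conv:
  assumes "scaled s c \<in> ell1"
  shows "ell2_le (scaled s (conv p c)) (v * ell1_norm (scaled s c))"
proof -
  define K where "K k j = of_real (wt s k / wt s j) * p (k - j)" for k j
  have "ell2_le (\<lambda>k. K k j) v" for j
  proof (rule ell2_le_mono[OF ell2_le_shift[OF weighted, of j] _ order_refl])
    fix k
    have "real_of_int \<bar>k - s\<bar> \<le> real_of_int \<bar>k - j\<bar> + real_of_int \<bar>j - s\<bar>" by linarith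
    then have "a * real_of_int \<bar>k - s\<bar> \<le> a * real_of_int \<bar>k - j\<bar> + a * real_of_int \<bar>j - s\<bar>"
      using a by (metis mult_left_mono distrib_left)
    then have "wt s k \<le> exp (a * \<bar>of_int (k - j)\<bar> / 2) * wt s j"
      unfolding wt_def exp_add[symmetric] by (simp add: field_simps)
    then have "wt s k / wt s j \<le> exp (a * \<bar>of_int (k - j)\<bar> / 2)"
      using wt_pos[of s j] by (simp add: field_simps)
    then show "norm (K k j) \<le> norm (complex_of_real (exp (a * \<bar>of_int (k - j)\<bar> / 2)) * p (k - j))"
      using mult_right_mono[of "wt s k / wt s j" "exp (a * \<bar>of_int (k - j)\<bar> / 2)" "norm (p (k - j))"]
        wt_pos[of s j] wt_pos[of s k] by (simp add: K_def norm_mult norm_divide)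
  qed
  from ell2_le_kernel[OF this assms]
  have *: "ell2_le (\<lambda>k. \<Sum>\<^sub>\<infinity>j. K k j * scaled s c j) (v * ell1_norm (scaled s c))" .
  have "K k j * scaled s c j = of_real (wt s k) * (p (k - j) * c j)" for k j
    using wt_pos[of s j] by (simp add: K_def scaled_def)
  then have "(\<Sum>\<^sub>\<infinity>j. K k j * scaled s c j) = scaled s (conv p c) k" for k
    unfolding scaled_def[of s "conv p c"] conv_def infsum_cmult_right'[symmetric] by (simp only:)
  then have "(\<lambda>k. \<Sum>\<^sub>\<infinity>j. K k j * scaled s c j) = scaled s (conv p c)" by (rule ext)
  with * show ?thesis by simp
qed

definition strip :: "complex set" where
  "strip = {z. \<bar>Re z - pi\<^sup>2 * (of_int n)\<^sup>2\<bar> \<le> 2 * real_of_int n}"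

definition den :: "complex \<Rightarrow> int \<Rightarrow> complex" where
  "den z k = of_real (pi\<^sup>2 * (of_int k)\<^sup>2) - z"

text \<open>The unperturbed distance is at least 9 |k^2 - n^2|; being in the strip costs at most 2n
  <= 2 |k^2 - n^2|, which leaves the factor 7.\<close>

lemma den_ge:
  assumes "z \<in> strip" "k \<noteq> n" "k \<noteq> - n"
  shows "7 * \<bar>real_of_int (k\<^sup>2 - n\<^sup>2)\<bar> \<le> norm (den z k)" "0 < norm (den z k)"
proof -
  have "\<bar>k\<^sup>2 - n\<^sup>2\<bar> = \<bar>\<bar>k\<bar> - n\<bar> * (\<bar>k\<bar> + n)"
  proof -
    have "k\<^sup>2 - n\<^sup>2 = (\<bar>k\<bar> - n) * (\<bar>k\<bar> + n)"
      by (simp add: algebra_simps power2_eq_square flip: abs_mult)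
    then show ?thesis using n by (simp add: abs_mult)
  qed
  moreover have "1 * n \<le> \<bar>\<bar>k\<bar> - n\<bar> * (\<bar>k\<bar> + n)"
    using assms n by (intro mult_mono) auto
  ultimately have *: "n \<le> \<bar>k\<^sup>2 - n\<^sup>2\<bar>" by simp
  then have nk: "real_of_int n \<le> \<bar>real_of_int (k\<^sup>2 - n\<^sup>2)\<bar>"
    by (metis of_int_abs of_int_le_iff)
  have pi2: "9 \<le> pi\<^sup>2" using pi_gt3 power_mono[of 3 pi 2] by simp
  have "9 * \<bar>real_of_int (k\<^sup>2 - n\<^sup>2)\<bar> \<le> pi\<^sup>2 * \<bar>real_of_int (k\<^sup>2 - n\<^sup>2)\<bar>"
    by (rule mult_right_mono[OF pi2]) simp
  also have "\<dots> = \<bar>pi\<^sup>2 * (of_int k)\<^sup>2 - pi\<^sup>2 * (of_int n)\<^sup>2\<bar>"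
    by (simp add: abs_mult right_diff_distrib[symmetric])
  also have "\<dots> \<le> \<bar>Re (den z k)\<bar> + 2 * real_of_int n"
    using assms(1) unfolding strip_def den_def by auto
  finally have "9 * \<bar>real_of_int (k\<^sup>2 - n\<^sup>2)\<bar> \<le> \<bar>Re (den z k)\<bar> + 2 * real_of_int n" .
  then show *: "7 * \<bar>real_of_int (k\<^sup>2 - n\<^sup>2)\<bar> \<le> norm (den z k)"
    using nk abs_Re_le_cmod[of "den z k"] by simp
  have "0 < \<bar>real_of_int (k\<^sup>2 - n\<^sup>2)\<bar>"
    by (rule less_le_trans[OF _ nk]) (use n in simp)
  then show "0 < norm (den z k)"
    by (intro less_le_trans[OF _ *] mult_pos_pos) auto
qed

lemma divide_den:
  assumes "z \<in> strip" "ell2_le y Y" "x n = 0" "x (- n) = 0"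
    and "\<And>k. k \<noteq> n \<Longrightarrow> k \<noteq> - n \<Longrightarrow> norm (den z k) * norm (x k) \<le> norm (y k)"
  shows "x \<in> ell1" "ell1_norm x \<le> 2 / (7 * real_of_int n) * Y"
proof -
  have L: "L2_set (\<lambda>k. 1 / norm (den z k)) H \<le> 2 / (7 * real_of_int n)" if "finite H" "H \<subseteq> {k. k \<noteq> n \<and> k \<noteq> - n}" for H
  proof (rule L2_set_inverse_off_diagonal[OF that n])
    show "7 * \<bar>real_of_int (k\<^sup>2 - n\<^sup>2)\<bar> \<le> norm (den z k)" if "k \<in> H" for k
      using that \<open>H \<subseteq> _\<close> by (intro den_ge(1)[OF assms(1)]) auto
  qed simp
  show "x \<in> ell1" "ell1_norm x \<le> 2 / (7 * real_of_int n) * Y"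
    using ell1_divide[OF assms(2), where K = "{k. k \<noteq> n \<and> k \<noteq> - n}" and d = "\<lambda>k. norm (den z k)"
        and s = "2 / (7 * real_of_int n)" and x = x] L den_ge(2)[OF assms(1)] assms(3,4,5) by auto
qed

lemma scaled_v_le: "2 / (7 * real_of_int n) * v \<le> 1 / 14"
  using vn n by (simp add: field_simps)

text \<open>The vector e_s + x solves every row of the eigenvalue equation except those at n and -n.
  The radius 1/13 solves r = (1 + r)/14, where 1/14 is the norm of one solution step.\<close>

definition reduced_solution :: "complex \<Rightarrow> int \<Rightarrow> (int \<Rightarrow> complex) \<Rightarrow> bool" where
  "reduced_solution z s x \<longleftrightarrow> x n = 0 \<and> x (- n) = 0 \<and> scaled s x \<in> ell1 \<and>
     ell1_norm (scaled s x) \<le> 1 / 13 \<and>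
     (\<forall>k. k \<noteq> n \<longrightarrow> k \<noteq> - n \<longrightarrow> den z k * x k = - conv p (\<lambda>k. single s k + x k) k)"

lemma scaled_single_add:
  assumes "scaled s x \<in> ell1" "ell1_norm (scaled s x) \<le> 1 / 13"
  shows "scaled s (\<lambda>k. single s k + x k) \<in> ell1" "ell1_norm (scaled s (\<lambda>k. single s k + x k)) \<le> 14 / 13"
proof -
  have e: "scaled s (\<lambda>k. single s k + x k) = (\<lambda>k. single s k + scaled s x k)"
    by (auto simp: scaled_def single_def algebra_simps)
  show "scaled s (\<lambda>k. single s k + x k) \<in> ell1" "ell1_norm (scaled s (\<lambda>k. single s k + x k)) \<le> 14 / 13"
    unfolding e using ell1_add[OF single_ell1(1) assms(1), of s] ell1_norm_add[OF single_ell1(1) assms(1), of s] assms(2)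
    by auto
qed

lemma reduced_solution_exists:
  assumes z: "z \<in> strip"
  shows "\<exists>x. reduced_solution z s x"
proof -
  define S where "S x c \<longleftrightarrow> x n = 0 \<and> x (- n) = 0 \<and> scaled s x \<in> ell1 \<and> ell1_norm (scaled s x) \<le> c" for x c
  \<comment> \<open>In terms of finite sums the ball is visibly closed under pointwise limits, as
    the contraction principle demands.\<close>
  have S_sums: "S x c \<longleftrightarrow> x n = 0 \<and> x (- n) = 0 \<and> (\<forall>H. finite H \<longrightarrow> (\<Sum>k\<in>H. norm (scaled s x k)) \<le> c)" for x c
    unfolding S_def using ell1_bounded[of "scaled s x" c] sum_le_ell1_norm[of "scaled s x"] by (meson order_trans)
  define F where "F x k = (if k = n \<or> k = - n then 0 else - conv p (\<lambda>k. single s k + x k) k / den z k)" for x k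
  have div: "S (\<lambda>k. if k = n \<or> k = - n then 0 else y k / den z k) (2 / (7 * real_of_int n) * Y)"
    if y: "ell2_le (scaled s y) Y" for y Y
  proof -
    let ?x = "\<lambda>k. if k = n \<or> k = - n then 0 else y k / den z k"
    have "norm (den z k) * norm (scaled s ?x k) \<le> norm (scaled s y k)" if "k \<noteq> n" "k \<noteq> - n" for k
      using den_ge(2)[OF z that] that by (simp add: scaled_def norm_mult norm_divide)
    then show ?thesis
      unfolding S_def using divide_den[OF z y, of "scaled s ?x"] by (simp add: scaled_def)
  qed
  have "\<exists>x. S x (1 / 13) \<and> F x = x"
  proof (rule contraction_fixpoint[where K = "\<lambda>_. 1"])
    show "S (\<lambda>i. x i + y i) (a + b)" if "S x a" "S y b" for x y a b
    proof -
      have "scaled s (\<lambda>i. x i + y i) = (\<lambda>i. scaled s x i + scaled s y i)"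
        by (auto simp: scaled_def algebra_simps)
      then show ?thesis
        using that ell1_add[of "scaled s x" "scaled s y"] ell1_norm_add[of "scaled s x" "scaled s y"]
        unfolding S_def by auto
    qed
    show "S (\<lambda>i. - x i) a" if "S x a" for x a
      using that by (simp add: S_sums scaled_def norm_mult)
    show "norm (x i) \<le> 1 * a" if "S x a" for x a i
      using that unscaled[of s x] norm_le_ell1_norm[of x i] by (simp add: S_def)
    show "S y a" if "\<And>j::nat. S (x j) a" "\<And>i. (\<lambda>j. x j i) \<longlonglongrightarrow> y i" for x y a
      unfolding S_sums
    proof (intro conjI allI impI)
      have "x j n = 0" "x j (- n) = 0" for j using that(1)[of j] by (auto simp: S_def)
      then show "y n = 0" "y (- n) = 0"
        using that(2)[of n] that(2)[of "- n"] by (auto simp: LIMSEQ_const_iff)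
      fix H :: "int set" assume H: "finite H"
      have "(\<lambda>j. \<Sum>k\<in>H. norm (scaled s (x j) k)) \<longlonglongrightarrow> (\<Sum>k\<in>H. norm (scaled s y k))"
        unfolding scaled_def by (intro tendsto_intros that)
      then show "(\<Sum>k\<in>H. norm (scaled s y k)) \<le> a"
        by (rule LIMSEQ_le_const2) (use that(1) H in \<open>auto simp: S_sums\<close>)
    qed
    show "S x b" if "S x a" "a \<le> b" for x a b using that by (simp add: S_def)
    show "S (\<lambda>i. 0) (1 / 13)" by (simp add: S_sums scaled_def)
    show "(0::real) \<le> 1 / 13" by simp
    show "S (F x) (1 / 13)" if "S x (1 / 13)" for x
    proof -
      have x: "scaled s (\<lambda>k. single s k + x k) \<in> ell1" "ell1_norm (scaled s (\<lambda>k. single s k + x k)) \<le> 14 / 13"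
        using scaled_single_add that by (auto simp: S_def)
      have "ell2_le (scaled s (\<lambda>k. - conv p (\<lambda>k. single s k + x k) k)) (v * (14 / 13))"
        by (rule ell2_le_mono[OF scaled_conv[OF x(1)] _ mult_left_mono[OF x(2) v_nonneg]])
          (simp add: scaled_def norm_mult)
      from div[OF this] have "S (F x) (2 / (7 * real_of_int n) * (v * (14 / 13)))" unfolding F_def[abs_def] .
      moreover have "2 / (7 * real_of_int n) * (v * (14 / 13)) \<le> 1 / 13"
        using mult_right_mono[OF scaled_v_le, of "14 / 13"] by simp
      ultimately show ?thesis by (simp add: S_def)
    qed
    show "S (\<lambda>i. F x i - F y i) (a / 2)" if "S x (1 / 13)" "S y (1 / 13)" "S (\<lambda>i. x i - y i) a" for x y a
    proof -
      have xy: "x \<in> ell1" "y \<in> ell1" using that unscaled by (auto simp: S_def)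
      have d: "scaled s (\<lambda>i. x i - y i) \<in> ell1" "ell1_norm (scaled s (\<lambda>i. x i - y i)) \<le> a"
        using that(3) by (auto simp: S_def)
      have "ell2_le (scaled s (\<lambda>k. - conv p (\<lambda>i. x i - y i) k)) (v * a)"
        by (rule ell2_le_mono[OF scaled_conv[OF d(1)] _ mult_left_mono[OF d(2) v_nonneg]])
          (simp add: scaled_def norm_mult)
      from div[OF this] have "S (\<lambda>k. if k = n \<or> k = - n then 0 else - conv p (\<lambda>i. x i - y i) k / den z k)
          (2 / (7 * real_of_int n) * (v * a))" .
      moreover have "2 / (7 * real_of_int n) * (v * a) \<le> a / 2"
      proof -
        have "0 \<le> a" using d(2) ell1_norm_nonneg order_trans by blast
        have "2 / (7 * real_of_int n) * (v * a) = 2 / (7 * real_of_int n) * v * a" by simp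
        also have "\<dots> \<le> 1 / 14 * a" by (rule mult_right_mono[OF scaled_v_le \<open>0 \<le> a\<close>])
        also have "\<dots> \<le> a / 2" using \<open>0 \<le> a\<close> by simp
        finally show ?thesis .
      qed
      moreover have "(\<lambda>k. if k = n \<or> k = - n then 0 else - conv p (\<lambda>i. x i - y i) k / den z k)
          = (\<lambda>i. F x i - F y i)"
        by (rule ext) (auto simp: F_def conv_add[OF p] conv_diff[OF p] xy diff_divide_distrib add_divide_distrib)
      ultimately show ?thesis by (simp add: S_def)
    qed
  qed
  then obtain x where x: "S x (1 / 13)" "F x = x" by blast
  have "den z k * x k = - conv p (\<lambda>k. single s k + x k) k" if "k \<noteq> n" "k \<noteq> - n" for k
  proof -
    have "x k = - conv p (\<lambda>k. single s k + x k) k / den z k"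
      using fun_cong[OF x(2), of k] that by (simp add: F_def)
    moreover have "den z k \<noteq> 0" using den_ge(2)[OF z that] by auto
    ultimately show ?thesis by (simp add: nonzero_eq_divide_eq mult.commute)
  qed
  then show ?thesis using x(1) by (auto simp: reduced_solution_def S_def)
qed

lemma reduced_solution_ell1:
  assumes "reduced_solution z s x"
  shows "x \<in> ell1" "ell1_norm x \<le> 1 / 13"
  using assms unscaled[of s x] by (auto simp: reduced_solution_def)

lemma homogeneous_solution_zero:
  assumes z: "z \<in> strip" and y: "y \<in> ell1" "y n = 0" "y (- n) = 0"
    and eq: "\<And>k. k \<noteq> n \<Longrightarrow> k \<noteq> - n \<Longrightarrow> den z k * y k = - conv p y k"
  shows "y k = 0"
proof -
  have "ell1_norm y \<le> 2 / (7 * real_of_int n) * (v * ell1_norm y)"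
  proof (rule divide_den(2)[OF z ell2_le_conv[OF p y(1)] y(2,3)])
    show "norm (den z k) * norm (y k) \<le> norm (conv p y k)" if "k \<noteq> n" "k \<noteq> - n" for k
      unfolding norm_mult[symmetric] eq[OF that] by simp
  qed
  also have "\<dots> \<le> 1 / 14 * ell1_norm y"
    using mult_right_mono[OF scaled_v_le ell1_norm_nonneg[of y]] by simp
  finally have "ell1_norm y \<le> 0" by simp
  then show ?thesis by (rule ell1_norm_le_zero[OF y(1)])
qed

section \<open>Entries of the reduced two-by-two matrix, from mode s to mode t\<close>

definition coupling :: "int \<Rightarrow> (int \<Rightarrow> complex) \<Rightarrow> int \<Rightarrow> complex" where
  "coupling s x t = conv p (\<lambda>k. single s k + x k) t"

text \<open>The weight centred at the source s equals exp (a n) at the opposite mode, at distance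
  2n; dividing by it gives the exponential gain.\<close>

lemma coupling_bound:
  assumes "reduced_solution z s x" "s = n \<and> t = - n \<or> s = - n \<and> t = n"
  shows "norm (coupling s x t) \<le> exp (- a * n) * (14 / 13 * v)"
proof -
  have x: "scaled s (\<lambda>k. single s k + x k) \<in> ell1" "ell1_norm (scaled s (\<lambda>k. single s k + x k)) \<le> 14 / 13"
    using scaled_single_add assms by (auto simp: reduced_solution_def)
  have "norm (scaled s (conv p (\<lambda>k. single s k + x k)) t) \<le> v * (14 / 13)"
    using ell2_le_norm[OF scaled_conv[OF x(1)], of t] mult_left_mono[OF x(2) v_nonneg] by linarith
  moreover have "wt s t = exp (a * n)" using assms(2) n by (auto simp: wt_def)
  ultimately have "exp (a * n) * norm (coupling s x t) \<le> v * (14 / 13)"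
    by (simp add: scaled_def coupling_def norm_mult)
  then show ?thesis by (simp add: exp_minus field_simps)
qed

text \<open>
  The reflection \<open>k \<mapsto> -k\<close> turns the equation for \<open>y\<close> into the transposed equation for \<open>x\<close>.
\<close>

lemma coupling_diagonal:
  assumes x: "reduced_solution z n x" and y: "reduced_solution z (- n) y"
  shows "coupling n x n = coupling (- n) y (- n)"
proof -
  note x1 = reduced_solution_ell1(1)[OF x] and y1 = reduced_solution_ell1(1)[OF y]
  have bij: "bij_betw (uminus :: int \<Rightarrow> int) UNIV UNIV"
    by (rule bij_betwI[where g = uminus]) auto
  have bounded_mult: "(\<lambda>k. u k * c k) summable_on UNIV" if "c \<in> ell1" "\<And>k. norm (u k) \<le> C" for u c C
  proof (rule abs_summable_summable, rule Infinite_Sum.abs_summable_on_comparison_test[where g = "\<lambda>k. of_real C * c k"])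
    show "(\<lambda>k. norm (of_real C * c k)) summable_on UNIV"
      using ell1_cmult[OF that(1), of "of_real C"] by (simp add: ell1_def)
    show "norm (u k * c k) \<le> norm (of_real C * c k)" for k
      using that(2)[of k] by (simp add: norm_mult mult_right_mono)
  qed
  have y1': "(\<lambda>k. y (- k)) \<in> ell1"
    using y1 summable_on_reindex_bij_betw[OF bij, of "\<lambda>k. norm (y k)"] by (simp add: ell1_def)
  \<comment> \<open>Row k for x and row -k for y have the same divisor, so cross-multiplying removes
    it. After summation over k the two convolution terms cancel by \<open>conv_symmetric\<close>,
    and the linear ones are the corrections to the two diagonal entries.\<close>
  have eq: "p (n - k) * x k + conv p y (- k) * x k = p (k - n) * y (- k) + conv p x k * y (- k)" for k
  proof (cases "k = n \<or> k = - n")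
    case True
    then show ?thesis using x y by (auto simp: reduced_solution_def)
  next
    case False
    have "den z k * x k = - (p (k - n) + conv p x k)"
      using x False by (simp add: reduced_solution_def conv_add[OF p _ x1] conv_single)
    moreover have "den z (- k) * y (- k) = - (p (n - k) + conv p y (- k))"
    proof -
      have "- k \<noteq> n \<and> - k \<noteq> - n" using False by auto
      then have "den z (- k) * y (- k) = - conv p (\<lambda>k. single (- n) k + y k) (- k)"
        using y unfolding reduced_solution_def by blast
      then show ?thesis by (simp add: conv_add[OF p _ y1] conv_single)
    qed
    moreover have "den z (- k) = den z k" by (simp add: den_def)
    moreover have "B * u = A * w" if "d * u = - A" "d' * w = - B" "d' = d" for A B d d' u w :: complex
    proof -
      have "A = - (d * u)" "B = - (d * w)" using that by auto
      then show ?thesis by simp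
    qed
    ultimately have "(p (n - k) + conv p y (- k)) * x k = (p (k - n) + conv p x k) * y (- k)" by blast
    then show ?thesis by (simp add: distrib_right)
  qed
  have s: "(\<lambda>k. p (n - k) * x k) summable_on UNIV" "(\<lambda>k. conv p y (- k) * x k) summable_on UNIV"
    "(\<lambda>k. p (k - n) * y (- k)) summable_on UNIV" "(\<lambda>k. conv p x k * y (- k)) summable_on UNIV"
    by (rule bounded_mult[OF x1 ell2_le_norm[OF p]] bounded_mult[OF x1 norm_conv_le[OF p y1]]
        bounded_mult[OF y1' ell2_le_norm[OF p]] bounded_mult[OF y1' norm_conv_le[OF p x1]])+
  have "(\<Sum>\<^sub>\<infinity>k. p (n - k) * x k) + (\<Sum>\<^sub>\<infinity>k. conv p y (- k) * x k)
      = (\<Sum>\<^sub>\<infinity>k. p (k - n) * y (- k)) + (\<Sum>\<^sub>\<infinity>k. conv p x k * y (- k))"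
    unfolding infsum_add[OF s(1,2), symmetric] infsum_add[OF s(3,4), symmetric] eq ..
  then have "(\<Sum>\<^sub>\<infinity>k. p (n - k) * x k) = (\<Sum>\<^sub>\<infinity>k. p (k - n) * y (- k))"
    unfolding conv_symmetric[OF p x1 y1] by simp
  also have "\<dots> = conv p y (- n)"
    unfolding conv_def using infsum_reindex_bij_betw[OF bij, of "\<lambda>k. p (- n - k) * y k"] by simp
  finally have "conv p x n = conv p y (- n)" by (simp add: conv_def)
  then show ?thesis
    by (simp add: coupling_def conv_add[OF p _ x1] conv_add[OF p _ y1] conv_single)
qed

text \<open>The difference of the two solutions satisfies the reduced equation with source (z - z')
  x'. Since x' has norm at most 1/13 and each division gains 1/n, the product with v <= n/4 is a
  small multiple of |z - z'|.\<close>

lemma coupling_lipschitz: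
  assumes z: "z \<in> strip" "reduced_solution z n x" and z': "z' \<in> strip" "reduced_solution z' n x'"
  shows "norm (coupling n x n - coupling n x' n) \<le> norm (z - z') / 10"
proof -
  note x1 = reduced_solution_ell1(1)[OF z(2)] and x1' = reduced_solution_ell1[OF z'(2)]
  define y where "y k = x k - x' k" for k
  have y1: "y \<in> ell1" unfolding y_def by (rule ell1_diff[OF x1 x1'(1)])
  define g where "g k = (z - z') * x' k - conv p y k" for k
  have g: "ell2_le g (norm (z - z') * (1 / 13) + v * ell1_norm y)"
    unfolding g_def
    by (intro ell2_le_diff ell2_le_cmult ell2_le_conv[OF p y1]
        ell2_le_mono[OF ell2_le_ell1[OF x1'(1)] order_refl x1'(2)])
  have "ell1_norm y \<le> 2 / (7 * real_of_int n) * (norm (z - z') * (1 / 13) + v * ell1_norm y)"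
  proof (rule divide_den(2)[OF z(1) g])
    show "y n = 0" "y (- n) = 0" using z(2) z'(2) by (auto simp: y_def reduced_solution_def)
    fix k assume k: "k \<noteq> n" "k \<noteq> - n"
    have "den z k * x k = - conv p (\<lambda>k. single n k + x k) k"
      "den z' k * x' k = - conv p (\<lambda>k. single n k + x' k) k"
      using z(2) z'(2) k by (auto simp: reduced_solution_def)
    then have "den z k * x k = - (conv p (single n) k + conv p x k)"
      "den z' k * x' k = - (conv p (single n) k + conv p x' k)"
      by (simp_all only: conv_add[OF p single_ell1(1) x1] conv_add[OF p single_ell1(1) x1'(1)])
    moreover have "den z k * x' k = den z' k * x' k - (z - z') * x' k"
      by (simp add: den_def left_diff_distrib)
    ultimately have "den z k * y k = g k"
      unfolding y_def g_def conv_diff[OF p x1 x1'(1)] right_diff_distrib by simp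
    then show "norm (den z k) * norm (y k) \<le> norm (g k)" by (simp add: norm_mult[symmetric])
  qed
  also have "\<dots> \<le> 2 / (91 * real_of_int n) * norm (z - z') + 1 / 14 * ell1_norm y"
    using mult_right_mono[OF scaled_v_le ell1_norm_nonneg[of y]] by (simp add: distrib_left)
  finally have "ell1_norm y \<le> 14 / 13 * (2 / (91 * real_of_int n)) * norm (z - z')" by simp
  then have "v * ell1_norm y \<le> (real_of_int n / 4) * (14 / 13 * (2 / (91 * real_of_int n)) * norm (z - z'))"
    using vn n by (intro mult_mono ell1_norm_nonneg) auto
  also have "\<dots> \<le> norm (z - z') / 10" using n by (simp add: field_simps)
  finally have "norm (conv p y n) \<le> norm (z - z') / 10"
    using norm_conv_le[OF p y1, of n] by linarith
  moreover have "coupling n x n - coupling n x' n = conv p y n"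
    unfolding y_def coupling_def conv_diff[OF p x1 x1'(1)]
    by (simp add: conv_add[OF p _ x1] conv_add[OF p _ x1'(1)])
  ultimately show ?thesis by simp
qed

lemma eigenvalue_near_diagonal:
  assumes z: "z \<in> strip" and x: "reduced_solution z n x"
    and c: "c \<in> ell1" "c \<noteq> (\<lambda>k. 0)" "\<And>k. hill_op p c k = z * c k"
  shows "norm (z - of_real (pi\<^sup>2 * (of_int n)\<^sup>2) - coupling n x n) \<le> exp (- a * n) * (14 / 13 * v)"
proof -
  obtain y where y: "reduced_solution z (- n) y" using reduced_solution_exists[OF z] by blast
  note x1 = reduced_solution_ell1(1)[OF x] and y1 = reduced_solution_ell1(1)[OF y]
  define X where "X k = single n k + x k" for k
  define Y where "Y k = single (- n) k + y k" for k
  have XY1: "X \<in> ell1" "Y \<in> ell1" unfolding X_def Y_def by (intro ell1_add single_ell1 x1 y1)+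
  have XYn: "X n = 1" "X (- n) = 0" "Y n = 0" "Y (- n) = 1"
    using x y n by (auto simp: X_def Y_def reduced_solution_def single_def)
  have eqX: "den z k * X k = - conv p X k" and eqY: "den z k * Y k = - conv p Y k" if "k \<noteq> n" "k \<noteq> - n" for k
    using x y that by (auto simp: X_def[abs_def] Y_def[abs_def] reduced_solution_def single_def)
  \<comment> \<open>\<open>r\<close> satisfies the homogeneous reduced equation, so an eigenvector
    is determined by its two entries at n and -n.\<close>
  define r where "r k = c k - (c n * X k + c (- n) * Y k)" for k
  have conv_r: "conv p r k = conv p c k - (c n * conv p X k + c (- n) * conv p Y k)" for k
    unfolding r_def
    by (simp add: conv_diff[OF p c(1)] conv_add[OF p] conv_cmult ell1_add ell1_cmult XY1)
  have den_c: "den z k * c k = - conv p c k" for k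
    using c(3)[of k] by (simp add: hill_op_def den_def algebra_simps)
  have r0: "r k = 0" for k
  proof (rule homogeneous_solution_zero[OF z])
    show "r \<in> ell1" unfolding r_def by (intro ell1_diff ell1_add ell1_cmult c(1) XY1)
    show "r n = 0" "r (- n) = 0" by (auto simp: r_def XYn)
    show "den z k * r k = - conv p r k" if "k \<noteq> n" "k \<noteq> - n" for k
    proof -
      have "den z k * r k = den z k * c k - (c n * (den z k * X k) + c (- n) * (den z k * Y k))"
        by (simp add: r_def algebra_simps)
      then show ?thesis unfolding den_c eqX[OF that] eqY[OF that] conv_r by simp
    qed
  qed
  have c_eq: "c k = c n * X k + c (- n) * Y k" for k
    using r0[of k] by (simp only: r_def right_minus_eq)
  have conv_c: "conv p c k = c n * conv p X k + c (- n) * conv p Y k" for k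
  proof -
    have "conv p r k = 0" by (simp add: conv_def r0)
    then show ?thesis by (simp only: conv_r right_minus_eq)
  qed
  define A where "A = z - of_real (pi\<^sup>2 * (of_int n)\<^sup>2) - coupling n x n"
  define b where "b = exp (- a * n) * (14 / 13 * v)"
  have "A * c n = c (- n) * coupling (- n) y n"
    using den_c[of n] conv_c[of n] by (simp add: A_def den_def coupling_def X_def[abs_def] Y_def[abs_def] algebra_simps)
  then have 1: "norm A * norm (c n) \<le> b * norm (c (- n))"
    using mult_left_mono[OF coupling_bound[OF y, of n], of "norm (c (- n))"]
    by (simp add: norm_mult[symmetric] b_def) (simp add: norm_mult mult_ac)
  have "A * c (- n) = c n * coupling n x (- n)"
    using den_c[of "- n"] conv_c[of "- n"] coupling_diagonal[OF x y]
    by (simp add: A_def den_def coupling_def X_def[abs_def] Y_def[abs_def] algebra_simps)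
  then have 2: "norm A * norm (c (- n)) \<le> b * norm (c n)"
    using mult_left_mono[OF coupling_bound[OF x, of "- n"], of "norm (c n)"]
    by (simp add: norm_mult[symmetric] b_def) (simp add: norm_mult mult_ac)
  have b: "0 \<le> b" using v_nonneg by (simp add: b_def)
  \<comment> \<open>Using the row whose diagonal entry multiplies the larger component bounds
    \<open>A\<close> directly, without a determinant or a square root.\<close>
  have "norm A * max (norm (c n)) (norm (c (- n))) \<le> b * max (norm (c n)) (norm (c (- n)))"
  proof (cases "norm (c n) \<le> norm (c (- n))")
    case True
    then show ?thesis using 2 mult_left_mono[OF True b] by (simp add: max_def)
  next
    case False
    then have "norm (c (- n)) \<le> norm (c n)" by simp
    then show ?thesis using 1 mult_left_mono[OF \<open>norm (c (- n)) \<le> norm (c n)\<close> b] by (simp add: max_def)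
  qed
  moreover have "0 < max (norm (c n)) (norm (c (- n)))"
  proof (rule ccontr)
    assume "\<not> ?thesis"
    then have "c n = 0" "c (- n) = 0" by (auto simp: max_def not_less split: if_splits)
    then have "c k = 0" for k using c_eq[of k] by simp
    then show False using c(2) by auto
  qed
  ultimately have "norm A \<le> b" by (rule mult_right_le_imp_le)
  then show ?thesis by (simp add: A_def b_def)
qed

theorem eigenvalue_distance:
  assumes "z \<in> strip" "c \<in> ell1" "c \<noteq> (\<lambda>k. 0)" "\<And>k. hill_op p c k = z * c k"
    and "z' \<in> strip" "c' \<in> ell1" "c' \<noteq> (\<lambda>k. 0)" "\<And>k. hill_op p c' k = z' * c' k"
  shows "norm (z - z') \<le> 2 * real_of_int n * exp (- a * n)"
proof -
  obtain x x' where x: "reduced_solution z n x" and x': "reduced_solution z' n x'"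
    using reduced_solution_exists assms(1,5) by blast
  define A where "A = z - of_real (pi\<^sup>2 * (of_int n)\<^sup>2) - coupling n x n"
  define A' where "A' = z' - of_real (pi\<^sup>2 * (of_int n)\<^sup>2) - coupling n x' n"
  define b where "b = exp (- a * n) * (14 / 13 * v)"
  have A: "norm A \<le> b" "norm A' \<le> b"
    unfolding A_def A'_def b_def
    using eigenvalue_near_diagonal[OF assms(1) x assms(2-4)] eigenvalue_near_diagonal[OF assms(5) x' assms(6-8)] by auto
  have "z - z' = (A - A') + (coupling n x n - coupling n x' n)" by (simp add: A_def A'_def)
  then have "norm (z - z') \<le> norm (A - A') + norm (coupling n x n - coupling n x' n)"
    by (metis norm_triangle_ineq)
  also have "norm (A - A') \<le> b + b" using norm_triangle_ineq4[of A A'] A by linarith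
  also have "norm (coupling n x n - coupling n x' n) \<le> norm (z - z') / 10"
    by (rule coupling_lipschitz[OF assms(1) x assms(5) x'])
  \<comment> \<open>The Lipschitz term, a tenth of the left-hand side, is absorbed.\<close>
  finally have "norm (z - z') \<le> 20 / 9 * b" by simp
  also have "\<dots> \<le> exp (- a * n) * (2 * real_of_int n)"
    using vn n mult_left_mono[of "20 / 9 * (14 / 13 * v)" "2 * real_of_int n" "exp (- a * n)"] by (simp add: b_def mult_ac)
  finally show ?thesis by (simp add: mult_ac)
qed

end

subsection \<open>Counting eigenvalues\<close>

lemma fcoeff_fseries_fun: "c \<in> ell1 \<Longrightarrow> fcoeff (fseries c) = c"
  by (rule ext) (rule fcoeff_fseries)

text \<open>Below the level, root spaces of the differential operator are the generalized
  eigenspaces of its restriction to the span of the 2N - 1 graph vectors, so multiplicities add up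
  to that dimension.\<close>

lemma (in hill_level) count_eigenvalues:
  fixes q :: "real \<Rightarrow> complex"
  assumes q: "q \<in> L2_circle 2" and p_eq: "p = fcoeff q"
  defines "P \<equiv> {z. Re z \<le> pi\<^sup>2 * (of_int N)\<^sup>2 - N \<and> algebraic_multiplicity q z \<noteq> 0}"
  shows "finite P" "(\<Sum>z\<in>P. algebraic_multiplicity q z) = nat (2 * N - 1)"
    "\<And>z. z \<in> P \<Longrightarrow> Re z < pi\<^sup>2 * (of_int (N - 1))\<^sup>2 + N"
    "\<And>z. z \<in> P \<Longrightarrow> \<exists>c\<in>ell1. c \<noteq> (\<lambda>k. 0) \<and> (\<forall>k. hill_op p c k = z * c k)"
proof -
  obtain Y A :: "int \<Rightarrow> int \<Rightarrow> complex" where Y1: "\<And>l. l \<in> low \<Longrightarrow> Y l \<in> ell1"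
    and Y_single: "\<And>l m. l \<in> low \<Longrightarrow> m \<in> low \<Longrightarrow> Y l m = single l m"
    and Y_op: "\<And>u k. hill_op p (\<lambda>k. \<Sum>l\<in>low. u l * Y l k) k = (\<Sum>m\<in>low. (\<Sum>l\<in>low. u l * A m l) * Y m k)"
    and Y_root: "\<And>z m c k. Re z \<le> pi\<^sup>2 * (of_int N)\<^sup>2 - N \<Longrightarrow> c \<in> root_seq p z m \<Longrightarrow> c k = (\<Sum>l\<in>low. c l * Y l k)"
    and Y_eig: "\<And>z u c k. pi\<^sup>2 * (of_int (N - 1))\<^sup>2 + N \<le> Re z \<Longrightarrow> c = (\<lambda>k. \<Sum>l\<in>low. u l * Y l k) \<Longrightarrow>
       (\<And>k. hill_op p c k = z * c k) \<Longrightarrow> c k = 0"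
  proof (rule low_spectral_subspace, goal_cases)
    case (1 Y A)
    show ?case by (rule 1(1)) (fact 1(2) 1(3) 1(4) 1(5) 1(6))+
  qed
  define S where "S u k = (\<Sum>l\<in>low. u l * Y l k)" for u k
  define F where "F u = fseries (S u)" for u
  define A' where "A' u m = (\<Sum>l\<in>low. u l * A m l)" for u m
  have S1: "S u \<in> ell1" for u unfolding S_def by (rule ell1_sum) (auto intro: Y1)
  have S_low: "S u m = u m" if "m \<in> low" for u m
  proof -
    have "S u m = (\<Sum>l\<in>low. if l = m then u m else 0)"
      unfolding S_def by (rule sum.cong) (auto simp: Y_single that single_def)
    then show ?thesis using that by simp
  qed
  have S_op: "hill_op p (S u) = S (A' u)" for u
    using Y_op[of u] by (auto simp: S_def[abs_def] A'_def)
  have coeff_F: "fcoeff (F u) = S u" for u unfolding F_def by (rule fcoeff_fseries_fun[OF S1])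
  have S_add: "S (\<lambda>l. u l + w l) k = S u k + S w k" for u w k
    by (simp add: S_def distrib_right sum.distrib)
  have S_mult: "S (\<lambda>l. a * u l) k = a * S u k" for a u k
    by (simp add: S_def sum_distrib_left mult.assoc)
  have F_add: "F (\<lambda>l. u l + w l) = F u + F w" for u w
    by (rule ext) (simp add: F_def S_add[abs_def] fseries_add S1)
  have F_mult: "F (\<lambda>l. a * u l) = (\<lambda>x. a * F u x)" for a u
    by (rule ext) (simp add: F_def S_mult[abs_def] fseries_cmult)
  have F_eq: "F u = (\<lambda>x. \<Sum>l\<in>low. u l * fseries (Y l) x)" for u
    by (rule ext) (simp add: F_def S_def[abs_def] fseries_sum Y1)
  have F_inj: "u m = w m" if "F u = F w" "m \<in> low" for u w m
    using that coeff_F S_low by metis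
  define \<Phi> where "\<Phi> l = fseries (Y l)" for l
  define G where "G = \<Phi> ` low"
  define E where "E = cfun.span G"
  \<comment> \<open>A total function, meaningful on \<open>E\<close>: there \<open>hill_op\<close>
    again yields an l^1 sequence, by invariance of the graph.\<close>
  define T where "T f = fseries (hill_op p (fcoeff f))" for f
  have T_F: "T (F u) = F (A' u)" for u
    unfolding T_def coeff_F S_op by (simp add: F_def)
  have F_sum: "F u = (\<Sum>l\<in>low. (\<lambda>x. u l * \<Phi> l x))" for u
  proof (rule ext)
    fix x
    have "(\<Sum>l\<in>B. h l) x = (\<Sum>l\<in>B. h l x)" for B and h :: "int \<Rightarrow> real \<Rightarrow> complex"
      by (induction B rule: infinite_finite_induct) auto
    then show "F u x = (\<Sum>l\<in>low. (\<lambda>x. u l * \<Phi> l x)) x" by (simp add: F_eq \<Phi>_def)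
  qed
  have F_E: "F u \<in> E" for u
    unfolding F_sum E_def G_def by (intro cfun.span_sum cfun.span_scale cfun.span_base) auto
  have E_F: "\<exists>u. f = F u" if "f \<in> E" for f
  proof -
    have "cfun.subspace (range F)"
    proof (rule cfun.subspaceI)
      show "0 \<in> range F"
        by (rule image_eqI[where x = "\<lambda>l. 0"]) (auto simp: F_eq fun_eq_iff)
      show "f + g \<in> range F" if "f \<in> range F" "g \<in> range F" for f g
        using that by (auto simp flip: F_add)
      show "(\<lambda>x. a * f x) \<in> range F" if "f \<in> range F" for a f
        using that by (auto simp flip: F_mult)
    qed
    moreover have "G \<subseteq> range F"
    proof
      fix g assume "g \<in> G"
      then obtain l where l: "l \<in> low" "g = fseries (Y l)" by (auto simp: G_def \<Phi>_def)
      have "F (single l) x = g x" for x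
      proof -
        have "F (single l) x = (\<Sum>m\<in>low. if m = l then g x else 0)"
          unfolding F_eq by (rule sum.cong) (auto simp: l single_def)
        then show ?thesis using l(1) by simp
      qed
      then have "g = F (single l)" by auto
      then show "g \<in> range F" by blast
    qed
    ultimately show ?thesis using that cfun.span_minimal unfolding E_def by blast
  qed
  interpret complex_operator "\<lambda>(c::complex) (f::real \<Rightarrow> complex) x. c * f x" T E G
  proof
    show "finite G" by (simp add: G_def)
    show "E = cfun.span G" by (rule E_def)
    show "T x \<in> E" if "x \<in> E" for x using E_F[OF that] by (auto simp: T_F F_E)
    show "T (x + y) = T x + T y" if xy: "x \<in> E" "y \<in> E" for x y
    proof -
      obtain u w where u: "x = F u" "y = F w" using E_F xy by blast
      have "A' (\<lambda>l. u l + w l) = (\<lambda>m. A' u m + A' w m)"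
        by (auto simp: A'_def distrib_right sum.distrib)
      then show ?thesis unfolding u F_add[symmetric] T_F by simp
    qed
    show "T (\<lambda>x. c * f x) = (\<lambda>x. c * T f x)" if f: "f \<in> E" for c f
    proof -
      obtain u where u: "f = F u" using E_F f by blast
      have "A' (\<lambda>l. c * u l) = (\<lambda>m. c * A' u m)"
        by (auto simp: A'_def sum_distrib_left mult.assoc)
      then show ?thesis unfolding u F_mult[symmetric] T_F by simp
    qed
  qed
  have root: "f \<in> root_space q z k \<longleftrightarrow> f \<in> E \<and> act ([:- z, 1:] ^ k) f = 0"
    if z: "Re z \<le> pi\<^sup>2 * (of_int N)\<^sup>2 - N" for f z k
  proof (induction k arbitrary: f)
    case 0
    have "root_space q z 0 = {0}" by (simp add: zero_fun_def)
    then show ?case using E_closed(1) by auto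
  next
    case (Suc k)
    have act_Suc: "act ([:- z, 1:] ^ Suc k) f = act ([:- z, 1:] ^ k) (act [:- z, 1:] f)" if "f \<in> E" for f
      unfolding power_Suc2 by (rule act_mult[OF that])
    show ?case
    proof
      assume "f \<in> root_space q z (Suc k)"
      then obtain c where c: "f = fseries c" "c \<in> root_seq p z (Suc k)"
        unfolding root_space_eq[OF q] p_eq by blast
      then obtain d where d: "d \<in> root_seq p z k" "\<And>i. hill_op p c i = z * c i + d i" by auto
      have c1: "c \<in> ell1" and d1: "d \<in> ell1" using c(2) d(1) root_seq_ell1 by blast+
      have "S c = c" unfolding S_def by (rule ext) (rule Y_root[OF z c(2), symmetric])
      then have fE: "f \<in> E" using F_E[of c] c(1) by (simp add: F_def)
      have "T f = fseries (\<lambda>i. z * c i + d i)"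
        unfolding T_def c(1) fcoeff_fseries_fun[OF c1] d(2)[abs_def] ..
      then have "act [:- z, 1:] f = fseries d"
        unfolding act_linear by (auto simp: fun_eq_iff fseries_add ell1_cmult c1 d1 fseries_cmult c(1))
      moreover have "fseries d \<in> root_space q z k" unfolding root_space_eq[OF q] using d(1) p_eq by blast
      ultimately have "act [:- z, 1:] f \<in> root_space q z k" by (simp only:)
      then show "f \<in> E \<and> act ([:- z, 1:] ^ Suc k) f = 0"
        unfolding Suc.IH using fE act_Suc[OF fE] by metis
    next
      assume f: "f \<in> E \<and> act ([:- z, 1:] ^ Suc k) f = 0"
      then obtain u where u: "f = F u" using E_F by blast
      have "act [:- z, 1:] f \<in> E" using f by (auto intro: act_in)
      moreover have "act ([:- z, 1:] ^ k) (act [:- z, 1:] f) = 0" using f act_Suc by metis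
      ultimately have "act [:- z, 1:] f \<in> root_space q z k" unfolding Suc.IH by (rule conjI)
      then obtain d where d: "act [:- z, 1:] f = fseries d" "d \<in> root_seq p z k"
        unfolding root_space_eq[OF q] p_eq by blast
      have d1: "d \<in> ell1" by (rule root_seq_ell1[OF d(2)])
      have "T f x = z * f x + fseries d x" for x
        using fun_cong[OF d(1)[unfolded act_linear], of x] by (simp add: diff_eq_eq add.commute)
      then have "F (A' u) x = fseries (\<lambda>k. z * S u k + d k) x" for x
        unfolding u T_F by (simp add: fseries_add ell1_cmult S1 d1 fseries_cmult) (simp add: F_def)
      then have "F (A' u) = fseries (\<lambda>k. z * S u k + d k)" by auto
      then have "S (A' u) = (\<lambda>k. z * S u k + d k)"
        using coeff_F[of "A' u"] fcoeff_fseries_fun[OF ell1_add[OF ell1_cmult[OF S1] d1], of z u] by simp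
      then have "hill_op p (S u) k = z * S u k + d k" for k unfolding S_op by (rule fun_cong)
      then have "S u \<in> root_seq p z (Suc k)" using S1 d(2) by auto
      then show "f \<in> root_space q z (Suc k)"
        unfolding root_space_eq[OF q] using u p_eq by (auto simp: F_def simp del: root_seq.simps)
    qed
  qed
  have mult: "algebraic_multiplicity q z = cfun.dim (gen_eigenspace z)"
    if "Re z \<le> pi\<^sup>2 * (of_int N)\<^sup>2 - N" for z
  proof -
    have "(\<Union>k. root_space q z k) = gen_eigenspace z"
      unfolding gen_eigenspace_def using root[OF that] by blast
    then show ?thesis by (simp add: algebraic_multiplicity_def)
  qed
  have eigenvector: "\<exists>u. S u \<noteq> (\<lambda>k. 0) \<and> (\<forall>k. hill_op p (S u) k = z * S u k)"
    if "cfun.dim (gen_eigenspace z) \<noteq> 0" for z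
  proof -
    have "\<not> gen_eigenspace z \<subseteq> {0}"
    proof
      assume "gen_eigenspace z \<subseteq> {0}"
      then have "cfun.dim (gen_eigenspace z) \<le> card ({} :: (real \<Rightarrow> complex) set)"
        by (intro cfun.dim_le_card) (simp_all add: cfun.span_empty)
      then show False using that by simp
    qed
    then obtain y where y: "y \<in> E" "y \<noteq> 0" "T y = (\<lambda>x. z * y x)"
      using gen_eigenspace_zero_or_eigenvector by blast
    then obtain u where u: "y = F u" using E_F by blast
    have "F (A' u) = F (\<lambda>l. z * u l)" using y(3) unfolding u T_F F_mult .
    then have "S (A' u) = S (\<lambda>l. z * u l)" using coeff_F by metis
    then have "hill_op p (S u) k = z * S u k" for k unfolding S_op S_mult[symmetric] by (rule fun_cong)
    moreover have "S u \<noteq> (\<lambda>k. 0)"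
    proof
      assume "S u = (\<lambda>k. 0)"
      then have "y x = 0" for x unfolding u F_def by simp
      then show False using y(2) by (auto simp: fun_eq_iff)
    qed
    ultimately show ?thesis by blast
  qed
  have bound: "Re z < pi\<^sup>2 * (of_int (N - 1))\<^sup>2 + N" if "cfun.dim (gen_eigenspace z) \<noteq> 0" for z
  proof (rule ccontr)
    assume "\<not> ?thesis"
    then have z: "pi\<^sup>2 * (of_int (N - 1))\<^sup>2 + N \<le> Re z" by simp
    from eigenvector[OF that]
    obtain u where u: "S u \<noteq> (\<lambda>k. 0)" "\<And>k. hill_op p (S u) k = z * S u k" by blast
    have "S u k = 0" for k by (rule Y_eig[OF z _ u(2)]) (simp add: S_def[abs_def])
    then show False using u(1) by auto
  qed
  \<comment> \<open>Hence every eigenvalue of \<open>T\<close> on \<open>E\<close> lies below the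
    level, \<open>P\<close> contains all of them, and no multiplicity is lost in the sum.\<close>
  have levels: "pi\<^sup>2 * (of_int (N - 1))\<^sup>2 + N \<le> pi\<^sup>2 * (of_int N)\<^sup>2 - N"
  proof -
    have "2 * real_of_int N \<le> 9 * (2 * real_of_int N - 1)" using N by simp
    also have "\<dots> \<le> pi\<^sup>2 * (2 * real_of_int N - 1)" using N pi_squared_ge by (intro mult_right_mono) auto
    finally show ?thesis by (simp add: power2_eq_square algebra_simps)
  qed
  have P_eq: "P = {z. cfun.dim (gen_eigenspace z) \<noteq> 0}"
    unfolding P_def using mult bound levels by fastforce
  show "finite P" unfolding P_eq by (rule sum_dim_gen_eigenspaces(1))
  show "Re z < pi\<^sup>2 * (of_int (N - 1))\<^sup>2 + N" if "z \<in> P" for z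
    using that bound unfolding P_eq by blast
  show "\<exists>c\<in>ell1. c \<noteq> (\<lambda>k. 0) \<and> (\<forall>k. hill_op p c k = z * c k)" if "z \<in> P" for z
    using that eigenvector S1 unfolding P_eq by blast
  have inj: "inj_on \<Phi> low"
  proof (rule inj_onI)
    fix l m assume lm: "l \<in> low" "m \<in> low" "\<Phi> l = \<Phi> m"
    then have "Y l = Y m" unfolding \<Phi>_def using fcoeff_fseries_fun Y1 by metis
    then have "single l m = single m m" using lm Y_single by metis
    then show "l = m" by (auto simp: single_def split: if_splits)
  qed
  have "(\<Sum>z\<in>P. algebraic_multiplicity q z) = (\<Sum>z\<in>P. cfun.dim (gen_eigenspace z))"
    by (rule sum.cong) (auto simp: P_def mult)
  also have "\<dots> = cfun.dim E" unfolding P_eq by (rule sum_dim_gen_eigenspaces(2))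
  also have "\<dots> = card G"
  proof -
    have "cfun.independent G"
    proof
      assume "cfun.dependent G"
      then obtain u g where u: "g \<in> G" "u g \<noteq> 0" "(\<Sum>g\<in>G. (\<lambda>x. u g * g x)) = 0"
        using cfun.dependent_finite[of G] by (auto simp: G_def)
      have "F (\<lambda>l. u (\<Phi> l)) = (\<Sum>g\<in>G. (\<lambda>x. u g * g x))"
        unfolding F_sum G_def by (simp add: sum.reindex[OF inj])
      also have "\<dots> = F (\<lambda>l. 0)" unfolding u(3) by (auto simp: F_eq fun_eq_iff)
      finally have "u (\<Phi> l) = 0" if "l \<in> low" for l using F_inj that by blast
      then show False using u(1,2) by (auto simp: G_def)
    qed
    then show "cfun.dim E = card G" unfolding E_def by (rule cfun.dim_span_eq_card_independent)
  qed
  also have "\<dots> = card low" unfolding G_def by (rule card_image[OF inj])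
  also have "low = {- N<..<N}" by (auto simp: low_def)
  also have "card {- N<..<N} = nat (2 * N - 1)" using N by simp
  finally show "(\<Sum>z\<in>P. algebraic_multiplicity q z) = nat (2 * N - 1)" .
qed

subsection \<open>Listing the spectrum\<close>

lemma lex_le_refl [simp]: "lex_le z z" by (simp add: lex_le_def)

lemma lex_le_trans: "lex_le x y \<Longrightarrow> lex_le y z \<Longrightarrow> lex_le x z"
  by (auto simp: lex_le_def)

lemma lex_le_antisym: "lex_le x y \<Longrightarrow> lex_le y x \<Longrightarrow> x = y"
  by (auto simp: lex_le_def complex_eq_iff)

lemma lex_le_linear: "lex_le x y \<or> lex_le y x"
  by (auto simp: lex_le_def)

lemma finite_down_closed_nat:
  assumes "finite (D :: nat set)" "\<And>i j. j \<in> D \<Longrightarrow> i \<le> j \<Longrightarrow> i \<in> D"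
  shows "D = {..<card D}"
proof (rule card_subset_eq[OF finite_lessThan])
  show "D \<subseteq> {..<card D}"
  proof
    fix k assume "k \<in> D"
    then have "{..k} \<subseteq> D" using assms(2) by auto
    then have "card {..k} \<le> card D" by (rule card_mono[OF assms(1)])
    then show "k \<in> {..<card D}" by simp
  qed
qed simp

definition is_listing :: "(complex \<Rightarrow> nat) \<Rightarrow> (nat \<Rightarrow> complex) \<Rightarrow> bool" where
  "is_listing m \<mu> \<longleftrightarrow> (\<forall>i j. i \<le> j \<longrightarrow> lex_le (\<mu> i) (\<mu> j)) \<and> (\<forall>z. finite {k. \<mu> k = z} \<and> card {k. \<mu> k = z} = m z)"

text \<open>A set closed downwards in the order is hit by an initial segment of indices, and its
  length is the total multiplicity.\<close>

lemma listing_initial_segment: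
  assumes "is_listing m \<mu>" "finite {z \<in> P. m z \<noteq> 0}" "\<And>x y. lex_le x y \<Longrightarrow> y \<in> P \<Longrightarrow> x \<in> P"
  shows "{k. \<mu> k \<in> P} = {..<\<Sum>z | z \<in> P \<and> m z \<noteq> 0. m z}"
proof -
  have fin: "finite {k. \<mu> k = z}" and card: "card {k. \<mu> k = z} = m z" for z
    using assms(1) by (auto simp: is_listing_def)
  have "m (\<mu> k) \<noteq> 0" for k
  proof -
    have "{j. \<mu> j = \<mu> k} \<noteq> {}" by auto
    then show ?thesis using card[of "\<mu> k"] fin[of "\<mu> k"] by (metis card_0_eq)
  qed
  then have eq: "{k. \<mu> k \<in> P} = (\<Union>z\<in>{z \<in> P. m z \<noteq> 0}. {k. \<mu> k = z})" by auto
  have "{k. \<mu> k \<in> P} = {..<card {k. \<mu> k \<in> P}}"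
  proof (rule finite_down_closed_nat)
    show "finite {k. \<mu> k \<in> P}" unfolding eq using assms(2) fin by blast
    show "i \<in> {k. \<mu> k \<in> P}" if "j \<in> {k. \<mu> k \<in> P}" "i \<le> j" for i j
      using that assms(1,3) by (auto simp: is_listing_def)
  qed
  moreover have "card {k. \<mu> k \<in> P} = (\<Sum>z | z \<in> P \<and> m z \<noteq> 0. m z)"
    unfolding eq using assms(2) fin by (subst card_UN_disjoint) (auto simp: card)
  ultimately show ?thesis by simp
qed

text \<open>\<open>Lo z\<close> and \<open>Hi z\<close> count the values strictly before z and up to
  z; the intervals from \<open>Lo z\<close> to \<open>Hi z\<close> tile the natural numbers, so the
  entry at k must be the z whose interval contains k.\<close>

lemma listing_unique_exists:
  assumes fin: "\<And>x. finite {z. Re z \<le> x \<and> m z \<noteq> 0}"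
    and unbounded: "\<And>k. \<exists>x. k < (\<Sum>z | Re z \<le> x \<and> m z \<noteq> 0. m z)"
  shows "\<exists>!\<mu>. is_listing m \<mu>"
proof -
  define L where "L z = {y. lex_le y z \<and> y \<noteq> z}" for z
  define Lo where "Lo z = (\<Sum>y | y \<in> L z \<and> m y \<noteq> 0. m y)" for z
  define Hi where "Hi z = (\<Sum>y | y \<in> {y. lex_le y z} \<and> m y \<noteq> 0. m y)" for z
  have finle: "finite {y. lex_le y z \<and> m y \<noteq> 0}" for z
    by (rule finite_subset[OF _ fin[of "Re z"]]) (auto simp: lex_le_def)
  have finL: "finite {y \<in> L z. m y \<noteq> 0}" for z
    by (rule finite_subset[OF _ finle[of z]]) (auto simp: L_def)
  have Hi: "Hi z = Lo z + m z" for z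
  proof (cases "m z = 0")
    case True
    then have "{y. y \<in> {y. lex_le y z} \<and> m y \<noteq> 0} = {y. y \<in> L z \<and> m y \<noteq> 0}" by (auto simp: L_def)
    then show ?thesis using True by (simp add: Hi_def Lo_def)
  next
    case False
    then have "{y. y \<in> {y. lex_le y z} \<and> m y \<noteq> 0} = insert z {y. y \<in> L z \<and> m y \<noteq> 0}" by (auto simp: L_def)
    then show ?thesis using finL by (simp add: Hi_def Lo_def L_def)
  qed
  have L_mono: "Hi z \<le> Lo z'" if "lex_le z z'" "z \<noteq> z'" for z z'
    unfolding Hi_def Lo_def
    by (rule sum_mono2) (use that finL[of z'] in \<open>auto simp: L_def intro: lex_le_trans dest: lex_le_antisym\<close>)
  have cover: "\<exists>z. Lo z \<le> k \<and> k < Hi z" for k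
  proof -
    obtain x where x: "k < (\<Sum>z | Re z \<le> x \<and> m z \<noteq> 0. m z)" using unbounded by blast
    define Z where "Z = {z. Re z \<le> x \<and> m z \<noteq> 0}"
    define s where "s = (\<Sum>z\<in>Z. m z)"
    have finZ: "finite Z" unfolding Z_def by (rule fin)
    have sub: "{Lo z..<Hi z} \<subseteq> {..<s}" if "z \<in> Z" for z
    proof -
      have "Hi z \<le> s" unfolding Hi_def s_def
        by (rule sum_mono2[OF finZ]) (use that in \<open>auto simp: Z_def lex_le_def\<close>)
      then show ?thesis by auto
    qed
    have disj: "{Lo z..<Hi z} \<inter> {Lo y..<Hi y} = {}" if "z \<noteq> y" for z y
      using L_mono[of z y] L_mono[of y z] lex_le_linear[of z y] that by fastforce
    \<comment> \<open>By counting: disjoint intervals inside a set of s elements whose lengths add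
      up to s leave no gap.\<close>
    have "(\<Union>z\<in>Z. {Lo z..<Hi z}) = {..<s}"
    proof (rule card_subset_eq)
      have "card (\<Union>z\<in>Z. {Lo z..<Hi z}) = (\<Sum>z\<in>Z. card {Lo z..<Hi z})"
        using finZ disj by (intro card_UN_disjoint) auto
      then show "card (\<Union>z\<in>Z. {Lo z..<Hi z}) = card {..<s}" by (simp add: Hi s_def)
    qed (use sub in auto)
    moreover have "k < s" using x by (simp add: s_def Z_def)
    ultimately have "k \<in> (\<Union>z\<in>Z. {Lo z..<Hi z})" by simp
    then show ?thesis by auto
  qed
  then obtain \<mu> where \<mu>: "\<And>k. Lo (\<mu> k) \<le> k \<and> k < Hi (\<mu> k)" by metis
  have iff: "\<mu> k = z \<longleftrightarrow> Lo z \<le> k \<and> k < Hi z" for k z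
    using \<mu>[of k] L_mono[of z "\<mu> k"] L_mono[of "\<mu> k" z] lex_le_linear[of z "\<mu> k"] by fastforce
  show ?thesis
  proof (rule ex1I)
    show "is_listing m \<mu>"
      unfolding is_listing_def
    proof (intro conjI allI impI)
      fix i j :: nat assume "i \<le> j"
      show "lex_le (\<mu> i) (\<mu> j)"
      proof (rule ccontr)
        assume "\<not> ?thesis"
        then have "lex_le (\<mu> j) (\<mu> i)" "\<mu> j \<noteq> \<mu> i" using lex_le_linear[of "\<mu> i" "\<mu> j"] by auto
        from L_mono[OF this] show False using \<mu>[of i] \<mu>[of j] \<open>i \<le> j\<close> by linarith
      qed
    next
      fix z
      have "{k. \<mu> k = z} = {Lo z..<Hi z}" using iff by auto
      then show "finite {k. \<mu> k = z}" "card {k. \<mu> k = z} = m z" by (simp_all add: Hi)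
    qed
    fix \<nu> assume \<nu>: "is_listing m \<nu>"
    have iff': "\<nu> k = z \<longleftrightarrow> Lo z \<le> k \<and> k < Hi z" for k z
    proof -
      have "{k. \<nu> k \<in> L z} = {..<Lo z}"
        unfolding Lo_def
        by (rule listing_initial_segment[OF \<nu> finL]) (auto simp: L_def intro: lex_le_trans dest: lex_le_antisym)
      moreover have "{k. \<nu> k \<in> {y. lex_le y z}} = {..<Hi z}"
        unfolding Hi_def
        by (rule listing_initial_segment[OF \<nu>]) (use finle in \<open>auto intro: lex_le_trans\<close>)
      ultimately have "\<nu> k \<in> L z \<longleftrightarrow> k < Lo z" "lex_le (\<nu> k) z \<longleftrightarrow> k < Hi z" by auto
      then show ?thesis by (auto simp: L_def)
    qed
    show "\<nu> = \<mu>"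
    proof (rule ext)
      fix k
      show "\<nu> k = \<mu> k" unfolding iff' using iff[of k "\<mu> k"] by simp
    qed
  qed
qed

subsection \<open>The exponent\<close>

text \<open>By superexponential growth all quotients from some M on are at least the one for m = 1,
  so the minimum is one over a finite set and the value given by \<open>LEAST\<close> is genuine.
  Nonnegativity uses r >= 1 and w >= 1.\<close>

lemma psi_attained:
  assumes w: "normalized_weight w" and sup: "strictly_superexponential w" and r: "1 \<le> r"
  shows "0 \<le> psi w r" "\<And>m::nat. 1 \<le> m \<Longrightarrow> exp (psi w r * m) \<le> r * w (int m)"
proof -
  define f where "f m = ln (r * w (int m)) / real m" for m :: nat
  have w1: "1 \<le> w k" for k using w by (simp add: normalized_weight_def)
  have rw1: "1 \<le> r * w k" for k using mult_mono[OF r w1[of k]] r by simp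
  have f0: "0 \<le> f m" for m using rw1 by (simp add: f_def)
  have "\<forall>\<^sub>F m in sequentially. f 1 \<le> ln (w (int m)) / real m"
    using sup unfolding strictly_superexponential_def filterlim_at_top by blast
  then obtain M where M: "\<And>m. M \<le> m \<Longrightarrow> f 1 \<le> ln (w (int m)) / real m"
    by (auto simp: eventually_sequentially)
  have f_ge: "f 1 \<le> f m" if "M \<le> m" for m
  proof -
    have "w (int m) \<le> r * w (int m)" using r w1[of "int m"] by simp
    then have "ln (w (int m)) \<le> ln (r * w (int m))"
      using w1[of "int m"] by (intro ln_mono) auto
    then have "ln (w (int m)) / real m \<le> f m" unfolding f_def by (intro divide_right_mono) auto
    then show ?thesis using M[OF that] by linarith
  qed
  define S where "S = f ` {1..Suc M}"
  have S: "finite S" "S \<noteq> {}" by (auto simp: S_def)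
  have f1: "f 1 \<in> S" by (auto simp: S_def)
  have min_le: "Min S \<le> f m" if "1 \<le> m" for m
  proof (cases "m \<le> M")
    case True
    then show ?thesis using that S by (intro Min_le) (auto simp: S_def)
  next
    case False
    then show ?thesis using Min_le[OF S(1) f1] f_ge[of m] by linarith
  qed
  have psi: "psi w r = Min S"
    unfolding psi_def
  proof (rule Least_equality)
    have "Min S \<in> S" by (rule Min_in[OF S])
    then show "\<exists>m::nat. 1 \<le> m \<and> Min S = ln (r * w (int m)) / real m"
      unfolding S_def f_def by (metis (mono_tags, lifting) atLeastAtMost_iff imageE)
    show "Min S \<le> y" if "\<exists>m::nat. 1 \<le> m \<and> y = ln (r * w (int m)) / real m" for y
      using that min_le by (auto simp: f_def)
  qed
  show "0 \<le> psi w r"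
    unfolding psi using Min_in[OF S] f0 by (auto simp: S_def)
  show "exp (psi w r * m) \<le> r * w (int m)" if "1 \<le> m" for m :: nat
  proof -
    have "psi w r * m \<le> f m * m" unfolding psi using min_le[OF that] by (intro mult_right_mono) auto
    also have "\<dots> = ln (r * w (int m))" using that by (simp add: f_def)
    finally have "exp (psi w r * m) \<le> exp (ln (r * w (int m)))" by simp
    then show ?thesis using rw1[of "int m"] by simp
  qed
qed

text \<open>Covers weighted norm 0: the argument n / 0 is then 0, and ln 0 = 0.\<close>

lemma psi_zero: "psi w 0 = 0"
  unfolding psi_def by (rule Least_equality) auto

lemma weighted_coefficients_le:
  assumes w: "normalized_weight w" and sup: "strictly_superexponential w" and q: "q \<in> weighted_space w"
    and n: "4 * weighted_norm w q \<le> real n" and n1: "1 \<le> n"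
  defines "a \<equiv> psi w (real n / (4 * weighted_norm w q))"
  shows "0 \<le> a" "ell2_le (\<lambda>k. of_real (exp (a * \<bar>of_int k\<bar> / 2)) * fcoeff q k) (n / 4)"
proof -
  define W where "W = weighted_norm w q"
  define g where "g j = (w j)\<^sup>2 * (norm (fourier_coeff q j))\<^sup>2" for j
  have g: "g summable_on UNIV" using q by (simp add: weighted_space_def g_def[abs_def])
  have g0: "0 \<le> g j" for j by (simp add: g_def)
  have W2: "W\<^sup>2 = infsum g UNIV"
    unfolding W_def weighted_norm_def g_def[symmetric]
    by (rule real_sqrt_pow2) (rule infsum_nonneg, simp add: g0)
  have W0: "0 \<le> W" by (simp add: W_def weighted_norm_def infsum_nonneg)
  have w1: "1 \<le> w j" for j using w by (simp add: normalized_weight_def)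
  have w_abs: "w j = w (int (nat \<bar>j\<bar>))" for j
    using w by (cases "0 \<le> j") (auto simp: normalized_weight_def)
  \<comment> \<open>The inequality exp (a |j|) <= (n / 4W) w_j, squared and cleared of its
    denominator so that it also makes sense for W = 0.\<close>
  have a_exp: "0 \<le> a \<and> (\<forall>j. (exp (a * \<bar>of_int j\<bar>))\<^sup>2 * (norm (fourier_coeff q j))\<^sup>2 * (16 * W\<^sup>2) \<le> (real n)\<^sup>2 * g j
      \<and> (W = 0 \<longrightarrow> fourier_coeff q j = 0))"
  proof (cases "W = 0")
    case True
    then have "a = 0" by (simp add: a_def W_def[symmetric] psi_zero)
    moreover have "fourier_coeff q j = 0" for j
    proof -
      have "g j \<le> infsum g UNIV"
        using finite_sum_le_infsum[OF g, of "{j}"] g0 by simp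
      then have "g j = 0" using g0[of j] True W2 by simp
      then show ?thesis using w1[of j] by (simp add: g_def)
    qed
    ultimately show ?thesis by (simp add: g0)
  next
    case False
    define r where "r = real n / (4 * W)"
    have W: "0 < W" using False W0 by simp
    have r: "1 \<le> r" using n W by (simp add: r_def W_def)
    have a: "a = psi w r" by (simp add: a_def r_def W_def)
    have e: "exp (a * \<bar>of_int j\<bar>) \<le> r * w j" for j
    \<comment> \<open>The minimum defining psi omits m = 0; that index is covered by r >= 1, which
      is the assumption n >= 4W.\<close>
    proof (cases "j = 0")
      case True
      then show ?thesis using mult_mono[OF r w1[of 0]] r by simp
    next
      case False
      then show ?thesis
        using psi_attained(2)[OF w sup r, of "nat \<bar>j\<bar>"] w_abs[of j] by (simp add: a)
    qed
    have "(exp (a * \<bar>of_int j\<bar>))\<^sup>2 * (norm (fourier_coeff q j))\<^sup>2 * (16 * W\<^sup>2) \<le> (real n)\<^sup>2 * g j" for j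
    proof -
      have "(exp (a * \<bar>of_int j\<bar>))\<^sup>2 \<le> (r * w j)\<^sup>2" using e by (intro power_mono) auto
      then have "(exp (a * \<bar>of_int j\<bar>))\<^sup>2 * ((norm (fourier_coeff q j))\<^sup>2 * (16 * W\<^sup>2))
          \<le> (r * w j)\<^sup>2 * ((norm (fourier_coeff q j))\<^sup>2 * (16 * W\<^sup>2))"
        by (intro mult_right_mono) auto
      also have "\<dots> = (real n)\<^sup>2 * g j"
        using W by (simp add: r_def g_def power_mult_distrib power_divide)
      finally show ?thesis by (simp add: mult.assoc)
    qed
    then show ?thesis using psi_attained(1)[OF w sup r] False by (simp add: a)
  qed
  then show a0: "0 \<le> a" by blast
  have q1: "q \<in> L2_circle 1" using q by (simp add: weighted_space_def)
  show "ell2_le (\<lambda>k. of_real (exp (a * \<bar>of_int k\<bar> / 2)) * fcoeff q k) (n / 4)"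
    unfolding ell2_le_def
  proof (intro allI impI)
    fix H :: "int set" assume H: "finite H"
    define t where "t k = (norm (complex_of_real (exp (a * \<bar>of_int k\<bar> / 2)) * fcoeff q k))\<^sup>2" for k
    define J where "J = {k \<in> H. even k}"
    have tJ: "t k = (exp (a * \<bar>of_int (k div 2)\<bar>))\<^sup>2 * (norm (fourier_coeff q (k div 2)))\<^sup>2" if ev: "even k" for k
    proof -
      obtain j where j: "k = 2 * j" using ev by auto
      show ?thesis
        using fcoeff_double[OF q1, of k] j
        by (simp add: t_def norm_mult power_mult_distrib abs_mult)
    qed
    have t_odd: "t k = 0" if "odd k" for k using fcoeff_double[OF q1, of k] that by (simp add: t_def)
    have sum_t: "(\<Sum>k\<in>H. t k) \<le> (n / 4)\<^sup>2"
    proof (cases "W = 0")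
      case True
      then have "t k = 0" for k using a_exp tJ[of k] t_odd[of k] by (cases "even k") auto
      then show ?thesis by simp
    next
      case False
      have "(\<Sum>k\<in>H. t k) * (16 * W\<^sup>2) = (\<Sum>k\<in>J. t k * (16 * W\<^sup>2))"
        unfolding sum_distrib_right
        by (rule sum.mono_neutral_right) (use H t_odd in \<open>auto simp: J_def\<close>)
      also have "\<dots> \<le> (\<Sum>k\<in>J. (real n)\<^sup>2 * g (k div 2))"
        using a_exp by (intro sum_mono) (auto simp: J_def tJ)
      also have "\<dots> = (real n)\<^sup>2 * (\<Sum>j\<in>(\<lambda>k. k div 2) ` J. g j)"
        by (subst sum.reindex) (auto simp: inj_on_def J_def sum_distrib_left elim!: evenE)
      also have "\<dots> \<le> (real n)\<^sup>2 * W\<^sup>2"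
        unfolding W2 using H g0 by (intro mult_left_mono finite_sum_le_infsum[OF g]) (auto simp: J_def)
      finally have "(\<Sum>k\<in>H. t k) * 16 * W\<^sup>2 \<le> (real n)\<^sup>2 * W\<^sup>2" by simp
      then have "(\<Sum>k\<in>H. t k) * 16 \<le> (real n)\<^sup>2" using False by simp
      then show ?thesis by (simp add: power_divide)
    qed
    then show "L2_set (\<lambda>k. norm (complex_of_real (exp (a * \<bar>of_int k\<bar> / 2)) * fcoeff q k)) H \<le> n / 4"
      unfolding L2_set_def t_def[symmetric] by (intro real_le_lsqrt) (auto simp: sum_nonneg t_def)
  qed
qed

section \<open>The gap estimate\<close>

theorem theorem6:
  fixes w :: "int \<Rightarrow> real" and q :: "real \<Rightarrow> complex" and n :: nat
  assumes "normalized_weight w"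
    and "strictly_superexponential w"
    and "q \<in> weighted_space w"
    and "\<not> (AE x in lebesgue. q x = 0)"
    and "n \<ge> 1"
    and "real n \<ge> 4 * weighted_norm w q"
  shows "cmod (gap_length q n)
           \<le> 2 * real n * exp (- real n * psi w (real n / (4 * weighted_norm w q)))"
proof -
  define a where "a = psi w (real n / (4 * weighted_norm w q))"
  define p where "p = fcoeff q"
  have q2: "q \<in> L2_circle 2"
    using assms(3) by (intro L2_circle_double) (simp add: weighted_space_def)
  have a: "0 \<le> a" "ell2_le (\<lambda>k. of_real (exp (a * \<bar>of_int k\<bar> / 2)) * p k) (n / 4)"
    using weighted_coefficients_le[OF assms(1-3) assms(6) assms(5)] by (auto simp: a_def p_def)
  interpret hill_gap p a "real n / 4" "int n"
    by unfold_locales (use a assms(5) in auto)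
  have level: "hill_level p (real n / 4) (int N)" if "n \<le> N" for N
    by unfold_locales (use p that assms(5) in auto)
  define \<beta> where "\<beta> N = pi\<^sup>2 * (real N)\<^sup>2 - real N" for N :: nat
  define m where "m = algebraic_multiplicity q"
  have P: "finite {z. Re z \<le> \<beta> N \<and> m z \<noteq> 0}" "(\<Sum>z | Re z \<le> \<beta> N \<and> m z \<noteq> 0. m z) = 2 * N - 1"
    "\<And>z. Re z \<le> \<beta> N \<Longrightarrow> m z \<noteq> 0 \<Longrightarrow> Re z < pi\<^sup>2 * (real N - 1)\<^sup>2 + N"
    "\<And>z. Re z \<le> \<beta> N \<Longrightarrow> m z \<noteq> 0 \<Longrightarrow> \<exists>c\<in>ell1. c \<noteq> (\<lambda>k. 0) \<and> (\<forall>k. hill_op p c k = z * c k)"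
    if N: "n \<le> N" for N
  proof -
    note C = hill_level.count_eigenvalues[OF level[OF N] q2 p_def]
    show "finite {z. Re z \<le> \<beta> N \<and> m z \<noteq> 0}" using C(1) by (simp add: \<beta>_def m_def)
    show "(\<Sum>z | Re z \<le> \<beta> N \<and> m z \<noteq> 0. m z) = 2 * N - 1"
      using C(2) N assms(5) by (simp add: \<beta>_def m_def nat_diff_distrib nat_mult_distrib)
    show "Re z < pi\<^sup>2 * (real N - 1)\<^sup>2 + N" if "Re z \<le> \<beta> N" "m z \<noteq> 0" for z
      using C(3)[of z] that by (simp add: \<beta>_def m_def)
    show "\<exists>c\<in>ell1. c \<noteq> (\<lambda>k. 0) \<and> (\<forall>k. hill_op p c k = z * c k)" if "Re z \<le> \<beta> N" "m z \<noteq> 0" for z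
      using C(4)[of z] that by (simp add: \<beta>_def m_def)
  qed
  have \<beta>_ge: "real N \<le> \<beta> N" for N
  proof -
    have "real N \<le> (real N)\<^sup>2" by (cases N) (auto simp: power2_eq_square)
    moreover have "9 * (real N)\<^sup>2 \<le> pi\<^sup>2 * (real N)\<^sup>2"
      using pi_gt3 power_mono[of 3 pi 2] by (intro mult_right_mono) auto
    ultimately show ?thesis unfolding \<beta>_def by (smt (verit) zero_le_power2)
  qed
  have "\<exists>!\<mu>. is_listing m \<mu>"
  proof (rule listing_unique_exists)
    fix x :: real
    obtain N where "max x (real n) \<le> real N" using real_arch_simple by blast
    then have "n \<le> N" "x \<le> \<beta> N" using \<beta>_ge[of N] by auto
    then show "finite {z. Re z \<le> x \<and> m z \<noteq> 0}"
      by (intro finite_subset[OF _ P(1)[of N]]) auto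
  next
    fix k :: nat
    have "k < (\<Sum>z | Re z \<le> \<beta> (n + k + 1) \<and> m z \<noteq> 0. m z)"
      using P(2)[of "n + k + 1"] by simp
    then show "\<exists>x. k < (\<Sum>z | Re z \<le> x \<and> m z \<noteq> 0. m z)" by blast
  qed
  moreover have "is_spectrum_listing q = is_listing m"
    by (rule ext) (simp add: is_spectrum_listing_def is_listing_def m_def)
  ultimately have \<mu>: "is_listing m (spectrum_listing q)"
    unfolding spectrum_listing_def by (metis theI')
  define \<mu> where "\<mu> = spectrum_listing q"
  \<comment> \<open>The half plane up to \<open>\<beta> N\<close> is closed downwards in the
    lexicographic order, so the count turns into a statement about indices.\<close>
  have low: "Re (\<mu> k) \<le> \<beta> N \<longleftrightarrow> k < 2 * N - 1" if "n \<le> N" for k N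
  proof -
    have "{k. \<mu> k \<in> {z. Re z \<le> \<beta> N}} = {..<\<Sum>z | z \<in> {z. Re z \<le> \<beta> N} \<and> m z \<noteq> 0. m z}"
      using \<mu> P(1)[OF that] unfolding \<mu>_def
      by (intro listing_initial_segment) (auto simp: lex_le_def)
    then show ?thesis using P(2)[OF that] by auto
  qed
  have mult: "m (\<mu> k) \<noteq> 0" for k
  proof -
    have "finite {j. \<mu> j = \<mu> k}" "card {j. \<mu> j = \<mu> k} = m (\<mu> k)"
      using \<mu> by (auto simp: is_listing_def \<mu>_def)
    moreover have "k \<in> {j. \<mu> j = \<mu> k}" by simp
    ultimately show ?thesis by (metis card_0_eq empty_iff)
  qed
  have pair: "\<mu> k \<in> strip \<and> (\<exists>c\<in>ell1. c \<noteq> (\<lambda>k. 0) \<and> (\<forall>i. hill_op p c i = \<mu> k * c i))"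
    if k: "k = 2 * n - 1 \<or> k = 2 * n" for k
  proof -
    \<comment> \<open>Indices start at 0, so level n holds exactly the indices below 2n - 1 and
      level n + 1 those below 2n + 1; the difference is the pair in question.\<close>
    have 1: "\<not> Re (\<mu> k) \<le> \<beta> n" using low[of n k] k by auto
    have 2: "Re (\<mu> k) \<le> \<beta> (n + 1)" using low[of "n + 1" k] k by auto
    have "Re (\<mu> k) < pi\<^sup>2 * (real n)\<^sup>2 + (real n + 1)"
      using P(3)[of "n + 1" "\<mu> k"] 2 mult by simp
    moreover have "pi\<^sup>2 * (real n)\<^sup>2 - real n < Re (\<mu> k)" using 1 by (simp add: \<beta>_def)
    \<comment> \<open>The margins are n below and n + 1 above, both at most 2n as n >= 1; this is
      why the strip has half-width 2n.\<close>
    ultimately have "\<mu> k \<in> strip" using assms(5) by (auto simp: strip_def abs_le_iff)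
    moreover have "\<exists>c\<in>ell1. c \<noteq> (\<lambda>k. 0) \<and> (\<forall>i. hill_op p c i = \<mu> k * c i)"
      using P(4)[of "n + 1" "\<mu> k"] 2 mult by simp
    ultimately show ?thesis by blast
  qed
  have s: "\<mu> (2 * n) \<in> strip" "\<mu> (2 * n - 1) \<in> strip" using pair by blast+
  obtain c c' where "c \<in> ell1" "c \<noteq> (\<lambda>k. 0)" "\<And>i. hill_op p c i = \<mu> (2 * n) * c i"
    "c' \<in> ell1" "c' \<noteq> (\<lambda>k. 0)" "\<And>i. hill_op p c' i = \<mu> (2 * n - 1) * c' i"
    using pair[of "2 * n"] pair[of "2 * n - 1"] by blast
  from eigenvalue_distance[OF s(1) this(1-3) s(2) this(4-6)]
  show ?thesis
    unfolding gap_length_def lambda_plus_def lambda_minus_def \<mu>_def[symmetric] a_def[symmetric]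
    by (simp add: mult.commute)
qed

end
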